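(* Let $m\ge0$, let $\alpha\in(0,\pi/2)$ and assume that $V$ satisfies the following hypothesis for this $\alpha$: (a) $V:\Sigma_\alpha\cup(-\Sigma_\alpha)\to\mathbb{C}^{2\times2}$ is a bounded analytic function; (b) the restriction of $V$ to the real axis is Hermitian-valued; (c) for each $\beta\in(0,\alpha)$ the functions $V(e^{i\varphi}\cdot)$, $|\varphi|\le\beta$, are in $L^1(\mathbb{R},\mathbb{C}^{2\times2})$ with uniformly bounded $L^1$-norms. Let $H=H_0+V$, let $\mathcal{R}(H)$ be its set of resonances and $D_\theta$ the region defined in the context. For $v\in[0,1)$ put $$x[v]:=\sqrt{\frac{v^4-2v^2+2}{4(1-v^2)}+\frac12},\qquad r[v]:=\sqrt{\frac{v^4-2v^2+2}{4(1-v^2)}-\frac12},$$ and for $\operatorname{Im}\theta\in[0,\alpha)$ put $$v_\theta:=\inf_{\operatorname{Im}\theta\le\varphi<\alpha}\|V(e^{i\varphi}\cdot)\|_1 .$$ i) If $\operatorname{Im}\theta\in[0,\alpha)$ and $v_\theta<1$, then, with $x_\theta:=x[v_\theta]$ and $r_\theta:=r[v_\theta]$, the disks $K_{mr_\theta}(mx_\theta)$ and $K_{mr_\theta}(-mx_\theta)$ are disjoint and $$\mathcal{R}(H)\cap D_\theta\subset K_{mr_\theta}(mx_\theta)\cup K_{mr_\theta}(-mx_\theta).$$ ii) If $V$ is scalar-valued and sign-definite (on the real axis), then $v_\theta=\|V(e^{i\operatorname{Im}\theta}\cdot)\|_1$ in i). iii) Assume that $\|V\|_1<1$. Then all eigenvalues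 of $H$ (including the embedded ones) are contained in the union of the disjoint intervals $$\big(-m(x_0+r_0),-m(x_0-r_0)\big)\cup\big(m(x_0-r_0),m(x_0+r_0)\big),$$ where $x_0:=x[\|V\|_1]$, $r_0:=r[\|V\|_1]$. iv) If $m=0$ and $\|V\|_1<1$, then, setting $$\varphi_0:=\sup\{\operatorname{Im}\theta\in[0,\alpha):v_\theta<1\},$$ one has $\varphi_0>0$ and $$\mathcal{R}(H)\cap\left\{\pm\sqrt{e^{-2\omega}p^2+m^2}:p\in\mathbb{R},\ \operatorname{Im}\omega\in[0,\varphi_0]\right\}=\emptyset .$$
   Context: Units are chosen so that $\hbar=c=1$. The Hilbert space is $\mathcal{H}=L^2(\mathbb{R})\otimes\mathbb{C}^2=L^2(\mathbb{R};\mathbb{C}^2)$. The free Dirac operator is the selfadjoint operator $H_0=-i\frac{d}{dx}\sigma_1+m\sigma_3$ with domain $H^1(\mathbb{R};\mathbb{C}^2)$, where $\sigma_1=\begin{pmatrix}0&1\\1&0\end{pmatrix}$, $\sigma_3=\begin{pmatrix}1&0\\0&-1\end{pmatrix}$. Matrix functions on $\mathbb{R}$ are identified with multiplication operators in $\mathcal{H}$; "scalar-valued" means a scalar function times the identity matrix. For $\alpha\in(0,\pi/2)$, $\Sigma_\alpha:=\{z\in\mathbb{C}\setminus\{0\}:|\arg z|<\alpha\}$, $-\pi<\arg z<\pi$. $\|V(e^{i\varphi}\cdot)\|_1=\int_{\mathbb{R}}\|V(e^{i\varphi}x)\|\,dx$ and $\|V\|_1=\int_{\mathbb{R}}\|V(x)\|\,dx$,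 with $\|\cdot\|$ the operator norm of matrices on Euclidean $\mathbb{C}^2$. Complex-dilated operators: for $\theta\in S_\alpha:=\{\theta\in\mathbb{C}:|\operatorname{Im}\theta|<\alpha\}$, $H_0(\theta)=-ie^{-\theta}\frac{d}{dx}\sigma_1+m\sigma_3$ on $H^1(\mathbb{R};\mathbb{C}^2)$, $V(\theta)=V(e^\theta\cdot)$, $H(\theta)=H_0(\theta)+V(\theta)$; for real $\theta$ these are $U(\theta)H_0U(\theta)^{-1}$, $U(\theta)VU(\theta)^{-1}$, $U(\theta)HU(\theta)^{-1}$ with the unitary dilation $(U(\theta)f)(x)=e^{\theta/2}f(e^\theta x)$. For $\operatorname{Im}\theta\in[0,\alpha)$, $$D_\theta:=\{\pm\sqrt{e^{-2\omega}p^2+m^2}:p\in\mathbb{R},\ \operatorname{Im}\omega\in[0,\operatorname{Im}\theta]\}.$$ Resonances: the resolvent $(H-z)^{-1}$ has a (many-sheeted) analytic continuation to the sets $\rho(H(\theta))$, $\operatorname{Im}\theta\in(0,\alpha)$; the poles of the continued resolvent are called the resonances of $H$, and they are located precisely at the (discrete) eigenvalues of $H(\theta)$. Thus the set $\mathcal{R}(H)$ of resonances is $\mathcal{R}(H)=\bigcup_{0<\operatorname{Im}\theta<\alpha}\sigma_{\rm d}(H(\theta))$, where $\sigma_{\rm d}(T)$ denotes the set of isolated eigenvalues of finite multiplicity of $T$. $K_r(z_0)$ is the closed disk in $\mathbb{C}$ with centre $z_0$ and radius $r>0$; by convention $K_r(z_0)=\emptyset$ if $r=0$. *)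

theory Defs
  imports "HOL-Analysis.Analysis"
begin

text \<open>
  Elements of the Hilbert space are represented by Borel measurable square-integrable functions;
  two functions that agree Lebesgue almost everywhere represent the same element.
\<close>

definition L2 :: "(real \<Rightarrow> complex^2) set" where
  "L2 = {f. f \<in> borel_measurable lborel \<and> integrable lborel (\<lambda>x. (norm (f x))\<^sup>2)}"

definition L2_norm :: "(real \<Rightarrow> complex^2) \<Rightarrow> real" where
  "L2_norm f = sqrt (\<integral>x. (norm (f x))\<^sup>2 \<partial>lborel)"

text \<open>
  Membership in the Sobolev space \<open>H\<^sup>1\<close> together with the derivative: \<open>f\<close> and \<open>f'\<close> are in \<open>L\<^sup>2\<close>, and
  \<open>f\<close> has a locally absolutely continuous representative \<open>F\<close>, that is, an indefinite Lebesgue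
  integral, with derivative \<open>f'\<close>.
\<close>

definition has_H1_derivative :: "(real \<Rightarrow> complex^2) \<Rightarrow> (real \<Rightarrow> complex^2) \<Rightarrow> bool" where
  "has_H1_derivative f f' \<longleftrightarrow> f \<in> L2 \<and> f' \<in> L2 \<and>
     (\<exists>F. (AE x in lborel. f x = F x) \<and>
          (\<forall>a b. a \<le> b \<longrightarrow> F b - F a = (LINT x:{a..b}|lborel. f' x)))"

text \<open>
  An unbounded linear operator is given by its graph: \<open>T f h\<close> means that \<open>f\<close> lies in the domain and
  that \<open>h\<close> represents the image of \<open>f\<close>.  The graphs used below are closed under changing \<open>f\<close>
  and \<open>h\<close> within \<open>L2\<close> on null sets.
\<close>

type_synonym operator_graph = "(real \<Rightarrow> complex^2) \<Rightarrow> (real \<Rightarrow> complex^2) \<Rightarrow> bool"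

text \<open>
  \<open>T - z\<close> maps the domain bijectively onto \<open>L\<^sup>2\<close> and the inverse is bounded.
\<close>

definition resolvent_set :: "operator_graph \<Rightarrow> complex set" where
  "resolvent_set T = {z.
     (\<forall>f. T f (\<lambda>x. z *s f x) \<longrightarrow> (AE x in lborel. f x = 0)) \<and>
     (\<forall>h\<in>L2. \<exists>f. T f (\<lambda>x. h x + z *s f x)) \<and>
     (\<exists>C. \<forall>f h. h \<in> L2 \<longrightarrow> T f (\<lambda>x. h x + z *s f x) \<longrightarrow> L2_norm f \<le> C * L2_norm h)}"

definition op_spectrum :: "operator_graph \<Rightarrow> complex set" where
  "op_spectrum T = - resolvent_set T"

definition is_eigenvalue :: "operator_graph \<Rightarrow> complex \<Rightarrow> bool" where
  "is_eigenvalue T z \<longleftrightarrow> (\<exists>f. T f (\<lambda>x. z *s f x) \<and> \<not> (AE x in lborel. f x = 0))"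

primrec gen_kernel :: "operator_graph \<Rightarrow> complex \<Rightarrow> nat \<Rightarrow> (real \<Rightarrow> complex^2) set" where
  "gen_kernel T z 0 = {f \<in> L2. AE x in lborel. f x = 0}"
| "gen_kernel T z (Suc n) = {f. \<exists>h. T f h \<and> (\<lambda>x. h x - z *s f x) \<in> gen_kernel T z n}"

text \<open>
  Multiplicity is algebraic: the root subspace \<open>\<Union>\<^sub>n ker (T - z)\<^sup>n\<close> is spanned, modulo null
  functions, by finitely many functions.
\<close>

definition finite_multiplicity :: "operator_graph \<Rightarrow> complex \<Rightarrow> bool" where
  "finite_multiplicity T z \<longleftrightarrow>
     (\<exists>(N::nat) b. \<forall>n. \<forall>f\<in>gen_kernel T z n. \<exists>c.
        AE x in lborel. f x = (\<Sum>i<N. c i *s b i x))"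

definition discrete_spectrum :: "operator_graph \<Rightarrow> complex set" where
  "discrete_spectrum T =
     {z. is_eigenvalue T z \<and> z isolated_in op_spectrum T \<and> finite_multiplicity T z}"

definition sigma1 :: "complex^2^2" where
  "sigma1 = vector [vector [0, 1], vector [1, 0]]"

definition sigma3 :: "complex^2^2" where
  "sigma3 = vector [vector [1, 0], vector [0, -1]]"

definition free_dirac :: "real \<Rightarrow> complex \<Rightarrow> operator_graph" where
  "free_dirac m \<theta> f h \<longleftrightarrow> h \<in> L2 \<and> (\<exists>f'. has_H1_derivative f f' \<and>
     (AE x in lborel. h x = (- \<i> * exp (- \<theta>)) *s (sigma1 *v f' x) + of_real m *s (sigma3 *v f x)))"

text \<open>
  \<open>H(\<theta>) = H\<^sub>0(\<theta>) + V(e\<^sup>\<theta> \<cdot>)\<close> with domain \<open>H\<^sup>1\<close>; the undilated operator \<open>H\<close> is the case \<open>\<theta> = 0\<close>.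
\<close>

definition dirac :: "real \<Rightarrow> (complex \<Rightarrow> complex^2^2) \<Rightarrow> complex \<Rightarrow> operator_graph" where
  "dirac m V \<theta> f h \<longleftrightarrow> h \<in> L2 \<and> (\<exists>h0. free_dirac m \<theta> f h0 \<and>
     (AE x in lborel. h x = h0 x + V (exp \<theta> * of_real x) *v f x))"

definition resonances :: "real \<Rightarrow> real \<Rightarrow> (complex \<Rightarrow> complex^2^2) \<Rightarrow> complex set" where
  "resonances \<alpha> m V = (\<Union>\<theta>\<in>{\<theta>. 0 < Im \<theta> \<and> Im \<theta> < \<alpha>}. discrete_spectrum (dirac m V \<theta>))"

definition sector :: "real \<Rightarrow> complex set" where
  "sector \<alpha> = {z. z \<noteq> 0 \<and> \<bar>Arg z\<bar> < \<alpha>}"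

definition double_sector :: "real \<Rightarrow> complex set" where
  "double_sector \<alpha> = sector \<alpha> \<union> uminus ` sector \<alpha>"

text \<open>
  Potentials are total functions on the complex plane; only their values on the double sector matter
  (the value at \<open>0\<close> concerns a null set of the real line).
\<close>

definition ray_norm :: "(complex \<Rightarrow> complex^2^2) \<Rightarrow> real \<Rightarrow> real" where
  "ray_norm V \<phi> = (\<integral>x. onorm ((*v) (V (cis \<phi> * of_real x))) \<partial>lborel)"

definition admissible_potential :: "real \<Rightarrow> (complex \<Rightarrow> complex^2^2) \<Rightarrow> bool" where
  "admissible_potential \<alpha> V \<longleftrightarrow>
     (\<forall>i j. (\<lambda>z. V z $ i $ j) analytic_on double_sector \<alpha>) \<and>
     bounded (V ` double_sector \<alpha>) \<and>
     (\<forall>x::real. x \<noteq> 0 \<longrightarrow> (\<forall>i j. V (of_real x) $ i $ j = cnj (V (of_real x) $ j $ i))) \<and>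
     (\<forall>\<beta>. 0 < \<beta> \<and> \<beta> < \<alpha> \<longrightarrow> (\<exists>C. \<forall>\<phi>::real. \<bar>\<phi>\<bar> \<le> \<beta> \<longrightarrow>
        integrable lborel (\<lambda>x. V (cis \<phi> * of_real x)) \<and>
        ray_norm V \<phi> \<le> C))"

definition v_inf :: "real \<Rightarrow> (complex \<Rightarrow> complex^2^2) \<Rightarrow> complex \<Rightarrow> real" where
  "v_inf \<alpha> V \<theta> = (INF \<phi>\<in>{Im \<theta>..<\<alpha>}. ray_norm V \<phi>)"

definition scalar_sign_definite :: "real \<Rightarrow> (complex \<Rightarrow> complex^2^2) \<Rightarrow> bool" where
  "scalar_sign_definite \<alpha> V \<longleftrightarrow> (\<exists>u :: complex \<Rightarrow> complex.
     (\<forall>z\<in>double_sector \<alpha>. V z = mat (u z)) \<and>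
     ((\<forall>x::real. x \<noteq> 0 \<longrightarrow> u (of_real x) \<in> \<real> \<and> 0 \<le> Re (u (of_real x))) \<or>
      (\<forall>x::real. x \<noteq> 0 \<longrightarrow> u (of_real x) \<in> \<real> \<and> Re (u (of_real x)) \<le> 0)))"

definition x_of :: "real \<Rightarrow> real" where
  "x_of v = sqrt ((v^4 - 2 * v\<^sup>2 + 2) / (4 * (1 - v\<^sup>2)) + 1 / 2)"

definition r_of :: "real \<Rightarrow> real" where
  "r_of v = sqrt ((v^4 - 2 * v\<^sup>2 + 2) / (4 * (1 - v\<^sup>2)) - 1 / 2)"

text \<open>With \<open>\<phi> = Im \<theta>\<close> this is \<open>D\<^sub>\<theta>\<close>.\<close>

definition D_region :: "real \<Rightarrow> real \<Rightarrow> complex set" where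
  "D_region m \<phi> = {z. \<exists>(p::real) \<omega>. 0 \<le> Im \<omega> \<and> Im \<omega> \<le> \<phi> \<and>
     (z = csqrt (exp (-2 * \<omega>) * of_real (p\<^sup>2) + of_real (m\<^sup>2)) \<or>
      z = - csqrt (exp (-2 * \<omega>) * of_real (p\<^sup>2) + of_real (m\<^sup>2)))}"

text \<open>Unlike \<^const>\<open>cball\<close>, the disk of radius \<open>0\<close> is empty.\<close>

definition K_disk :: "real \<Rightarrow> complex \<Rightarrow> complex set" where
  "K_disk r z0 = (if r = 0 then {} else cball z0 r)"

end

theory Submission
  imports Defs "HOL-Complex_Analysis.Complex_Analysis"
begin

text \<open>
  An eigenfunction of \<open>H(\<theta>)\<close> is a solution, along the ray of angle \<open>Im \<theta>\<close>, of a first-order system that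
  decays at both ends.  Split it into the two modes \<open>e\<^sup>\<plusminus>\<^sup>i\<^sup>\<kappa>\<^sup>\<zeta>\<close>, \<open>\<kappa>\<^sup>2 = z\<^sup>2 - m\<^sup>2\<close>; as each mode is recovered by
  integration from the end where it vanishes, and as the free Green kernel is of rank one, the sup norm of
  the solution is at most \<open>n(z) \<parallel>V(e\<^sup>i\<^sup>\<phi>\<cdot>)\<parallel>\<^sub>1\<close> times itself, where
  \<open>n(z) = (\<bar>z + m\<bar> + \<bar>z - m\<bar>) / (2 \<bar>z\<^sup>2 - m\<^sup>2\<bar>\<^sup>1\<^sup>/\<^sup>2)\<close>.  The two modes are not parallel, which improves the
  bound by a gap that depends on \<open>z\<close> only and gives strict inequalities and stability under limits of rays.
  The condition \<open>n(z) v \<ge> 1\<close> describes the two Apollonius disks.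

  The function \<open>\<phi> \<mapsto> \<parallel>V(e\<^sup>i\<^sup>\<phi>\<cdot>)\<parallel>\<^sub>1\<close> is logarithmically convex by the three-lines theorem and even by Schwarz
  reflection, hence continuous and nondecreasing on \<open>[0, \<alpha>)\<close>; so the infimum \<open>v\<^sub>\<theta>\<close> is attained at \<open>Im \<theta>\<close>.
  An eigenfunction on a larger angle is continued to a solution on the
  sector; it is bounded on the given ray, and also on the ray where \<open>\<kappa>\<zeta>\<close> is real because all solutions are,
  so by Phragmen-Lindelof it is bounded on all rays in between, to which the previous estimate applies.
\<close>

section \<open>Matrix norms and real analysis\<close>

text \<open>The potential is analytic in two separate sectors and only bounded near 0, so nothing
  links the two half-lines except the value of the solution at 0. The analysis is therefore done on
  one half-line, the left one being folded onto the right, and the halves are glued at the end: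
  half-line norms add up, and the two continuations of an eigenfunction agree at 0 because bounded
  coefficients make the limit at 0 independent of the angle. The glued function is only known to be
  bounded; it need not lie in L2, since Im (\<kappa>\<zeta>) > 0 already kills the boundary terms.
  On the target ray itself \<kappa>\<zeta> may be real, so the estimate is taken on larger angles
  that decrease to the target; a bare strict inequality would be lost in this limit. The points z =
  m and z = -m, where \<kappa> = 0 and the two modes degenerate, are treated apart: they lie inside
  the disks unless m = 0 or the potential vanishes, and in these two cases the equation is explicit
  enough to exclude eigenvalues there.\<close>

lemma norm_cvec2: "(norm (u :: complex^2))\<^sup>2 = (cmod (u $ 1))\<^sup>2 + (cmod (u $ 2))\<^sup>2"
  by (simp add: norm_vec_def L2_set_def sum_2 real_sqrt_pow2)

lemma matrix_vector_nth2: "((A :: complex^2^2) *v u) $ i = A $ i $ 1 * u $ 1 + A $ i $ 2 * u $ 2"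
  by (simp add: matrix_vector_mult_def sum_2)

lemma bounded_linear_matrix_vector: "bounded_linear ((*v) (A :: complex^2^2))"
  unfolding linear_conv_bounded_linear [symmetric]
  by (rule linearI) (simp_all add: vec_eq_iff matrix_vector_nth2 algebra_simps scaleR_right_distrib)

abbreviation mnorm :: "complex^2^2 \<Rightarrow> real" where
  "mnorm A \<equiv> onorm ((*v) A)"

lemma mnorm_bound: "norm ((A :: complex^2^2) *v u) \<le> mnorm A * norm u"
  by (rule onorm [OF bounded_linear_matrix_vector])

lemma mnorm_nonneg [simp]: "0 \<le> mnorm A"
  by (rule onorm_pos_le [OF bounded_linear_matrix_vector])

lemma Cauchy_Schwarz_complex2:
  "cmod (a * x + b * y) \<le> sqrt ((cmod a)\<^sup>2 + (cmod b)\<^sup>2) * sqrt ((cmod x)\<^sup>2 + (cmod y)\<^sup>2)"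
proof -
  have "cmod (a * x + b * y) \<le> cmod a * cmod x + cmod b * cmod y"
    by (metis norm_mult norm_triangle_ineq)
  also have "\<dots> \<le> sqrt ((cmod a * cmod x + cmod b * cmod y)\<^sup>2)" by simp
  also have "\<dots> \<le> sqrt (((cmod a)\<^sup>2 + (cmod b)\<^sup>2) * ((cmod x)\<^sup>2 + (cmod y)\<^sup>2))"
  proof (rule real_sqrt_le_mono)
    have "((cmod a)\<^sup>2 + (cmod b)\<^sup>2) * ((cmod x)\<^sup>2 + (cmod y)\<^sup>2) - (cmod a * cmod x + cmod b * cmod y)\<^sup>2
        = (cmod a * cmod y - cmod b * cmod x)\<^sup>2" by algebra
    then show "(cmod a * cmod x + cmod b * cmod y)\<^sup>2 \<le> ((cmod a)\<^sup>2 + (cmod b)\<^sup>2) * ((cmod x)\<^sup>2 + (cmod y)\<^sup>2)"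
      by (smt (verit) zero_le_power2)
  qed
  finally show ?thesis by (simp add: real_sqrt_mult)
qed

lemma norm_cvec2_sqrt: "norm (u :: complex^2) = sqrt ((cmod (u $ 1))\<^sup>2 + (cmod (u $ 2))\<^sup>2)"
  using norm_cvec2 [of u] by (metis norm_ge_zero real_sqrt_unique)

text \<open>On \<open>complex^2^2\<close> the type-class norm is the Frobenius norm. Boundedness and
  integrability of the potential are given in that norm, the L1 norms of the theorem in the operator
  norm; this comparison passes from one to the other.\<close>

lemma mnorm_le_norm: "mnorm A \<le> norm A"
proof (rule onorm_bound)
  fix u :: "complex^2"
  have *: "cmod ((A *v u) $ i) \<le> norm (A $ i) * norm u" for i
    unfolding matrix_vector_nth2 norm_cvec2_sqrt by (rule Cauchy_Schwarz_complex2)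
  have "(norm (A *v u))\<^sup>2 \<le> (norm (A $ 1) * norm u)\<^sup>2 + (norm (A $ 2) * norm u)\<^sup>2"
    unfolding norm_cvec2 by (intro add_mono power_mono *) auto
  also have "\<dots> = (norm A * norm u)\<^sup>2"
    by (simp add: norm_vec_def [of A] L2_set_def sum_2 power_mult_distrib algebra_simps)
  finally show "norm (A *v u) \<le> norm A * norm u"
    by (rule power2_le_imp_le) simp
qed simp

lemma mnorm_Lipschitz: "\<bar>mnorm A - mnorm B\<bar> \<le> norm (A - B)"
proof -
  have *: "mnorm A \<le> mnorm B + mnorm (A - B)" for A B
  proof (rule onorm_bound)
    fix u :: "complex^2"
    have "A *v u = B *v u + (A - B) *v u"
      by (simp add: matrix_vector_mult_diff_rdistrib)
    then have "norm (A *v u) \<le> norm (B *v u) + norm ((A - B) *v u)"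
      by (metis norm_triangle_ineq)
    also have "\<dots> \<le> mnorm B * norm u + mnorm (A - B) * norm u"
      by (intro add_mono mnorm_bound)
    finally show "norm (A *v u) \<le> (mnorm B + mnorm (A - B)) * norm u"
      by (simp add: algebra_simps)
  qed simp
  have "mnorm A - mnorm B \<le> norm (A - B)" "mnorm B - mnorm A \<le> norm (A - B)"
    using * [of A B] * [of B A] mnorm_le_norm [of "A - B"] mnorm_le_norm [of "B - A"]
    by (auto simp: norm_minus_commute)
  then show ?thesis by linarith
qed

lemma continuous_on_mnorm [continuous_intros]:
  assumes "continuous_on S f" shows "continuous_on S (\<lambda>x. mnorm (f x))"
proof -
  have "continuous_on UNIV mnorm"
    unfolding continuous_on_iff dist_real_def
  proof (intro ballI allI impI)
    fix x :: "complex^2^2" and e :: real assume "0 < e"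
    then show "\<exists>d>0. \<forall>x'\<in>UNIV. dist x' x < d \<longrightarrow> \<bar>mnorm x' - mnorm x\<bar> < e"
      using mnorm_Lipschitz by (intro exI [of _ e]) (auto simp: dist_norm intro: le_less_trans)
  qed
  then show ?thesis using assms continuous_on_compose2 by blast
qed

lemma borel_measurable_mnorm [measurable]:
  "f \<in> borel_measurable M \<Longrightarrow> (\<lambda>x. mnorm (f x)) \<in> borel_measurable M"
  using borel_measurable_continuous_on [OF continuous_on_mnorm [OF continuous_on_id]] by blast

lemma integrable_mnorm:
  assumes "integrable M f" shows "integrable M (\<lambda>x. mnorm (f x))"
proof (rule Bochner_Integration.integrable_bound [OF integrable_norm [OF assms]])
  show "(\<lambda>x. mnorm (f x)) \<in> borel_measurable M" using assms by measurable
qed (simp add: mnorm_le_norm)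

section \<open>Integral and differential inequalities on the real line\<close>

text \<open>A mean value inequality with the point 0 exempted: along a ray the potential is known to
  be continuous only off 0, so solutions are known to be differentiable only there.\<close>

lemma norm_diff_le_integral:
  fixes f :: "real \<Rightarrow> 'a::euclidean_space"
  assumes ab: "a \<le> b" and "continuous_on {a..b} f"
    and der: "\<And>x. \<lbrakk>a < x; x < b; x \<noteq> 0\<rbrakk> \<Longrightarrow> (f has_vector_derivative f' x) (at x)"
    and le: "\<And>x. \<lbrakk>a < x; x < b; x \<noteq> 0\<rbrakk> \<Longrightarrow> norm (f' x) \<le> g x"
    and g: "g integrable_on {a..b}"
  shows "norm (f b - f a) \<le> integral {a..b} g"
proof -
  have "(f' has_integral (f b - f a)) {a..b}"
    by (rule fundamental_theorem_of_calculus_interior_strong [of "{0}"]) (use assms in auto)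
  \<comment> \<open>The pointwise bound is available only off these points; replacing both
    integrands by 0 there makes it hold on the whole interval.\<close>
  then have I: "((\<lambda>x. if x \<in> {a,b,0} then 0 else f' x) has_integral (f b - f a)) {a..b}"
    by (rule has_integral_spike [of "{a,b,0}", rotated 2]) auto
  have J: "((\<lambda>x. if x \<in> {a,b,0} then 0 else g x) has_integral integral {a..b} g) {a..b}"
    by (rule has_integral_spike [of "{a,b,0}", OF _ _ integrable_integral [OF g]]) auto
  have "norm (integral {a..b} (\<lambda>x. if x \<in> {a,b,0} then 0 else f' x))
     \<le> integral {a..b} (\<lambda>x. if x \<in> {a,b,0} then 0 else g x)"
    using I J le by (intro integral_norm_bound_integral) auto
  then show ?thesis
    using I J by (simp add: integral_unique)
qed

text \<open>With K a primitive of \<open>k\<close>, \<open>y x * exp (- K x)\<close> decreases and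
  \<open>y x * exp (K x)\<close> increases. Both directions are used: bounds and zeros of solutions
  are propagated forwards and backwards.\<close>

lemma Gronwall:
  fixes y :: "real \<Rightarrow> real"
  assumes ab: "a \<le> b"
    and der: "\<And>x. a \<le> x \<Longrightarrow> x \<le> b \<Longrightarrow> (y has_real_derivative y' x) (at x)"
    and le: "\<And>x. a \<le> x \<Longrightarrow> x \<le> b \<Longrightarrow> \<bar>y' x\<bar> \<le> k x * y x"
    and k: "continuous_on {a..b} k"
  shows "y b \<le> y a * exp (integral {a..b} k)" "y a \<le> y b * exp (integral {a..b} k)"
proof -
  define K where "K = (\<lambda>x. integral {a..x} k)"
  have K: "(K has_real_derivative k x) (at x)" if "a < x" "x < b" for x
  proof -
    have "(K has_real_derivative k x) (at x within {a..b})"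
      unfolding K_def using that k by (intro integral_has_real_derivative) auto
    then show ?thesis using that by (simp add: at_within_Icc_at)
  qed
  have cK: "continuous_on {a..b} K"
    unfolding K_def by (intro indefinite_integral_continuous_1 integrable_continuous_real k)
  have cy: "continuous_on {a..b} y"
    using der by (meson DERIV_isCont atLeastAtMost_iff continuous_at_imp_continuous_on)
  have "- (y a * exp (- K a)) \<le> - (y b * exp (- K b))"
  proof (rule DERIV_nonneg_imp_increasing_open [OF ab])
    fix x assume x: "a < x" "x < b"
    have "((\<lambda>x. - (y x * exp (- K x))) has_real_derivative (k x * y x - y' x) * exp (- K x)) (at x)"
      by (rule derivative_eq_intros der K refl | use x in \<open>simp add: algebra_simps\<close>)+
    moreover have "(k x * y x - y' x) * exp (- K x) \<ge> 0"
      using le [of x] x by (intro mult_nonneg_nonneg) auto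
    ultimately show "\<exists>d. ((\<lambda>x. - (y x * exp (- K x))) has_real_derivative d) (at x) \<and> d \<ge> 0" by blast
  qed (intro continuous_intros cy cK)
  moreover have "y a * exp (K a) \<le> y b * exp (K b)"
  proof (rule DERIV_nonneg_imp_increasing_open [OF ab])
    fix x assume x: "a < x" "x < b"
    have "((\<lambda>x. y x * exp (K x)) has_real_derivative (y' x + k x * y x) * exp (K x)) (at x)"
      by (rule derivative_eq_intros der K refl | use x in \<open>simp add: algebra_simps\<close>)+
    moreover have "(y' x + k x * y x) * exp (K x) \<ge> 0"
      using le [of x] x by (intro mult_nonneg_nonneg) auto
    ultimately show "\<exists>d. ((\<lambda>x. y x * exp (K x)) has_real_derivative d) (at x) \<and> d \<ge> 0" by blast
  qed (intro continuous_intros cy cK)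
  moreover have "K a = 0" "K b = integral {a..b} k" by (auto simp: K_def)
  ultimately show "y b \<le> y a * exp (integral {a..b} k)" "y a \<le> y b * exp (integral {a..b} k)"
    by (auto simp: exp_minus field_simps)
qed

lemma integral_mass_in_interval:
  fixes G :: "real \<Rightarrow> real"
  assumes G: "integrable lborel G" and "0 < e"
  obtains R where "0 < R" "(LINT x|lborel. G x) - e \<le> (LINT x:{-R..R}|lborel. G x)"
proof -
  have "((\<lambda>n. LINT x:{-real n..real n}|lborel. G x) \<longlongrightarrow> (LINT x|lborel. G x)) sequentially"
    unfolding set_lebesgue_integral_def
  proof (rule integral_dominated_convergence [where w = "\<lambda>x. \<bar>G x\<bar>"])
    show "AE x in lborel. (\<lambda>n. indicat_real {-real n..real n} x *\<^sub>R G x) \<longlonglongrightarrow> G x"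
    proof (rule AE_I2, rule tendsto_eventually)
      fix x
      show "\<forall>\<^sub>F n in sequentially. indicat_real {-real n..real n} x *\<^sub>R G x = G x"
        using eventually_ge_at_top [of "nat \<lceil>\<bar>x\<bar>\<rceil>"]
        by eventually_elim (auto simp: indicator_def abs_le_iff split: if_splits)
    qed
  qed (use G in \<open>auto simp: indicator_def split: if_splits\<close>)
  then have "\<forall>\<^sub>F n in sequentially. (LINT x|lborel. G x) - e < (LINT x:{-real n..real n}|lborel. G x)"
    by (rule order_tendstoD) (use \<open>0 < e\<close> in simp)
  then have "\<forall>\<^sub>F n in sequentially. 0 < n \<and> (LINT x|lborel. G x) - e < (LINT x:{-real n..real n}|lborel. G x)"
    using eventually_gt_at_top [of 0] by eventually_elim auto
  then obtain n where "0 < n" "(LINT x|lborel. G x) - e < (LINT x:{-real n..real n}|lborel. G x)"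
    by (auto dest: eventually_happens)
  then show ?thesis using that [of "real n"] by simp
qed

lemma vanishing_at_infinity_bounded:
  fixes F :: "real \<Rightarrow> 'a::real_normed_vector"
  assumes F: "continuous_on UNIV F" "(F \<longlongrightarrow> 0) at_infinity"
  obtains B where "\<And>x. norm (F x) \<le> B"
proof -
  obtain R where R: "\<And>x. R \<le> \<bar>x\<bar> \<Longrightarrow> norm (F x) < 1"
    using tendstoD [OF F(2), of 1] by (auto simp: eventually_at_infinity)
  have "compact (F ` {-\<bar>R\<bar>..\<bar>R\<bar>})"
    by (intro compact_continuous_image continuous_on_subset [OF F(1)]) auto
  then have "bounded (F ` {-\<bar>R\<bar>..\<bar>R\<bar>})" by (rule compact_imp_bounded)
  then obtain B where B: "\<And>x. x \<in> {-\<bar>R\<bar>..\<bar>R\<bar>} \<Longrightarrow> norm (F x) \<le> B"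
    unfolding bounded_iff by blast
  have "norm (F x) \<le> max B 1" for x
  proof (cases "R \<le> \<bar>x\<bar>")
    case True
    then show ?thesis using R [OF True] by linarith
  next
    case False
    then have "x \<in> {-\<bar>R\<bar>..\<bar>R\<bar>}" by (auto simp: abs_if split: if_splits)
    from B [OF this] show ?thesis by linarith
  qed
  then show ?thesis by (rule that)
qed

section \<open>The coupling gap for outgoing solutions\<close>

text \<open>The eigenvalue equation along the ray of direction \<open>lam\<close>, solved for the
  derivatives; \<open>sigma1\<close> makes each component drive the other. It is stated at a single
  point so that 0 can be left out.\<close>

definition dirac_ode ::
  "real \<Rightarrow> complex \<Rightarrow> complex \<Rightarrow> (real \<Rightarrow> complex^2^2) \<Rightarrow> (real \<Rightarrow> complex^2) \<Rightarrow> real \<Rightarrow> bool" where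
  "dirac_ode m z lam W F x \<longleftrightarrow>
     ((\<lambda>t. F t $ 1) has_vector_derivative \<i> * lam * ((z + m) * F x $ 2 - (W x *v F x) $ 2)) (at x) \<and>
     ((\<lambda>t. F t $ 2) has_vector_derivative \<i> * lam * ((z - m) * F x $ 1 - (W x *v F x) $ 1)) (at x)"

text \<open>This is n(z): as |\<kappa>|^2 = |z + m| |z - m|, the two summands are the square root of
  |z + m| / |z - m| and its reciprocal. It is the norm of the rank-one matrix in the free Green
  kernel, without the exponential factor.\<close>

definition kernel_norm :: "real \<Rightarrow> complex \<Rightarrow> complex \<Rightarrow> real" where
  "kernel_norm m z \<kappa> = (cmod (z + m) / cmod \<kappa> + cmod \<kappa> / cmod (z + m)) / 2"

definition mode_angle :: "real \<Rightarrow> complex \<Rightarrow> complex \<Rightarrow> real" where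
  "mode_angle m z \<kappa> = \<bar>(cmod (z + m))\<^sup>2 - (cmod \<kappa>)\<^sup>2\<bar> / ((cmod (z + m))\<^sup>2 + (cmod \<kappa>)\<^sup>2)"

text \<open>The coordinate of \<open>u\<close> along the vector (z + m, s \<kappa>), an eigenvector
  of the free system with eigenvalue i s \<open>lam\<close> \<kappa>.\<close>

definition mode :: "real \<Rightarrow> complex \<Rightarrow> complex \<Rightarrow> real \<Rightarrow> complex^2 \<Rightarrow> complex" where
  "mode m z \<kappa> s u = (u $ 1 / (z + m) + s * (u $ 2 / \<kappa>)) / 2"

definition mode_source ::
  "real \<Rightarrow> complex \<Rightarrow> complex \<Rightarrow> complex \<Rightarrow> real \<Rightarrow> complex^2^2 \<Rightarrow> complex^2 \<Rightarrow> complex" where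
  "mode_source m z \<kappa> lam s A u = - (\<i> * lam / 2) * (s * ((A *v u) $ 1 / \<kappa>) + (A *v u) $ 2 / (z + m))"

text \<open>The norm of the coordinate functional \<open>mode\<close>. Multiplied by the length of a
  mode vector it gives \<open>kernel_norm\<close>.\<close>

definition mode_const :: "real \<Rightarrow> complex \<Rightarrow> complex \<Rightarrow> real" where
  "mode_const m z \<kappa> = sqrt (1 / (cmod \<kappa>)\<^sup>2 + 1 / (cmod (z + m))\<^sup>2) / 2"

lemma z_plus_m_nonzero:
  fixes m :: real and z \<kappa> :: complex
  assumes "\<kappa>\<^sup>2 = z\<^sup>2 - (of_real m)\<^sup>2" "\<kappa> \<noteq> 0" shows "z + of_real m \<noteq> 0"
proof
  assume "z + of_real m = 0"
  then have "z = - of_real m" by (simp add: eq_neg_iff_add_eq_0)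
  then show False using assms by simp
qed

lemma mode_derivative:
  fixes m s :: real
  assumes \<kappa>: "\<kappa>\<^sup>2 = z\<^sup>2 - (of_real m)\<^sup>2" "\<kappa> \<noteq> 0"
    and ode: "dirac_ode m z lam W F t" and s: "s = 1 \<or> s = -1"
  shows "((\<lambda>t. mode m z \<kappa> s (F t)) has_vector_derivative
    \<i> * s * (lam * \<kappa>) * mode m z \<kappa> s (F t) + mode_source m z \<kappa> lam s (W t) (F t)) (at t)"
proof -
  have zm: "z + of_real m \<noteq> 0" by (rule z_plus_m_nonzero [OF \<kappa>])
  \<comment> \<open>This identity diagonalises the free part: both components feed the mode at the
    same rate.\<close>
  have kz: "(z - m) / \<kappa> = \<kappa> / (z + m)"
    using \<kappa> zm by (simp add: field_simps power2_eq_square)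
  let ?d1 = "\<i> * lam * ((z + m) * F t $ 2 - (W t *v F t) $ 2)"
  let ?d2 = "\<i> * lam * ((z - m) * F t $ 1 - (W t *v F t) $ 1)"
  have "((\<lambda>t. F t $ 1) has_vector_derivative ?d1) (at t)" "((\<lambda>t. F t $ 2) has_vector_derivative ?d2) (at t)"
    using ode by (auto simp: dirac_ode_def)
  then have "((\<lambda>t. (F t $ 1 * (1 / (z + m)) + s * (F t $ 2 * (1 / \<kappa>))) * (1/2)) has_vector_derivative
      ((?d1 * (1 / (z + m)) + s * (?d2 * (1 / \<kappa>))) * (1/2))) (at t)"
    by (intro has_vector_derivative_mult_left has_vector_derivative_mult_right has_vector_derivative_add)
  then have "((\<lambda>t. mode m z \<kappa> s (F t)) has_vector_derivative ((?d1 * (1 / (z + m)) + s * (?d2 * (1 / \<kappa>))) * (1/2))) (at t)"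
    by (simp add: mode_def)
  \<comment> \<open>With \<open>p\<close> and \<open>q\<close> in place of the two reciprocals the
    claim is a polynomial identity modulo four relations.\<close>
  moreover have "((\<i> * lam * ((z + m) * f2 - u2)) * p + s * ((\<i> * lam * ((z - m) * f1 - u1)) * q)) * (1/2)
      = \<i> * s * (lam * \<kappa>) * ((f1 * p + s * (f2 * q)) / 2) + - (\<i> * lam / 2) * (s * (u1 * q) + u2 * p)"
    if "(z + m) * p = 1" "\<kappa> * q = 1" "(z - m) * q = \<kappa> * p" "s * s = 1" for f1 f2 u1 u2 p q s :: complex
    using that by algebra
  from this [of "1 / (z + m)" "1 / \<kappa>" s "F t $ 2" "(W t *v F t) $ 2" "F t $ 1" "(W t *v F t) $ 1"]
  have "(?d1 * (1 / (z + m)) + s * (?d2 * (1 / \<kappa>))) * (1/2) = \<i> * s * (lam * \<kappa>) * mode m z \<kappa> s (F t) + mode_source m z \<kappa> lam s (W t) (F t)"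
    using zm \<kappa>(2) kz s by (force simp: mode_def mode_source_def)
  ultimately show ?thesis by (simp add: has_vector_derivative_eq_rhs)
qed

lemma mode_source_bound:
  fixes m s :: real
  assumes lam: "cmod lam = 1" and s: "s = 1 \<or> s = -1"
  shows "cmod (mode_source m z \<kappa> lam s A u) \<le> mode_const m z \<kappa> * (mnorm A * norm u)"
proof -
  let ?u = "A *v u"
  have "cmod (mode_source m z \<kappa> lam s A u) = cmod ((s / \<kappa>) * ?u $ 1 + (1 / (z + m)) * ?u $ 2) / 2"
    using lam by (simp add: mode_source_def norm_mult norm_divide)
  also have "\<dots> \<le> (sqrt ((cmod (s / \<kappa>))\<^sup>2 + (cmod (1 / (z + m)))\<^sup>2) * norm ?u) / 2"
    unfolding norm_cvec2_sqrt by (intro divide_right_mono Cauchy_Schwarz_complex2) auto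
  also have "\<dots> = mode_const m z \<kappa> * norm ?u"
    using s by (auto simp: mode_const_def norm_divide power_divide)
  also have "\<dots> \<le> mode_const m z \<kappa> * (mnorm A * norm u)"
    by (intro mult_left_mono mnorm_bound) (simp add: mode_const_def)
  finally show ?thesis .
qed

lemma mode_bound:
  fixes m s :: real
  assumes s: "s = 1 \<or> s = -1"
  shows "cmod (mode m z \<kappa> s u) \<le> mode_const m z \<kappa> * norm u"
proof -
  have "cmod (mode m z \<kappa> s u) = cmod ((1 / (z + m)) * u $ 1 + (s / \<kappa>) * u $ 2) / 2"
    by (simp add: mode_def norm_divide)
  also have "\<dots> \<le> (sqrt ((cmod (1 / (z + m)))\<^sup>2 + (cmod (s / \<kappa>))\<^sup>2) * norm u) / 2"
    unfolding norm_cvec2_sqrt by (intro divide_right_mono Cauchy_Schwarz_complex2) auto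
  also have "\<dots> = mode_const m z \<kappa> * norm u"
    using s by (auto simp: mode_const_def norm_divide power_divide add.commute)
  finally show ?thesis .
qed

lemma mode_decomposition:
  assumes "z + of_real m \<noteq> 0" "\<kappa> \<noteq> 0"
  shows "u $ 1 = (z + m) * (mode m z \<kappa> 1 u + mode m z \<kappa> (-1) u)"
    and "u $ 2 = \<kappa> * (mode m z \<kappa> 1 u - mode m z \<kappa> (-1) u)"
proof -
  have halves: "(X + complex_of_real 1 * Y) / 2 + (X + complex_of_real (-1) * Y) / 2 = X"
    "(X + complex_of_real 1 * Y) / 2 - (X + complex_of_real (-1) * Y) / 2 = Y" for X Y :: complex
    by (simp_all add: field_simps)
  have "mode m z \<kappa> 1 u + mode m z \<kappa> (-1) u = u $ 1 / (z + m)"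
    "mode m z \<kappa> 1 u - mode m z \<kappa> (-1) u = u $ 2 / \<kappa>"
    using halves [of "u $ 1 / (z + m)" "u $ 2 / \<kappa>"] unfolding mode_def by auto
  then show "u $ 1 = (z + m) * (mode m z \<kappa> 1 u + mode m z \<kappa> (-1) u)"
    "u $ 2 = \<kappa> * (mode m z \<kappa> 1 u - mode m z \<kappa> (-1) u)"
    using assms by simp_all
qed

text \<open>Regularising parameters, such as tail errors and damping factors, enter the later bounds
  continuously; this removes them.\<close>

lemma le_limit_at_0:
  fixes g :: "real \<Rightarrow> real"
  assumes "\<And>e. 0 < e \<Longrightarrow> x \<le> g e" "isCont g 0"
  shows "x \<le> g 0"
proof (rule tendsto_lowerbound)
  show "(g \<longlongrightarrow> g 0) (at_right 0)"
    using assms(2) by (simp add: isCont_def filterlim_at_split)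
  show "\<forall>\<^sub>F e in at_right 0. x \<le> g e"
    using assms(1) by (auto simp: eventually_at_filter)
qed simp

text \<open>The cross term 2 Re (a cnj b) enters the two components with opposite signs, so it
  survives only with the factor P^2 - k^2. The modulus of this factor divided by P^2 + k^2 is the
  cosine of the angle between the two mode vectors.\<close>

lemma mode_sum_norm:
  fixes a b u v :: complex
  assumes "0 < P" "0 < k" "cmod u = P" "cmod v = k"
  shows "(cmod (u * (a + b)))\<^sup>2 + (cmod (v * (a - b)))\<^sup>2
    \<le> (P\<^sup>2 + k\<^sup>2) * ((cmod a)\<^sup>2 + (cmod b)\<^sup>2 + 2 * (\<bar>P\<^sup>2 - k\<^sup>2\<bar> / (P\<^sup>2 + k\<^sup>2)) * cmod a * cmod b)"
proof -
  define r where "r = Re (a * cnj b)"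
  have r: "\<bar>r\<bar> \<le> cmod a * cmod b"
    unfolding r_def by (metis abs_Re_le_cmod complex_mod_cnj norm_mult)
  have p: "(cmod (a + b))\<^sup>2 = (cmod a)\<^sup>2 + (cmod b)\<^sup>2 + 2 * r" "(cmod (a - b))\<^sup>2 = (cmod a)\<^sup>2 + (cmod b)\<^sup>2 - 2 * r"
    unfolding r_def cmod_power2 by (simp_all add: power2_eq_square algebra_simps)
  have "(P\<^sup>2 - k\<^sup>2) * r \<le> \<bar>P\<^sup>2 - k\<^sup>2\<bar> * (cmod a * cmod b)"
    using abs_ge_self [of "(P\<^sup>2 - k\<^sup>2) * r"] mult_left_mono [OF r, of "\<bar>P\<^sup>2 - k\<^sup>2\<bar>"]
    by (simp add: abs_mult)
  moreover have "P\<^sup>2 + k\<^sup>2 \<noteq> 0" using assms by (simp add: add_pos_pos less_imp_neq [symmetric])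
  then have "(P\<^sup>2 + k\<^sup>2) * ((cmod a)\<^sup>2 + (cmod b)\<^sup>2 + 2 * (\<bar>P\<^sup>2 - k\<^sup>2\<bar> / (P\<^sup>2 + k\<^sup>2)) * cmod a * cmod b)
      = (P\<^sup>2 + k\<^sup>2) * ((cmod a)\<^sup>2 + (cmod b)\<^sup>2) + 2 * (\<bar>P\<^sup>2 - k\<^sup>2\<bar> * (cmod a * cmod b))"
    by (simp add: distrib_left)
  moreover have "(cmod (u * (a + b)))\<^sup>2 + (cmod (v * (a - b)))\<^sup>2
      = (P\<^sup>2 + k\<^sup>2) * ((cmod a)\<^sup>2 + (cmod b)\<^sup>2) + 2 * ((P\<^sup>2 - k\<^sup>2) * r)"
    unfolding norm_mult power_mult_distrib assms p by (simp add: algebra_simps)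
  ultimately show ?thesis by linarith
qed

text \<open>Variation of constants, started on the side from which the mode comes: \<open>y\<close>
  lies left of \<open>x\<close> for s = 1 and right of it for s = -1. There the propagator from
  \<open>t\<close> to \<open>x\<close> has modulus at most 1, as Im \<mu> is nonnegative.\<close>

lemma outgoing_mode_bound:
  fixes c :: "real \<Rightarrow> complex" and s \<eta> :: real
  assumes s: "s = 1 \<or> s = -1" and \<mu>: "0 \<le> Im \<mu>"
    and cont: "continuous_on UNIV c"
    and der: "\<And>t. t \<noteq> 0 \<Longrightarrow> (c has_vector_derivative \<i> * s * \<mu> * c t + r t) (at t)"
    and r: "\<And>t. cmod (r t) \<le> g t" and g: "g integrable_on {min x y..max x y}"
    and xy: "0 \<le> s * (x - y)"
  shows "cmod (c x) \<le> exp (- Im \<mu> * \<bar>x - y\<bar>) * cmod (c y) + integral {min x y..max x y} g"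
proof -
  define \<phi> where "\<phi> = (\<lambda>t. exp (\<i> * s * \<mu> * (x - t)) * c t)"
  have "norm (\<phi> (max x y) - \<phi> (min x y)) \<le> integral {min x y..max x y} g"
  proof (rule norm_diff_le_integral)
    show "continuous_on {min x y..max x y} \<phi>"
      unfolding \<phi>_def by (intro continuous_intros continuous_on_subset [OF cont]) auto
    fix t assume t: "min x y < t" "t < max x y" "t \<noteq> 0"
    have 1: "((\<lambda>t::real. exp (\<i> * s * \<mu> * (x - t))) has_vector_derivative
        exp (\<i> * s * \<mu> * (x - t)) * (- (\<i> * s * \<mu>))) (at t)"
    proof -
      have "((\<lambda>w. exp (\<i> * s * \<mu> * (complex_of_real x - w))) has_field_derivative
          exp (\<i> * s * \<mu> * (x - t)) * (- (\<i> * s * \<mu>))) (at (complex_of_real t))"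
        by (auto intro!: derivative_eq_intros)
      from has_vector_derivative_real_field [OF this] show ?thesis by simp
    qed
    show "(\<phi> has_vector_derivative exp (\<i> * s * \<mu> * (x - t)) * r t) (at t)"
      unfolding \<phi>_def
      by (rule has_vector_derivative_eq_rhs [OF has_vector_derivative_mult [OF 1 der [OF t(3)]]])
        (simp add: algebra_simps)
    have "0 \<le> s * (x - t)" using s t xy by (auto simp: min_def max_def split: if_splits)
    then have "cmod (exp (\<i> * s * \<mu> * (x - t))) \<le> 1"
      using \<mu> mult_nonneg_nonneg [of "s * (x - t)" "Im \<mu>"] by (simp add: algebra_simps)
    then show "norm (exp (\<i> * s * \<mu> * (x - t)) * r t) \<le> g t"
      using r [of t] mult_right_mono [of "cmod (exp (\<i> * s * \<mu> * (x - t)))" 1 "cmod (r t)"]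
      by (simp add: norm_mult)
  qed (use g in auto)
  moreover have "\<phi> x = c x" by (simp add: \<phi>_def)
  moreover have "cmod (\<phi> y) = exp (- Im \<mu> * \<bar>x - y\<bar>) * cmod (c y)"
    using s xy by (auto simp: \<phi>_def norm_mult algebra_simps)
  moreover have "norm (\<phi> x - \<phi> y) = norm (\<phi> (max x y) - \<phi> (min x y))"
    by (auto simp: max_def min_def norm_minus_commute)
  ultimately show ?thesis
    by (smt (verit) norm_triangle_ineq2)
qed

text \<open>The two mode vectors enclose an angle whose cosine is \<^term>\<open>mode_angle m z \<kappa>\<close>.  On the interval where
  both one-sided integrals of \<open>|W F|\<close> are at least a quarter of the total, the triangle inequality for the
  two modes is strict by a definite factor, and this interval carries a definite part of the norm of \<open>W\<close>.\<close>

lemma birman_schwinger_gap: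
  assumes \<kappa>: "\<kappa>\<^sup>2 = z\<^sup>2 - (of_real m)\<^sup>2" "\<kappa> \<noteq> 0"
    and lam: "cmod lam = 1" "0 \<le> Im (lam * \<kappa>)"
    and W: "integrable lborel W"
    and F: "continuous_on UNIV F" and bdd: "\<And>x. norm (F x) \<le> Bd"
    and ode: "\<And>x. x \<noteq> 0 \<Longrightarrow> dirac_ode m z lam W F x"
    and decay: "0 < Im (lam * \<kappa>) \<or> (F \<longlongrightarrow> 0) at_infinity"
    and F0: "F xx \<noteq> 0"
  shows "1 + 3 / 128 * (1 - mode_angle m z \<kappa>) \<le> kernel_norm m z \<kappa> * (LINT x|lborel. mnorm (W x))"
proof -
  define P k where "P = cmod (z + m)" and "k = cmod \<kappa>"
  have zm: "z + of_real m \<noteq> 0" by (rule z_plus_m_nonzero [OF \<kappa>])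
  then have Pk: "0 < P" "0 < k" using \<kappa> by (auto simp: P_def k_def)
  define e where "e = mode_angle m z \<kappa>"
  have e_eq: "e = \<bar>P\<^sup>2 - k\<^sup>2\<bar> / (P\<^sup>2 + k\<^sup>2)" by (simp add: e_def mode_angle_def P_def k_def)
  have PK2: "P\<^sup>2 + k\<^sup>2 > 0" using Pk by (simp add: add_pos_pos)
  have e: "0 \<le> e" "e < 1" using Pk PK2 by (auto simp: e_eq divide_less_eq abs_less_iff)
  define n where "n = kernel_norm m z \<kappa>"
  define L where "L = sqrt (1 / k\<^sup>2 + 1 / P\<^sup>2) / 2"
  have L: "0 < L" unfolding L_def using Pk by (simp add: add_pos_pos)
  have nL: "n\<^sup>2 = (P\<^sup>2 + k\<^sup>2) * L\<^sup>2"
    using Pk unfolding n_def kernel_norm_def L_def P_def [symmetric] k_def [symmetric]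
    by (simp add: power_divide field_simps) (simp add: power2_eq_square power4_eq_xxxx algebra_simps)
  have n: "0 < n" using Pk by (simp add: n_def kernel_norm_def P_def [symmetric] k_def [symmetric] add_pos_pos)
  define w where "w = (\<lambda>x. mnorm (W x))"
  define G where "G = (\<lambda>x. w x * norm (F x))"
  have w: "integrable lborel w" unfolding w_def by (rule integrable_mnorm [OF W])
  have w0: "0 \<le> w x" for x by (simp add: w_def)
  have Fm: "F \<in> borel_measurable borel" by (rule borel_measurable_continuous_onI [OF F])
  have Bd0: "0 \<le> Bd" using bdd [of 0] norm_ge_zero order_trans by blast
  have G: "integrable lborel G"
  proof (rule Bochner_Integration.integrable_bound)
    show "integrable lborel (\<lambda>x. w x * Bd)" using w by simp
    show "G \<in> borel_measurable lborel" unfolding G_def using w Fm by measurable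
    show "AE x in lborel. norm (G x) \<le> norm (w x * Bd)"
      using bdd w0 Bd0 by (simp add: G_def mult_left_mono abs_mult)
  qed
  have G0: "0 \<le> G x" for x by (simp add: G_def w0)
  define T where "T = (LINT x|lborel. G x)"
  have T0: "0 \<le> T" unfolding T_def by (rule Bochner_Integration.integral_nonneg) (rule G0)
  have set_int: "set_integrable lborel {a..b} f" if "integrable lborel f" for a b and f :: "real \<Rightarrow> real"
    unfolding set_integrable_def by (rule integrable_mult_indicator [OF _ that]) simp
  have Gi: "G integrable_on {a..b}" for a b
    by (rule set_borel_integral_eq_integral(1) [OF set_int [OF G]])
  define J where "J = (\<lambda>a b. integral {a..b} G)"
  have J_eq: "J a b = (LINT x:{a..b}|lborel. G x)" for a b
    unfolding J_def by (rule set_borel_integral_eq_integral(2) [OF set_int [OF G], symmetric])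
  have J0: "0 \<le> J a b" for a b unfolding J_def by (rule integral_nonneg [OF Gi]) (rule G0)
  have JT: "J a b \<le> T" for a b
    unfolding J_eq T_def set_lebesgue_integral_def
    by (rule integral_mono [OF _ G]) (use set_int [OF G] G0 in \<open>auto simp: set_integrable_def indicator_def\<close>)
  have Jadd: "J a b + J b c = J a c" if "a \<le> b" "b \<le> c" for a b c
    unfolding J_def by (rule Henstock_Kurzweil_Integration.integral_combine [OF that Gi])
  have Jmono: "J b c \<le> J a d" if "a \<le> b" "b \<le> c" "c \<le> d" for a b c d
    using Jadd [of a b c] Jadd [of a c d] that J0 [of a b] J0 [of c d] by linarith
  have cF: "continuous_on UNIV (\<lambda>t. F t $ i)" for i
    by (intro continuous_intros F)
  define c where "c = (\<lambda>s t. mode m z \<kappa> s (F t))"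
  have cc: "continuous_on UNIV (c s)" for s
    unfolding c_def mode_def using zm \<kappa> by (intro continuous_intros cF) auto
  have cder: "(c s has_vector_derivative \<i> * s * (lam * \<kappa>) * c s t + mode_source m z \<kappa> lam s (W t) (F t)) (at t)"
    if "t \<noteq> 0" "s = 1 \<or> s = -1" for s t
    unfolding c_def by (rule mode_derivative [OF \<kappa> ode that(2)]) (rule that)
  have rem: "cmod (mode_source m z \<kappa> lam s (W t) (F t)) \<le> L * G t" if "s = 1 \<or> s = -1" for s t
    using mode_source_bound [OF lam(1) that] by (simp add: L_def G_def w_def mode_const_def P_def k_def)
  have cF': "cmod (c s t) \<le> L * norm (F t)" if "s = 1 \<or> s = -1" for s t
    using mode_bound [OF that] by (simp add: c_def L_def mode_const_def P_def k_def)
  \<comment> \<open>The boundary term at distance \<open>h\<close> is negligible under either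
    alternative of \<open>decay\<close>: by exponential damping of a bounded function, or by the
    decay of \<open>F\<close>.\<close>
  have far: "\<exists>h0\<ge>0. \<forall>h\<ge>h0. \<forall>y. \<bar>y - x\<bar> = h \<longrightarrow> exp (- Im (lam * \<kappa>) * h) * norm (F y) \<le> d" if "0 < d" for d x
  proof (cases "0 < Im (lam * \<kappa>)")
    case True
    obtain \<eta> where \<eta>: "Im (lam * \<kappa>) = \<eta>" by blast
    \<comment> \<open>From here on exp (\<eta> h) > \<eta> h \<ge> Bd / d.\<close>
    define h0 where "h0 = Bd / (d * \<eta>)"
    have h0: "exp (- Im (lam * \<kappa>) * h) * Bd < d" if "h \<ge> h0" for h
      unfolding \<eta>
    proof -
      have "0 < \<eta>" using True by (simp add: \<eta> del: times_complex.sel)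
      then have "Bd / d \<le> \<eta> * h"
        using that \<open>0 < d\<close> by (simp add: h0_def field_simps)
      then have "Bd / d < exp (\<eta> * h)"
        using exp_ge_add_one_self [of "\<eta> * h"] by linarith
      then show "exp (- \<eta> * h) * Bd < d" using \<open>0 < d\<close> by (simp add: exp_minus field_simps)
    qed
    have "exp (- Im (lam * \<kappa>) * h) * norm (F y) \<le> d" if "h \<ge> max 0 h0" for h y
    proof -
      have "exp (- Im (lam * \<kappa>) * h) * norm (F y) \<le> exp (- Im (lam * \<kappa>) * h) * Bd"
        by (intro mult_left_mono bdd) auto
      also have "\<dots> \<le> d" using h0 [of h] that by linarith
      finally show ?thesis .
    qed
    then show ?thesis by (intro exI [of _ "max 0 h0"]) auto
  next
    case False
    then have "(F \<longlongrightarrow> 0) at_infinity" using decay by blast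
    then have "\<forall>\<^sub>F y in at_infinity. norm (F y) < d"
      using that tendstoD by fastforce
    then obtain b where b: "\<And>y. \<bar>y\<bar> \<ge> b \<Longrightarrow> norm (F y) < d"
      by (auto simp: eventually_at_infinity)
    have "Im (lam * \<kappa>) = 0" using False lam by linarith
    moreover have "norm (F y) \<le> d" if "h \<ge> max 0 (b + \<bar>x\<bar>)" "\<bar>y - x\<bar> = h" for h y
      using that by (intro less_imp_le [OF b]) linarith
    ultimately show ?thesis by (intro exI [of _ "max 0 (b + \<bar>x\<bar>)"]) auto
  qed
  \<comment> \<open>The starting points are pushed beyond \<open>-R\<close> and \<open>R\<close>, so
    that both one-sided integrals can be compared with those over a fixed window.\<close>
  have modes: "\<exists>x0\<le>-R. \<exists>X\<ge>R. x0 \<le> x \<and> x \<le> X \<and> cmod (c 1 x) \<le> L * (d + J x0 x) \<and> cmod (c (-1) x) \<le> L * (d + J x X)"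
    if d: "0 < d" for d x R
  proof -
    obtain h0 where h0: "h0 \<ge> 0" "\<And>h y. h \<ge> h0 \<Longrightarrow> \<bar>y - x\<bar> = h \<Longrightarrow> exp (- Im (lam * \<kappa>) * h) * norm (F y) \<le> d"
      using far [OF d, of x] by meson
    define h where "h = max h0 (\<bar>R\<bar> + \<bar>x\<bar>)"
    have h: "h \<ge> h0" "h \<ge> 0" "x - h \<le> -R" "x + h \<ge> R" using h0(1) by (auto simp: h_def)
    have *: "cmod (c s x) \<le> L * (d + J (min x y) (max x y))"
      if s: "s = 1 \<or> s = -1" and y: "y = x - s * h" for s y
    proof -
      have "cmod (c s x) \<le> exp (- Im (lam * \<kappa>) * \<bar>x - y\<bar>) * cmod (c s y) + integral {min x y..max x y} (\<lambda>t. L * G t)"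
        by (rule outgoing_mode_bound [OF s lam(2) cc cder rem])
          (use s y h in \<open>auto intro!: integrable_on_mult_right Gi\<close>)
      also have "exp (- Im (lam * \<kappa>) * \<bar>x - y\<bar>) * cmod (c s y) \<le> exp (- Im (lam * \<kappa>) * \<bar>x - y\<bar>) * (L * norm (F y))"
        by (intro mult_left_mono cF' s) auto
      also have "\<dots> = L * (exp (- Im (lam * \<kappa>) * h) * norm (F y))"
        using s y h by auto
      also have "\<dots> \<le> L * d"
        using s y h L by (intro mult_left_mono h0(2)) auto
      finally show ?thesis by (simp add: J_def distrib_left)
    qed
    have "cmod (c 1 x) \<le> L * (d + J (x - h) x)" "cmod (c (-1) x) \<le> L * (d + J x (x + h))"
      using * [of 1 "x - h"] * [of "-1" "x + h"] h by (cases "h = 0"; simp add: min_def max_def)+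
    with h show ?thesis
      by - (rule exI [of _ "x - h"], simp, rule exI [of _ "x + h"], simp)
  qed
  have FA: "(norm (F x))\<^sup>2 \<le> n\<^sup>2 * (\<alpha>\<^sup>2 + \<beta>\<^sup>2 + 2 * e * \<alpha> * \<beta>)"
    if "cmod (c 1 x) \<le> L * \<alpha>" "cmod (c (-1) x) \<le> L * \<beta>" for x \<alpha> \<beta>
  proof -
    have 1: "F x $ 1 = (z + m) * (c 1 x + c (-1) x)" "F x $ 2 = \<kappa> * (c 1 x - c (-1) x)"
      unfolding c_def by (rule mode_decomposition [OF zm \<kappa>(2)])+
    have ab: "0 \<le> L * \<alpha>" "0 \<le> L * \<beta>" using that norm_ge_zero order_trans by blast+
    have "(norm (F x))\<^sup>2 \<le> (P\<^sup>2 + k\<^sup>2) * ((cmod (c 1 x))\<^sup>2 + (cmod (c (-1) x))\<^sup>2 + 2 * e * cmod (c 1 x) * cmod (c (-1) x))"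
      unfolding norm_cvec2 1 e_eq by (rule mode_sum_norm) (use Pk in \<open>auto simp: P_def k_def\<close>)
    also have "\<dots> \<le> (P\<^sup>2 + k\<^sup>2) * ((L * \<alpha>)\<^sup>2 + (L * \<beta>)\<^sup>2 + 2 * e * (L * \<alpha>) * (L * \<beta>))"
      using PK2 e ab that by (intro mult_left_mono add_mono power_mono mult_mono) auto
    also have "\<dots> = n\<^sup>2 * (\<alpha>\<^sup>2 + \<beta>\<^sup>2 + 2 * e * \<alpha> * \<beta>)"
      unfolding nL by (simp add: power_mult_distrib algebra_simps power2_eq_square)
    finally show ?thesis .
  qed
  \<comment> \<open>If each side carries at least S / 4, then \<alpha>\<beta> \<ge> S^2 / 16, and
    (\<alpha> + \<beta>)^2 - 2 (1 - e) \<alpha>\<beta> loses (1 - e) S^2 / 8. The choice S = 0 gives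
    the plain sup bound, S = T the improved one.\<close>
  have FT2: "(norm (F x))\<^sup>2 \<le> n\<^sup>2 * (T\<^sup>2 - (1 - e) / 8 * S\<^sup>2)"
    if S: "0 \<le> S" "J (-R) x \<ge> S / 4" "J x R \<ge> S / 4" "\<bar>x\<bar> \<le> R" for x R S
  proof -
    have "(norm (F x))\<^sup>2 \<le> n\<^sup>2 * ((T + 2 * d)\<^sup>2 - (1 - e) / 8 * S\<^sup>2)" if d: "0 < d" for d
    proof -
      obtain x0 X where X: "x0 \<le> -R" "R \<le> X" "x0 \<le> x" "x \<le> X"
        "cmod (c 1 x) \<le> L * (d + J x0 x)" "cmod (c (-1) x) \<le> L * (d + J x X)"
        using modes [OF d, of R x] by auto
      define \<alpha> \<beta> where "\<alpha> = d + J x0 x" and "\<beta> = d + J x X"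
      have ab: "\<alpha> \<ge> S / 4" "\<beta> \<ge> S / 4" "\<alpha> + \<beta> \<le> T + 2 * d"
        using Jmono [of x0 "-R" x x] Jmono [of x x R X] X S d Jadd [of x0 x X] JT [of x0 X]
        by (auto simp: \<alpha>_def \<beta>_def abs_le_iff)
      have "\<alpha>\<^sup>2 + \<beta>\<^sup>2 + 2 * e * \<alpha> * \<beta> = (\<alpha> + \<beta>)\<^sup>2 - 2 * (1 - e) * (\<alpha> * \<beta>)"
        by (simp add: power2_eq_square algebra_simps)
      also have "\<dots> \<le> (T + 2 * d)\<^sup>2 - 2 * (1 - e) * (S / 4 * (S / 4))"
        using ab S e by (intro diff_mono power_mono mult_left_mono mult_mono) auto
      finally have "\<alpha>\<^sup>2 + \<beta>\<^sup>2 + 2 * e * \<alpha> * \<beta> \<le> (T + 2 * d)\<^sup>2 - (1 - e) / 8 * S\<^sup>2"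
        by (simp add: power2_eq_square field_simps)
      then show ?thesis
        using FA [of x \<alpha> \<beta>] X(5,6) mult_left_mono [of _ _ "n\<^sup>2"] unfolding \<alpha>_def \<beta>_def
        by (meson order_trans zero_le_power2)
    qed
    then have "(norm (F x))\<^sup>2 \<le> n\<^sup>2 * ((T + 2 * 0)\<^sup>2 - (1 - e) / 8 * S\<^sup>2)"
      by (rule le_limit_at_0) (auto intro!: continuous_intros)
    then show ?thesis by simp
  qed
  have FT: "norm (F x) \<le> n * T" for x
  proof (rule power2_le_imp_le)
    show "(norm (F x))\<^sup>2 \<le> (n * T)\<^sup>2"
      using FT2 [of 0 "\<bar>x\<bar>" x] J0 by (simp add: power_mult_distrib)
  qed (use n T0 in simp)
  have T: "0 < T"
    using FT [of xx] F0 T0 n by (cases "T = 0") auto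
  \<comment> \<open>An upper bound, linear in \<open>e\<close>, for the square root of 1 - (1 - e) /
    8.\<close>
  define g where "g = 1 - (1 - e) / 16"
  have g: "0 < g" "g < 1" using e by (auto simp: g_def field_simps)
  \<comment> \<open>The window carries 7/8 of \<open>T\<close>. The levels 1/4 and 5/8 leave at
    least 1/4 of \<open>T\<close> on either side of each point between \<open>x1\<close> and
    \<open>x2\<close>, and 3/8 of \<open>T\<close> between them; 3/8 times (1 - e) / 16 is the gap
    3/128 (1 - e).\<close>
  obtain R where R: "0 < R" "T - T / 8 \<le> J (-R) R"
    using integral_mass_in_interval [OF G, of "T / 8"] T unfolding T_def [symmetric] J_eq by auto
  have cJ: "continuous_on {-R..R} (J (-R))"
    unfolding J_def by (rule indefinite_integral_continuous_1 [OF Gi])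
  have "J (-R) (-R) = 0" by (simp add: J_def)
  then obtain x1 where x1: "-R \<le> x1" "x1 \<le> R" "J (-R) x1 = T / 4"
    using IVT' [of "J (-R)" "-R" "T / 4" R] cJ R T by auto
  obtain x2 where x2: "x1 \<le> x2" "x2 \<le> R" "J (-R) x2 = 5 / 8 * T"
    using IVT' [of "J (-R)" x1 "5/8 * T" R] continuous_on_subset [OF cJ, of "{x1..R}"] R T x1 by auto
  have Fmid: "norm (F x) \<le> g * (n * T)" if "x1 \<le> x" "x \<le> x2" for x
  proof (rule power2_le_imp_le)
    have "(norm (F x))\<^sup>2 \<le> n\<^sup>2 * (T\<^sup>2 - (1 - e) / 8 * T\<^sup>2)"
    proof (rule FT2)
      show "T / 4 \<le> J (-R) x" using Jmono [of "-R" "-R" x1 x] that x1 by simp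
      show "T / 4 \<le> J x R" using Jmono [of x x2 R R] Jadd [of "-R" x2 R] that x1 x2 R by simp
    qed (use T x1 x2 that in auto)
    also have "\<dots> = (n * T)\<^sup>2 * (1 - (1 - e) / 8)" by (simp add: power_mult_distrib algebra_simps)
    also have "\<dots> \<le> (n * T)\<^sup>2 * g\<^sup>2"
    proof (rule mult_left_mono)
      show "1 - (1 - e) / 8 \<le> g\<^sup>2"
      proof -
        have "g\<^sup>2 = 1 - (1 - e) / 8 + ((1 - e) / 16)\<^sup>2"
          by (simp add: g_def power2_eq_square field_simps)
        then show ?thesis using zero_le_power2 [of "(1 - e) / 16"] by linarith
      qed
    qed simp
    finally show "(norm (F x))\<^sup>2 \<le> (g * (n * T))\<^sup>2" by (simp add: power_mult_distrib mult.commute)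
  qed (use g n T in simp)
  define w1 where "w1 = (LINT x:{x1..x2}|lborel. w x)"
  have w1_int: "integrable lborel (\<lambda>x. indicat_real {x1..x2} x * w x)"
    using set_int [OF w, of x1 x2] by (simp add: set_integrable_def)
  have nT: "0 < n * T" using n T by simp
  \<comment> \<open>Integrating the bounds for |F| against \<open>w\<close> bounds \<open>T\<close>
    by a multiple of itself, from which the positive factor \<open>T\<close> is finally
    cancelled.\<close>
  have "T = (LINT x|lborel. G x)" by (rule T_def)
  also have "\<dots> \<le> (LINT x|lborel. n * T * w x - (1 - g) * (n * T) * (indicat_real {x1..x2} x * w x))"
  proof (rule integral_mono [OF G])
    fix x
    show "G x \<le> n * T * w x - (1 - g) * (n * T) * (indicat_real {x1..x2} x * w x)"
    proof (cases "x \<in> {x1..x2}")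
      case True
      then have "G x \<le> w x * (g * (n * T))"
        unfolding G_def by (intro mult_left_mono Fmid w0) auto
      then show ?thesis using True by (simp add: algebra_simps)
    next
      case False
      have "G x \<le> w x * (n * T)" unfolding G_def by (intro mult_left_mono FT w0)
      then show ?thesis using False by (simp add: algebra_simps)
    qed
  qed (intro Bochner_Integration.integrable_diff integrable_mult_right w w1_int)
  also have "\<dots> = n * T * (LINT x|lborel. w x) - (1 - g) * (n * T) * w1"
    using w w1_int by (simp add: w1_def set_lebesgue_integral_def)
  finally have 1: "T \<le> n * T * (LINT x|lborel. w x) - (1 - g) * (n * T) * w1" .
  \<comment> \<open>On the middle interval \<open>G\<close> has integral 3/8 \<open>T\<close> and is
    at most n T \<open>w\<close>; this forces a lower bound on the mass \<open>w1\<close> of the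
    potential there.\<close>
  have "3 / 8 * T = J x1 x2" using Jadd [of "-R" x1 x2] x1 x2 by simp
  also have "\<dots> \<le> (LINT x|lborel. n * T * (indicat_real {x1..x2} x * w x))"
    unfolding J_eq set_lebesgue_integral_def
  proof (rule integral_mono)
    fix x
    show "indicat_real {x1..x2} x *\<^sub>R G x \<le> n * T * (indicat_real {x1..x2} x * w x)"
      using mult_left_mono [OF FT w0, of x x] by (simp add: G_def indicator_def algebra_simps)
  qed (use w1_int set_int [OF G] in \<open>auto simp: set_integrable_def\<close>)
  also have "\<dots> = n * T * w1" by (simp add: w1_def set_lebesgue_integral_def)
  finally have "(1 - g) * (3 / 8 * T) \<le> (1 - g) * (n * T * w1)"
    using g by (intro mult_left_mono) auto
  then have "T + (1 - g) * (3 / 8) * T \<le> n * T * (LINT x|lborel. w x)"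
    using 1 by (simp add: algebra_simps)
  then have "T * (1 + (1 - g) * (3 / 8)) \<le> T * (n * (LINT x|lborel. w x))"
    by (simp add: algebra_simps)
  then have "1 + (1 - g) * (3 / 8) \<le> n * (LINT x|lborel. w x)"
    using T by (simp only: mult_le_cancel_left_pos)
  then show ?thesis by (simp add: n_def g_def e_def w_def algebra_simps)
qed

section \<open>Eigenfunctions as solutions of the Dirac equation\<close>

lemma sector_rcis: "\<lbrakk>0 < r; \<bar>\<phi>\<bar> < \<alpha>; \<alpha> < pi\<rbrakk> \<Longrightarrow> cis \<phi> * of_real r \<in> sector \<alpha>"
  using Arg_times_of_real [of r "cis \<phi>"] Arg_cis [of \<phi>]
  by (auto simp: sector_def mult.commute abs_less_iff)

lemma double_sector_rcis: "\<lbrakk>x \<noteq> 0; \<bar>\<phi>\<bar> < \<alpha>; \<alpha> < pi\<rbrakk> \<Longrightarrow> cis \<phi> * of_real x \<in> double_sector \<alpha>"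
  using sector_rcis [of x \<phi> \<alpha>] sector_rcis [of "-x" \<phi> \<alpha>]
  by (cases "0 < x") (force simp: double_sector_def)+

lemma continuous_on_matrix_entries:
  fixes V :: "'a::topological_space \<Rightarrow> complex^2^2"
  assumes "\<And>i j. continuous_on S (\<lambda>z. V z $ i $ j)" shows "continuous_on S V"
proof -
  have "continuous_on S (\<lambda>z. \<chi> i j. V z $ i $ j)"
    by (intro continuous_on_vec_lambda assms)
  then show ?thesis by simp
qed

lemma admissible_continuous:
  assumes "admissible_potential \<alpha> V" shows "continuous_on (double_sector \<alpha>) V"
  using assms by (intro continuous_on_matrix_entries holomorphic_on_imp_continuous_on analytic_imp_holomorphic)
    (auto simp: admissible_potential_def)

lemma admissible_bounded:
  assumes "admissible_potential \<alpha> V"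
  obtains C where "0 \<le> C" "\<And>\<zeta>. \<zeta> \<in> double_sector \<alpha> \<Longrightarrow> mnorm (V \<zeta>) \<le> C"
proof -
  obtain C where C: "\<And>\<zeta>. \<zeta> \<in> double_sector \<alpha> \<Longrightarrow> norm (V \<zeta>) \<le> C"
    using assms by (auto simp: admissible_potential_def bounded_iff)
  show ?thesis
    by (rule that [of "\<bar>C\<bar>"]) (use C mnorm_le_norm order_trans in fastforce)+
qed

lemma admissible_integrable:
  assumes "admissible_potential \<alpha> V" "\<bar>\<phi>\<bar> < \<alpha>"
  shows "integrable lborel (\<lambda>x. V (cis \<phi> * of_real x))"
proof -
  define b where "b = (\<bar>\<phi>\<bar> + \<alpha>) / 2"
  have "0 < b" "b < \<alpha>" "\<bar>\<phi>\<bar> \<le> b" using assms by (auto simp: b_def)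
  then show ?thesis using assms(1) unfolding admissible_potential_def by blast
qed

lemma sigma1_mult: "sigma1 *v u = vector [u $ 2, u $ 1]"
  and sigma3_mult: "sigma3 *v u = vector [u $ 1, - u $ 2]"
  by (simp_all add: vec_eq_iff forall_2 matrix_vector_nth2 sigma1_def sigma3_def vector_2)

lemma L2_set_integrable:
  assumes "f \<in> L2" shows "set_integrable lborel {a..b} f"
proof -
  have f: "f \<in> borel_measurable lborel" "integrable lborel (\<lambda>x. (norm (f x))\<^sup>2)"
    using assms by (auto simp: L2_def)
  have "integrable lborel (\<lambda>x. indicat_real {a..b} x + (norm (f x))\<^sup>2)"
    by (intro Bochner_Integration.integrable_add f(2) integrable_real_indicator)
      (auto simp: emeasure_lborel_Icc_eq)
  then show ?thesis
    unfolding set_integrable_def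
  proof (rule Bochner_Integration.integrable_bound)
    show "AE x in lborel. norm (indicator {a..b} x *\<^sub>R f x) \<le> norm (indicat_real {a..b} x + (norm (f x))\<^sup>2)"
    proof (rule AE_I2)
      fix x
      have "norm (f x) \<le> 1 + (norm (f x))\<^sup>2"
        using zero_le_power2 [of "norm (f x) - 1/2"] by (simp add: power2_eq_square algebra_simps)
      then show "norm (indicator {a..b} x *\<^sub>R f x) \<le> norm (indicat_real {a..b} x + (norm (f x))\<^sup>2)"
        by (simp add: indicator_def)
    qed
  qed (use f in measurable)
qed

definition dirac_rhs :: "real \<Rightarrow> complex \<Rightarrow> complex^2^2 \<Rightarrow> complex^2 \<Rightarrow> complex^2" where
  "dirac_rhs m z A u = vector [(z + m) * u $ 2 - (A *v u) $ 2, (z - m) * u $ 1 - (A *v u) $ 1]"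

lemma norm_dirac_rhs: "norm (dirac_rhs m z A u) \<le> (cmod z + \<bar>m\<bar> + mnorm A) * norm u"
proof -
  define p :: "complex^2" where "p = vector [z * u $ 2, z * u $ 1]"
  define q :: "complex^2" where "q = vector [m * u $ 2, - m * u $ 1]"
  define r :: "complex^2" where "r = vector [(A *v u) $ 2, (A *v u) $ 1]"
  have "dirac_rhs m z A u = p + q - r"
    by (simp add: dirac_rhs_def p_def q_def r_def vec_eq_iff forall_2 vector_2 algebra_simps)
  then have "norm (dirac_rhs m z A u) \<le> norm p + norm q + norm r"
    using norm_triangle_ineq [of p q] norm_triangle_ineq4 [of "p + q" r] by simp
  moreover have "norm p = cmod z * norm u" "norm q = \<bar>m\<bar> * norm u" "norm r = norm (A *v u)"
    unfolding p_def q_def r_def norm_cvec2_sqrt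
    by (simp_all add: vector_2 norm_mult power_mult_distrib real_sqrt_mult add.commute
          flip: distrib_left)
  ultimately show ?thesis using mnorm_bound [of A u] by (simp add: algebra_simps)
qed

lemma has_vector_derivative_nth:
  "(f has_vector_derivative d) F \<Longrightarrow> ((\<lambda>t. f t $ i) has_vector_derivative d $ i) F"
  by (rule bounded_linear.has_vector_derivative [OF bounded_linear_vec_nth])

text \<open>Regularity: the weak derivative agrees almost everywhere with an expression that is
  continuous off 0, so its indefinite integral is differentiable there. Decay: F is square
  integrable and |F'| \<le> C |F|, so the value at a point is controlled by the mass on a unit
  interval. The modulus of \<open>exp \<theta>\<close> is scaled away at the end.\<close>

lemma eigenfunction_ode:
  assumes adm: "admissible_potential \<alpha> V" and \<theta>: "\<bar>Im \<theta>\<bar> < \<alpha>" "\<alpha> < pi"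
    and eig: "is_eigenvalue (dirac m V \<theta>) z"
  obtains F x0 where "continuous_on UNIV F" "(F \<longlongrightarrow> 0) at_infinity" "F x0 \<noteq> 0"
    "\<And>x. x \<noteq> 0 \<Longrightarrow> dirac_ode m z (cis (Im \<theta>)) (\<lambda>x. V (cis (Im \<theta>) * of_real x)) F x"
proof -
  obtain f where f: "dirac m V \<theta> f (\<lambda>x. z *s f x)" "\<not> (AE x in lborel. f x = 0)"
    using eig by (auto simp: is_eigenvalue_def)
  define U where "U = (\<lambda>x::real. V (exp \<theta> * of_real x))"
  obtain h0 f' where h: "AE x in lborel. z *s f x = h0 x + U x *v f x"
    "AE x in lborel. h0 x = (- \<i> * exp (- \<theta>)) *s (sigma1 *v f' x) + of_real m *s (sigma3 *v f x)"
    "has_H1_derivative f f'"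
    using f(1) unfolding dirac_def free_dirac_def U_def by blast
  obtain F where F: "AE x in lborel. f x = F x" "\<And>a b. a \<le> b \<Longrightarrow> F b - F a = (LINT x:{a..b}|lborel. f' x)"
    and L2: "f \<in> L2" "f' \<in> L2"
    using h(3) unfolding has_H1_derivative_def by blast
  define r where "r = (\<lambda>x. (\<i> * exp \<theta>) *s dirac_rhs m z (U x) (F x))"
  have "AE x in lborel. f' x = r x"
    using h(1,2) F(1)
  proof eventually_elim
    case (elim x)
    then have "z *s F x = (- \<i> * exp (- \<theta>)) *s (sigma1 *v f' x) + of_real m *s (sigma3 *v F x) + U x *v F x"
      by simp
    then have "z * F x $ 1 = - (\<i> * exp (- \<theta>)) * f' x $ 2 + m * F x $ 1 + (U x *v F x) $ 1"
      "z * F x $ 2 = - (\<i> * exp (- \<theta>)) * f' x $ 1 - m * F x $ 2 + (U x *v F x) $ 2"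
      by (simp_all add: vec_eq_iff forall_2 sigma1_mult sigma3_mult vector_2)
    then have "(z - m) * F x $ 1 - (U x *v F x) $ 1 = - (\<i> * exp (- \<theta>)) * f' x $ 2"
      "(z + m) * F x $ 2 - (U x *v F x) $ 2 = - (\<i> * exp (- \<theta>)) * f' x $ 1"
      by (simp_all add: algebra_simps)
    moreover have "- (\<i> * exp \<theta> * (\<i> * inverse (exp \<theta>) * w)) = w" for w
      by (simp add: field_simps)
    ultimately show ?case
      by (simp add: r_def dirac_rhs_def vec_eq_iff forall_2 vector_2 exp_minus)
  qed
  then obtain N0 where N0: "\<And>x. x \<in> space lborel - N0 \<Longrightarrow> f' x = r x" "N0 \<in> null_sets lborel"
    by (rule AE_E3) (rule that)
  define N where "N = insert 0 N0"
  have N: "negligible N" "\<And>x. x \<notin> N \<Longrightarrow> f' x = r x \<and> x \<noteq> 0"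
    using N0 null_sets_completionI [OF N0(2)] by (auto simp: N_def negligible_iff_null_sets)
  have f'i: "f' integrable_on {a..b}" for a b
    by (rule set_borel_integral_eq_integral(1) [OF L2_set_integrable [OF L2(2)]])
  have FI: "F b - F a = integral {a..b} f'" if "a \<le> b" for a b
    using F(2) [OF that] set_borel_integral_eq_integral(2) [OF L2_set_integrable [OF L2(2)], of a b] by simp
  have FI': "F a + integral {a..b} f' = F b" if "a \<le> b" for a b
    using FI [OF that] by (metis add.commute diff_add_cancel)
  have cF: "continuous_on UNIV F"
  proof (rule continuous_at_imp_continuous_on, rule ballI)
    fix x
    have "continuous_on {x-1..x+1} (\<lambda>t. F (x-1) + integral {x-1..t} f')"
      by (intro continuous_intros indefinite_integral_continuous_1 f'i)
    then have "continuous_on {x-1..x+1} F"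
      by (rule continuous_on_eq) (simp add: FI')
    then show "isCont F x"
      by (rule continuous_on_interior) auto
  qed
  have rs: "exp \<theta> * of_real x = cis (Im \<theta>) * of_real (exp (Re \<theta>) * x)" for x
    by (simp add: exp_eq_polar mult_ac exp_of_real)
  have dsec: "exp \<theta> * of_real x \<in> double_sector \<alpha>" if "x \<noteq> 0" for x
    unfolding rs by (rule double_sector_rcis) (use \<theta> that in auto)
  have cr: "continuous_on S r" if "0 \<notin> S" for S
  proof -
    have "continuous_on S U"
      unfolding U_def using that
      by (intro continuous_on_compose2 [OF admissible_continuous [OF adm]] continuous_intros) (auto intro!: dsec)
    then have U: "continuous_on S (\<lambda>x. U x $ i $ j)" for i j by (intro continuous_intros)
    have F: "continuous_on S (\<lambda>x. F x $ i)" for i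
      by (intro continuous_intros continuous_on_subset [OF cF]) auto
    have UF: "continuous_on S (\<lambda>x. (U x *v F x) $ i)" for i
      unfolding matrix_vector_nth2 by (intro continuous_intros U F)
    have r: "r = (\<lambda>x. \<chi> i. if i = 1 then \<i> * exp \<theta> * ((z + of_real m) * F x $ 2 - (U x *v F x) $ 2)
      else \<i> * exp \<theta> * ((z - of_real m) * F x $ 1 - (U x *v F x) $ 1))"
      by (simp add: r_def dirac_rhs_def fun_eq_iff vec_eq_iff forall_2 vector_2)
    have iff: "continuous_on S (\<lambda>x. if P then g x else h x)"
      if "continuous_on S g" "continuous_on S h" for P and g h :: "real \<Rightarrow> complex"
      using that by (cases P) auto
    show ?thesis unfolding r
      by (rule continuous_on_vec_lambda, rule iff) (intro continuous_intros UF F)+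
  qed
  have der: "(F has_vector_derivative r x) (at x)" if "x \<noteq> 0" for x
  proof -
    define a b where "a = x - \<bar>x\<bar> / 2" and "b = x + \<bar>x\<bar> / 2"
    have ab: "a < x" "x < b" "0 \<notin> {a..b}" using that by (auto simp: a_def b_def abs_if field_simps)
    have "((\<lambda>t. F a + integral {a..t} r) has_vector_derivative 0 + r x) (at x within {a..b})"
      by (intro has_vector_derivative_add has_vector_derivative_const integral_has_vector_derivative cr ab)
        (use ab in auto)
    then have "((\<lambda>t. F a + integral {a..t} r) has_vector_derivative r x) (at x)"
      using ab by (simp add: at_within_Icc_at)
    then show ?thesis
    proof (rule has_vector_derivative_transform_within_open [of _ _ _ "{a<..<b}"])
      fix t assume "t \<in> {a<..<b}"
      then have "F t - F a = integral {a..t} f'" by (intro FI) auto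
      also have "\<dots> = integral {a..t} r" by (rule integral_spike [OF N(1)]) (use N(2) in auto)
      finally show "F a + integral {a..t} r = F t" by (simp add: algebra_simps)
    qed (use ab in auto)
  qed
  obtain Cv where Cv: "0 \<le> Cv" "\<And>\<zeta>. \<zeta> \<in> double_sector \<alpha> \<Longrightarrow> mnorm (V \<zeta>) \<le> Cv"
    using admissible_bounded [OF adm] by blast
  define C where "C = exp (Re \<theta>) * (cmod z + \<bar>m\<bar> + Cv)"
  have C: "0 \<le> C" using Cv by (simp add: C_def)
  have rC: "norm (r x) \<le> C * norm (F x)" if "x \<noteq> 0" for x
  proof -
    have "norm (r x) = exp (Re \<theta>) * norm (dirac_rhs m z (U x) (F x))"
      unfolding r_def norm_cvec2_sqrt
      by (simp add: norm_mult power_mult_distrib real_sqrt_mult flip: distrib_left)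
    also have "\<dots> \<le> exp (Re \<theta>) * ((cmod z + \<bar>m\<bar> + Cv) * norm (F x))"
      using Cv(2) [OF dsec [OF that]]
      by (intro mult_left_mono order_trans [OF norm_dirac_rhs] mult_right_mono) (auto simp: U_def)
    finally show ?thesis by (simp add: C_def)
  qed
  have nFi: "(\<lambda>t. norm (F t)) integrable_on {a..b}" for a b
    by (intro integrable_continuous_real continuous_intros continuous_on_subset [OF cF]) auto
  have Fdiff: "norm (F y - F x) \<le> C * integral {x..x+1} (\<lambda>t. norm (F t))" if "x \<le> y" "y \<le> x + 1" for x y
  proof -
    have "norm (F y - F x) \<le> integral {x..y} (\<lambda>t. C * norm (F t))"
      by (rule norm_diff_le_integral [where f' = r])
        (use that der rC nFi in \<open>auto intro!: integrable_on_mult_right continuous_on_subset [OF cF]\<close>)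
    also have "\<dots> \<le> integral {x..x+1} (\<lambda>t. C * norm (F t))"
      by (rule integral_subset_le) (use that C nFi in \<open>auto intro!: integrable_on_mult_right\<close>)
    finally show ?thesis by simp
  qed
  define g where "g = (\<lambda>x. (norm (F x))\<^sup>2)"
  have g: "integrable lborel g"
  proof -
    have "integrable lborel (\<lambda>x. (norm (f x))\<^sup>2)" using L2 by (simp add: L2_def)
    moreover have "AE x in lborel. (norm (f x))\<^sup>2 = g x"
      using F(1) by eventually_elim (simp add: g_def)
    moreover have "g \<in> borel_measurable lborel" "(\<lambda>x. (norm (f x))\<^sup>2) \<in> borel_measurable lborel"
      using borel_measurable_continuous_onI [OF cF] L2 by (auto simp: g_def L2_def)
    ultimately show ?thesis using integrable_cong_AE by blast
  qed
  have gi: "set_integrable lborel {a..b} g" for a b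
    unfolding set_integrable_def by (rule integrable_mult_indicator [OF _ g]) simp
  \<comment> \<open>The value at \<open>x\<close> is at most 1 + C times the mean of |F| over the
    unit interval to the right, and |F| \<le> d + |F|^2 / d turns the mean into L2 mass, with
    \<open>d\<close> free.\<close>
  have Fbound: "norm (F x) \<le> (1 + C) * (d + (LINT t:{x..x+1}|lborel. g t) / d)" if d: "0 < d" for x d
  proof -
    let ?I = "integral {x..x+1} (\<lambda>t. norm (F t))"
    have "norm (F x) \<le> integral {x..x+1} (\<lambda>y. norm (F y) + C * ?I)"
    proof -
      have "integral {x..x+1} (\<lambda>y. norm (F x)) \<le> integral {x..x+1} (\<lambda>y. norm (F y) + C * ?I)"
      proof (rule integral_le)
        fix y assume "y \<in> {x..x+1}"
        then show "norm (F x) \<le> norm (F y) + C * ?I"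
          using Fdiff [of x y] norm_triangle_sub [of "F x" "F y"] by (simp add: norm_minus_commute)
      qed (auto intro!: Henstock_Kurzweil_Integration.integrable_add nFi)
      then show ?thesis by simp
    qed
    also have "\<dots> = (1 + C) * ?I"
      by (subst Henstock_Kurzweil_Integration.integral_add) (auto simp: nFi algebra_simps)
    also have "?I \<le> integral {x..x+1} (\<lambda>t. d + g t / d)"
    proof (rule integral_le)
      show "(\<lambda>t. d + g t / d) integrable_on {x..x+1}"
        using set_borel_integral_eq_integral(1) [OF gi, of x "x+1"]
        by (auto intro!: Henstock_Kurzweil_Integration.integrable_add integrable_on_divide)
      fix t
      have "0 \<le> (norm (F t) - d)\<^sup>2 + norm (F t) * d" using d by simp
      then show "norm (F t) \<le> d + g t / d"
        using d by (simp add: g_def field_simps power2_eq_square)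
    qed (rule nFi)
    also have "\<dots> = d + (LINT t:{x..x+1}|lborel. g t) / d"
      using set_borel_integral_eq_integral [OF gi, of x "x+1"]
      by (subst Henstock_Kurzweil_Integration.integral_add) (auto intro!: integrable_on_divide)
    finally show ?thesis using C by (simp add: mult_left_mono)
  qed
  have lim: "(F \<longlongrightarrow> 0) at_infinity"
  proof (rule tendstoI)
    fix e :: real assume e: "0 < e"
    \<comment> \<open>Far out the mass on a unit interval is at most d^2, so the bound becomes 2 (1
      + C) d = e / 2.\<close>
    define d where "d = e / (4 * (1 + C))"
    have d: "0 < d" using e C by (simp add: d_def)
    obtain R where R: "0 < R" "(LINT x|lborel. g x) - d * d \<le> (LINT x:{-R..R}|lborel. g x)"
      using integral_mass_in_interval [OF g, of "d * d"] d by auto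
    \<comment> \<open>The margin 2 keeps [x, x + 1] disjoint from [-R, R] also when x is
      negative.\<close>
    have "norm (F x) < e" if x: "\<bar>x\<bar> \<ge> R + 2" for x
    proof -
      have "(LINT t:{x..x+1}|lborel. g t) + (LINT t:{-R..R}|lborel. g t)
        = (LINT t|lborel. indicat_real {x..x+1} t *\<^sub>R g t + indicat_real {-R..R} t *\<^sub>R g t)"
        unfolding set_lebesgue_integral_def
        by (rule Bochner_Integration.integral_add [symmetric]) (use gi in \<open>auto simp: set_integrable_def\<close>)
      also have "\<dots> \<le> (LINT t|lborel. g t)"
        by (rule integral_mono [OF _ g])
          (use gi x R in \<open>auto simp: set_integrable_def g_def indicator_def\<close>)
      finally have "(LINT t:{x..x+1}|lborel. g t) / d \<le> d"
        using R d by (simp add: field_simps)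
      then have "norm (F x) \<le> (1 + C) * (d + d)"
        using Fbound [OF d, of x] C by (smt (verit) mult_left_mono)
      also have "\<dots> = 2 * ((1 + C) * d)" by (simp add: algebra_simps)
      also have "(1 + C) * d = e / 4"
        using C nonzero_eq_divide_eq [of "4 * (1 + C)" d e] by (simp add: d_def algebra_simps)
      finally show ?thesis using e by linarith
    qed
    then show "\<forall>\<^sub>F x in at_infinity. dist (F x) 0 < e"
      by (auto simp: eventually_at_infinity)
  qed
  obtain xx where xx: "F xx \<noteq> 0"
  proof (rule ccontr)
    assume "\<not> thesis"
    then have "\<And>x. F x = 0" using that by blast
    then show False using f(2) F(1) by simp
  qed
  define s where "s = exp (- Re \<theta>)"
  have s: "0 < s" by (simp add: s_def)
  define H where "H = (\<lambda>x. F (s * x))"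
  show ?thesis
  proof (rule that)
    show "continuous_on UNIV H"
      unfolding H_def by (intro continuous_on_compose2 [OF cF] continuous_intros) auto
    show "(H \<longlongrightarrow> 0) at_infinity"
    proof (rule tendstoI)
      fix e :: real assume "0 < e"
      then have "\<forall>\<^sub>F x in at_infinity. dist (F x) 0 < e" by (rule tendstoD [OF lim])
      then obtain b where b: "\<And>x. b \<le> \<bar>x\<bar> \<Longrightarrow> dist (F x) 0 < e"
        by (auto simp: eventually_at_infinity)
      have "dist (H x) 0 < e" if "b / s \<le> \<bar>x\<bar>" for x
        unfolding H_def by (rule b) (use that s in \<open>simp add: abs_mult field_simps\<close>)
      then show "\<forall>\<^sub>F x in at_infinity. dist (H x) 0 < e"
        by (auto simp: eventually_at_infinity)
    qed
    show "H (xx / s) \<noteq> 0" using s xx by (simp add: H_def)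
    fix x :: real assume x: "x \<noteq> 0"
    have "(H has_vector_derivative s *\<^sub>R r (s * x)) (at x)"
    proof -
      have "((F \<circ> (\<lambda>x. s * x)) has_vector_derivative s *\<^sub>R r (s * x)) (at x)"
        by (rule vector_diff_chain_at) (use der x s in \<open>auto intro!: derivative_eq_intros\<close>)
      then show ?thesis by (simp add: H_def o_def)
    qed
    moreover have "s *\<^sub>R r (s * x) = (\<i> * cis (Im \<theta>)) *s dirac_rhs m z (V (cis (Im \<theta>) * of_real x)) (H x)"
    proof -
      have e1: "exp (Re \<theta>) * (s * x) = x" by (simp add: s_def exp_minus)
      have "of_real s * exp \<theta> = of_real (s * exp (Re \<theta>)) * cis (Im \<theta>)"
        by (simp add: exp_eq_polar mult.assoc)
      then have e2: "of_real s * (\<i> * exp \<theta>) = \<i> * cis (Im \<theta>)"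
        by (simp add: s_def exp_minus mult.left_commute)
      have e3: "s *\<^sub>R (a *s v) = (of_real s * a) *s v" for a and v :: "complex^2"
        by (simp add: vec_eq_iff scaleR_conv_of_real [of s "_ :: complex"])
      show ?thesis unfolding r_def U_def rs e1 e3 e2 H_def ..
    qed
    ultimately have "(H has_vector_derivative (\<i> * cis (Im \<theta>)) *s dirac_rhs m z (V (cis (Im \<theta>) * of_real x)) (H x)) (at x)"
      by simp
    from has_vector_derivative_nth [OF this, of 1] has_vector_derivative_nth [OF this, of 2]
    show "dirac_ode m z (cis (Im \<theta>)) (\<lambda>x. V (cis (Im \<theta>) * of_real x)) H x"
      by (simp add: dirac_ode_def dirac_rhs_def vector_2)
  qed
qed

section \<open>A three-lines theorem for ray norms\<close>

text \<open>Linear inequalities describe the sector, so that openness and convexity, hence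
  primitives and connectedness, come for free.\<close>

lemma sector_iff:
  assumes "0 < \<alpha>" "\<alpha> < pi / 2"
  shows "z \<in> sector \<alpha> \<longleftrightarrow> 0 < Re z \<and> \<bar>Im z\<bar> < tan \<alpha> * Re z"
proof (cases "0 < Re z")
  case True
  then have "z \<noteq> 0" by auto
  then have "Arg z = arctan (Im z / Re z)"
    using True Arg_eq_Im_Ln [of z] Im_Ln_eq [of z] by simp
  moreover have "\<bar>arctan t\<bar> < \<alpha> \<longleftrightarrow> \<bar>t\<bar> < tan \<alpha>" for t
    using arctan_less_iff [of t "tan \<alpha>"] arctan_less_iff [of "- tan \<alpha>" t] assms
    by (auto simp: abs_less_iff arctan_tan arctan_minus)
  ultimately show ?thesis
    using True \<open>z \<noteq> 0\<close> by (simp add: sector_def pos_divide_less_eq)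
next
  case False
  then show ?thesis
    using Re_Ln_pos_lt [of z] Arg_eq_Im_Ln [of z] assms by (auto simp: sector_def)
qed

lemma open_sector:
  assumes "0 < \<alpha>" "\<alpha> < pi / 2" shows "open (sector \<alpha>)"
proof -
  have "sector \<alpha> = {z. 0 < Re z} \<inter> {z. \<bar>Im z\<bar> < tan \<alpha> * Re z}"
    using assms by (auto simp: sector_iff)
  then show ?thesis
    by (simp add: open_Int open_Collect_less continuous_intros)
qed

lemma convex_sector:
  assumes "0 < \<alpha>" "\<alpha> < pi / 2" shows "convex (sector \<alpha>)"
proof -
  have eq: "sector \<alpha> = {z. Re z > 0} \<inter> {z. inner (Complex (tan \<alpha>) 1) z > 0} \<inter> {z. inner (Complex (tan \<alpha>) (-1)) z > 0}"
    using assms by (auto simp: sector_iff inner_complex_def abs_less_iff)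
  show ?thesis
    unfolding eq by (intro convex_Int convex_halfspace_Re_gt convex_halfspace_gt)
qed

lemma exp_in_sector: "\<lbrakk>0 < x; \<bar>Im w\<bar> < \<alpha>; \<alpha> < pi\<rbrakk> \<Longrightarrow> exp w * of_real x \<in> sector \<alpha>"
  using sector_rcis [of "exp (Re w) * x" "Im w" \<alpha>] by (simp add: exp_eq_polar mult_ac exp_of_real)

section \<open>Maximum principles in a horizontal strip\<close>

lemma strip_maximum_far:
  assumes holo: "g holomorphic_on S" and S: "{w. a \<le> Im w \<and> Im w \<le> b} \<subseteq> S"
    and lines: "\<And>w. Im w = a \<or> Im w = b \<Longrightarrow> cmod (g w) \<le> M"
    and far: "\<And>w. \<lbrakk>a \<le> Im w; Im w \<le> b; X \<le> \<bar>Re w\<bar>\<rbrakk> \<Longrightarrow> cmod (g w) \<le> M"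
    and w: "a \<le> Im w" "Im w \<le> b"
  shows "cmod (g w) \<le> M"
proof -
  \<comment> \<open>Wide enough for the rectangle to contain \<open>w\<close> and for its vertical
    sides to lie in the far region.\<close>
  define Y where "Y = max X \<bar>Re w\<bar> + 1"
  define B where "B = cbox (Complex (-Y) a) (Complex Y b)"
  have BS: "B \<subseteq> S" using S by (auto simp: B_def in_cbox_complex_iff)
  show ?thesis
  proof (rule maximum_modulus_frontier [where f = g and S = B and \<xi> = w])
    show "g holomorphic_on interior B"
      using holomorphic_on_subset [OF holo BS] interior_subset holomorphic_on_subset by blast
    show "continuous_on (closure B) g"
      using holomorphic_on_imp_continuous_on [OF holomorphic_on_subset [OF holo BS]] by (simp add: B_def)
    show "bounded B" by (simp add: B_def)
    show "w \<in> B" using w by (auto simp: B_def in_cbox_complex_iff Y_def)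
    fix z assume "z \<in> frontier B"
    then have z: "z \<in> B" "z \<notin> box (Complex (-Y) a) (Complex Y b)"
      by (auto simp: B_def frontier_cbox)
    then consider "Im z = a \<or> Im z = b" | "X \<le> \<bar>Re z\<bar>"
      by (fastforce simp: B_def in_cbox_complex_iff in_box_complex_iff Y_def)
    then show "cmod (g z) \<le> M"
      using z lines far by cases (auto simp: B_def in_cbox_complex_iff)
  qed
qed

text \<open>The factor exp (- e w^2) decays as |Re w| grows and is at most exp (e c^2) in the strip.
  It brings a bounded function under the previous lemma, after which e tends to 0.\<close>

lemma strip_maximum:
  assumes holo: "g holomorphic_on S" and S: "{w. a \<le> Im w \<and> Im w \<le> b} \<subseteq> S"
    and lines: "\<And>w. Im w = a \<or> Im w = b \<Longrightarrow> cmod (g w) \<le> M"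
    and bdd: "\<And>w. \<lbrakk>a \<le> Im w; Im w \<le> b\<rbrakk> \<Longrightarrow> cmod (g w) \<le> B"
    and w: "a \<le> Im w" "Im w \<le> b"
  shows "cmod (g w) \<le> M"
proof -
  define c where "c = max \<bar>a\<bar> \<bar>b\<bar>"
  have M0: "0 \<le> M" using order_trans [OF norm_ge_zero lines [of "Complex 0 a"]] by simp
  have B0: "0 \<le> B" using bdd [OF w] norm_ge_zero order_trans by blast
  have im: "(Im v)\<^sup>2 \<le> c\<^sup>2" if "a \<le> Im v" "Im v \<le> b" for v
    using that by (intro abs_le_square_iff [THEN iffD1]) (auto simp: c_def)
  have nexp: "cmod (exp (- of_real e * v\<^sup>2)) = exp (- e * (Re v)\<^sup>2) * exp (e * (Im v)\<^sup>2)" for e :: real and v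
    unfolding norm_exp_eq_Re exp_add [symmetric] by (simp add: Re_power2 algebra_simps)
  have "cmod (g w) \<le> (M + e) * exp (e * c\<^sup>2) * exp (e * (Re w)\<^sup>2)" if e: "0 < e" for e
  proof -
    define h where "h = (\<lambda>v. g v * exp (- of_real e * v\<^sup>2))"
    have hle: "cmod (h v) \<le> cmod (g v) * (exp (- e * (Re v)\<^sup>2) * exp (e * c\<^sup>2))" if "a \<le> Im v" "Im v \<le> b" for v
      using im [OF that] e unfolding h_def norm_mult nexp by (intro mult_left_mono) auto
    have "cmod (h w) \<le> (M + e) * exp (e * c\<^sup>2)"
    proof (rule strip_maximum_far [where S = S and X = "B / e\<^sup>2 + 1", OF _ S _ _ w])
      show "h holomorphic_on S" unfolding h_def by (intro holomorphic_intros holo)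
      fix v assume v: "Im v = a \<or> Im v = b"
      then have "cmod (h v) \<le> cmod (g v) * (exp (- e * (Re v)\<^sup>2) * exp (e * c\<^sup>2))"
        using w by (intro hle) auto
      also have "\<dots> \<le> (M + e) * (1 * exp (e * c\<^sup>2))"
        using lines [OF v] e M0 by (intro mult_mono) auto
      finally show "cmod (h v) \<le> (M + e) * exp (e * c\<^sup>2)" by simp
    next
      \<comment> \<open>Beyond B / e^2 + 1 one has e (Re v)^2 \<ge> B / e and hence B exp (- e (Re
        v)^2) \<le> e; the summand 1 ensures |Re v| \<ge> 1, so that |Re v| \<le> (Re v)^2.\<close>
      fix v assume v: "a \<le> Im v" "Im v \<le> b" "B / e\<^sup>2 + 1 \<le> \<bar>Re v\<bar>"
      have "B / e\<^sup>2 + 1 \<le> (Re v)\<^sup>2"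
      proof -
        have "1 \<le> \<bar>Re v\<bar>" using v(3) B0 by (smt (verit) divide_nonneg_nonneg zero_le_power2)
        then have "\<bar>Re v\<bar> * 1 \<le> \<bar>Re v\<bar> * \<bar>Re v\<bar>" by (intro mult_left_mono) auto
        then show ?thesis using v(3) by (simp add: power2_eq_square)
      qed
      then have "e * (B / e\<^sup>2) \<le> e * (Re v)\<^sup>2" using e by (intro mult_left_mono) auto
      then have "B / e \<le> exp (e * (Re v)\<^sup>2)"
      proof -
        have "e * (B / e\<^sup>2) = B / e" by (simp add: power2_eq_square)
        then show ?thesis
          using \<open>e * (B / e\<^sup>2) \<le> _\<close> exp_ge_add_one_self [of "e * (Re v)\<^sup>2"] by linarith
      qed
      then have "B * exp (- e * (Re v)\<^sup>2) \<le> e" using e by (simp add: exp_minus field_simps)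
      then have "B * (exp (- e * (Re v)\<^sup>2) * exp (e * c\<^sup>2)) \<le> (M + e) * exp (e * c\<^sup>2)"
        using M0 by (subst mult.assoc [symmetric]) (intro mult_right_mono, auto)
      moreover have "cmod (h v) \<le> B * (exp (- e * (Re v)\<^sup>2) * exp (e * c\<^sup>2))"
        using hle [OF v(1,2)] bdd [OF v(1,2)] by (meson mult_right_mono exp_ge_zero mult_nonneg_nonneg order_trans)
      ultimately show "cmod (h v) \<le> (M + e) * exp (e * c\<^sup>2)" by linarith
    qed
    moreover have "cmod (g w) = cmod (h w) * (exp (e * (Re w)\<^sup>2) * exp (- e * (Im w)\<^sup>2))"
      unfolding h_def norm_mult nexp by (simp add: exp_minus field_simps)
    moreover have "\<dots> \<le> cmod (h w) * (exp (e * (Re w)\<^sup>2) * 1)"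
      using e by (intro mult_left_mono) auto
    ultimately show ?thesis
      by (smt (verit, best) mult_right_mono exp_ge_zero mult_1_right)
  qed
  then have "cmod (g w) \<le> (M + 0) * exp (0 * c\<^sup>2) * exp (0 * (Re w)\<^sup>2)"
    by (rule le_limit_at_0) (auto intro!: continuous_intros)
  then show ?thesis by simp
qed

section \<open>Holomorphic approximation of integrals along rays\<close>

definition pairing :: "complex^2 \<Rightarrow> complex^2 \<Rightarrow> complex" where
  "pairing p u = cnj (p $ 1) * u $ 1 + cnj (p $ 2) * u $ 2"

lemma pairing_bound: "cmod (pairing p u) \<le> norm p * norm u"
  using Cauchy_Schwarz_complex2 [of "cnj (p $ 1)" "u $ 1" "cnj (p $ 2)" "u $ 2"]
  by (simp add: pairing_def norm_cvec2_sqrt)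

lemma pairing_self: "pairing u u = of_real ((norm u)\<^sup>2)"
  unfolding pairing_def norm_cvec2 of_real_add complex_norm_square by (simp add: mult.commute)

text \<open>Here \<open>q\<close> nearly attains the operator norm and \<open>p\<close> is its
  normalised image. For a fixed pair the value \<open>pairing p (A *v q)\<close> is linear in
  \<open>A\<close>, so it is holomorphic where \<open>A\<close> is, unlike the norm.\<close>

lemma mnorm_approx:
  assumes "0 < \<eta>"
  obtains p q where "norm p \<le> 1" "norm q \<le> 1" "Im (pairing p (A *v q)) = 0" "mnorm A - \<eta> \<le> Re (pairing p (A *v q))"
proof (cases "mnorm A \<le> \<eta>")
  case True
  show ?thesis by (rule that [of 0 0]) (use True in \<open>auto simp: pairing_def\<close>)
next
  case False
  have "\<exists>q. norm (A *v q) > (mnorm A - \<eta>) * norm q"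
  proof (rule ccontr)
    assume "\<not> ?thesis"
    then have "mnorm A \<le> mnorm A - \<eta>"
      using False by (intro onorm_bound) (auto simp: not_less)
    then show False using assms by simp
  qed
  then obtain q0 where q0: "norm (A *v q0) > (mnorm A - \<eta>) * norm q0" by blast
  then have "q0 \<noteq> 0" by auto
  define q where "q = (1 / norm q0) *\<^sub>R q0"
  define u where "u = A *v q"
  have "u = (1 / norm q0) *\<^sub>R (A *v q0)"
    unfolding u_def q_def by (rule linear_scale [OF bounded_linear.linear [OF bounded_linear_matrix_vector]])
  then have nu: "norm u > mnorm A - \<eta>"
    using q0 \<open>q0 \<noteq> 0\<close> by (simp add: field_simps)
  then have u0: "norm u > 0" using False by linarith
  have pu: "pairing ((1 / norm u) *\<^sub>R u) u = of_real (norm u)"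
  proof -
    have "pairing ((1 / norm u) *\<^sub>R u) u = (1 / norm u) *\<^sub>R pairing u u"
      by (simp add: pairing_def scaleR_add_right)
    then show ?thesis using u0 by (simp add: pairing_self power2_eq_square scaleR_conv_of_real)
  qed
  have "norm q \<le> 1" by (simp add: q_def)
  then show ?thesis
    by (intro that [of "(1 / norm u) *\<^sub>R u" q]) (use pu nu u0 in \<open>auto simp: u_def [symmetric]\<close>)
qed

text \<open>Up to \<open>\<epsilon>\<close>, the \<open>L\<^sup>1\<close> norm along one ray is the value of a single holomorphic function that is bounded by
  the corresponding norm along every ray, so that the three-lines theorem for scalar functions applies.\<close>

lemma norm_integral_approx:
  fixes V :: "complex \<Rightarrow> complex^2^2"
  assumes \<alpha>: "0 < \<alpha>" "\<alpha> < pi / 2" and hol: "\<And>i j. (\<lambda>z. V z $ i $ j) holomorphic_on sector \<alpha>"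
    and \<psi>: "\<bar>\<psi>\<bar> < \<alpha>" and dR: "0 < \<delta>" "\<delta> \<le> R" and \<epsilon>: "0 < \<epsilon>"
  obtains S where "S holomorphic_on {w. \<bar>Im w\<bar> < \<alpha>}"
    "\<And>w. \<bar>Im w\<bar> < \<alpha> \<Longrightarrow> cmod (S w) \<le> integral {\<delta>..R} (\<lambda>x. exp (Re w) * mnorm (V (exp w * of_real x)))"
    "integral {\<delta>..R} (\<lambda>x. mnorm (V (cis \<psi> * of_real x))) - \<epsilon> * (R - \<delta>) \<le> Re (S (\<i> * of_real \<psi>))"
proof -
  let ?g = "\<lambda>w x. exp (Re w) * mnorm (V (exp w * of_real x))"
  let ?h = "\<lambda>x. mnorm (V (cis \<psi> * of_real x))"
  let ?ok = "\<lambda>a b S. S holomorphic_on {w. \<bar>Im w\<bar> < \<alpha>} \<and>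
     (\<forall>w. \<bar>Im w\<bar> < \<alpha> \<longrightarrow> cmod (S w) \<le> integral {a..b} (?g w)) \<and>
     integral {a..b} ?h - \<epsilon> * (b - a) \<le> Re (S (\<i> * of_real \<psi>))"
  have api: "\<alpha> < pi" using \<alpha> by simp
  have cV: "continuous_on (sector \<alpha>) V"
    by (intro continuous_on_matrix_entries holomorphic_on_imp_continuous_on hol)
  have cVe: "continuous_on {a..b} (\<lambda>x. V (exp w * of_real x))" if "\<bar>Im w\<bar> < \<alpha>" "0 < a" for a b and w
    by (intro continuous_on_compose2 [OF cV] continuous_intros) (use that api in \<open>auto intro!: exp_in_sector\<close>)
  have gi: "?g w integrable_on {a..b}" if "\<bar>Im w\<bar> < \<alpha>" "0 < a" for a b and w
    by (intro integrable_continuous_real continuous_intros cVe that)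
  have cis_exp: "cis \<psi> = exp (\<i> * of_real \<psi>)" by (simp add: cis_conv_exp)
  have cVc: "continuous_on {a..b} (\<lambda>x. V (cis \<psi> * of_real x))" if "0 < a" for a b
    unfolding cis_exp by (rule cVe) (use \<psi> that in auto)
  have hi: "?h integrable_on {a..b}" if "0 < a" for a b
    by (intro integrable_continuous_real continuous_intros cVc that)
  \<comment> \<open>The property is additive over adjacent intervals, as the error is proportional
    to the length, so bisection reduces it to short intervals around each point.\<close>
  have "0 < \<delta> \<longrightarrow> (\<exists>S. ?ok \<delta> R S)"
  proof (rule Bolzano [OF dR(2)])
    fix a b c :: real
    assume ab: "0 < a \<longrightarrow> (\<exists>S. ?ok a b S)" and bc: "0 < b \<longrightarrow> (\<exists>S. ?ok b c S)" and le: "a \<le> b" "b \<le> c"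
    show "0 < a \<longrightarrow> (\<exists>S. ?ok a c S)"
    proof
      assume a: "0 < a"
      obtain S1 where S1: "?ok a b S1" using ab a by blast
      obtain S2 where S2: "?ok b c S2" using bc a le by auto
      have "?ok a c (\<lambda>w. S1 w + S2 w)"
      proof (intro conjI allI impI)
        show "(\<lambda>w. S1 w + S2 w) holomorphic_on {w. \<bar>Im w\<bar> < \<alpha>}"
          using S1 S2 by (intro holomorphic_intros) auto
        show "cmod (S1 w + S2 w) \<le> integral {a..c} (?g w)" if "\<bar>Im w\<bar> < \<alpha>" for w
        proof -
          have "cmod (S1 w + S2 w) \<le> integral {a..b} (?g w) + integral {b..c} (?g w)"
            using S1 S2 that by (meson norm_triangle_mono)
          also have "\<dots> = integral {a..c} (?g w)"
            by (rule Henstock_Kurzweil_Integration.integral_combine [OF le gi]) (use that a in auto)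
          finally show ?thesis .
        qed
        have "integral {a..b} ?h + integral {b..c} ?h = integral {a..c} ?h"
          by (rule Henstock_Kurzweil_Integration.integral_combine [OF le hi]) (use a in auto)
        then show "integral {a..c} ?h - \<epsilon> * (c - a) \<le> Re (S1 (\<i> * of_real \<psi>) + S2 (\<i> * of_real \<psi>))"
          using S1 S2 by (simp add: algebra_simps)
      qed
      then show "\<exists>S. ?ok a c S" by (rule exI [of _ "\<lambda>w. S1 w + S2 w"])
    qed
  next
    fix x0 assume "\<delta> \<le> x0" "x0 \<le> R"
    then have x0: "0 < x0" using dR by simp
    \<comment> \<open>Three errors of size \<eta>: the choice of \<open>p\<close> and
      \<open>q\<close>, the variation of \<open>V\<close>, and the variation of \<open>k\<close> on
      a short interval.\<close>
    define \<eta> where "\<eta> = \<epsilon> / 3"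
    have \<eta>: "0 < \<eta>" using \<epsilon> by (simp add: \<eta>_def)
    \<comment> \<open>The integral of \<open>k\<close> along the ray carries the phase
      \<open>cis \<psi>\<close>. Putting it into the matrix, which keeps the operator norm, adapts
      \<open>p\<close> and \<open>q\<close> to the real part of that integral.\<close>
    define A0 where "A0 = (\<chi> i j. cis \<psi> * V (cis \<psi> * of_real x0) $ i $ j)"
    have A0v: "A0 *v u = cis \<psi> *s (V (cis \<psi> * of_real x0) *v u)" for u
      by (simp add: A0_def vec_eq_iff matrix_vector_nth2 algebra_simps)
    have "mnorm (V (cis \<psi> * of_real x0)) \<le> mnorm A0"
    proof (rule onorm_bound)
      fix u
      have "norm (V (cis \<psi> * of_real x0) *v u) = norm (A0 *v u)"
        unfolding A0v norm_cvec2_sqrt by (simp add: norm_mult)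
      then show "norm (V (cis \<psi> * of_real x0) *v u) \<le> mnorm A0 * norm u"
        using mnorm_bound by metis
    qed simp
    moreover obtain p q where pq: "norm p \<le> 1" "norm q \<le> 1" "Im (pairing p (A0 *v q)) = 0"
      "mnorm A0 - \<eta> \<le> Re (pairing p (A0 *v q))"
      using mnorm_approx [OF \<eta>] by blast
    ultimately have pq4: "?h x0 - \<eta> \<le> Re (pairing p (A0 *v q))" by linarith
    define k where "k = (\<lambda>\<zeta>. pairing p (V \<zeta> *v q))"
    define c where "c = pairing p (A0 *v q)"
    have c: "c = cis \<psi> * k (cis \<psi> * of_real x0)"
      unfolding c_def k_def A0v by (simp add: pairing_def algebra_simps)
    have kh: "k holomorphic_on sector \<alpha>"
      unfolding k_def pairing_def matrix_vector_nth2 by (intro holomorphic_intros hol)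
    have kle: "cmod (k \<zeta>) \<le> mnorm (V \<zeta>)" for \<zeta>
    proof -
      have "cmod (k \<zeta>) \<le> norm p * norm (V \<zeta> *v q)" unfolding k_def by (rule pairing_bound)
      also have "\<dots> \<le> 1 * (mnorm (V \<zeta>) * 1)"
        by (intro mult_mono order_trans [OF mnorm_bound] mult_left_mono pq) auto
      finally show ?thesis by simp
    qed
    \<comment> \<open>Increments of this primitive stand for the integral of exp w k (exp w x) over
      [a, b], so holomorphy in \<open>w\<close> needs no differentiation under the integral
      sign.\<close>
    obtain K where K0: "\<And>\<zeta>. \<zeta> \<in> sector \<alpha> \<Longrightarrow> (K has_field_derivative k \<zeta>) (at \<zeta> within sector \<alpha>)"
      using holomorphic_convex_primitive' [OF convex_sector [OF \<alpha>] open_sector [OF \<alpha>] kh] by blast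
    have K: "(K has_field_derivative k \<zeta>) (at \<zeta>)" if "\<zeta> \<in> sector \<alpha>" for \<zeta>
      using K0 [OF that] by (simp add: at_within_open [OF that open_sector [OF \<alpha>]])
    have Kh: "K holomorphic_on sector \<alpha>"
      using K by (auto simp: holomorphic_on_def field_differentiable_def intro: has_field_derivative_at_within)
    have Kx: "((\<lambda>x. K (exp w * of_real x)) has_vector_derivative exp w * k (exp w * of_real x)) (at x)"
      if "\<bar>Im w\<bar> < \<alpha>" "0 < x" for w x
    proof -
      have "((\<lambda>\<zeta>. K (exp w * \<zeta>)) has_field_derivative k (exp w * of_real x) * exp w) (at (of_real x))"
        by (rule DERIV_chain2 [OF K]) (use that api in \<open>auto intro!: exp_in_sector derivative_eq_intros\<close>)
      from has_vector_derivative_real_field [OF this] show ?thesis by (simp add: mult.commute)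
    qed
    have Kc: "continuous_on {a..b} (\<lambda>x. K (exp w * of_real x))" if "\<bar>Im w\<bar> < \<alpha>" "0 < a" for a b w
      by (intro continuous_at_imp_continuous_on ballI has_vector_derivative_continuous [OF Kx [OF that(1)]])
        (use that in auto)
    have "isCont (\<lambda>x. V (cis \<psi> * of_real x)) x0"
      by (rule continuous_on_interior [OF cVc [of "x0/2" "2*x0"]]) (use x0 in auto)
    moreover have "isCont (\<lambda>x. k (cis \<psi> * of_real x)) x0"
    proof -
      have "continuous_on {x0/2..2*x0} (\<lambda>x. k (cis \<psi> * of_real x))"
        unfolding cis_exp
        by (intro continuous_on_compose2 [OF holomorphic_on_imp_continuous_on [OF kh]] continuous_intros)
          (use x0 \<psi> api in \<open>auto intro!: exp_in_sector\<close>)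
      then show ?thesis by (rule continuous_on_interior) (use x0 in auto)
    qed
    ultimately have "\<forall>\<^sub>F x in nhds x0. dist (V (cis \<psi> * of_real x)) (V (cis \<psi> * of_real x0)) < \<eta> \<and>
        dist (k (cis \<psi> * of_real x)) (k (cis \<psi> * of_real x0)) < \<eta>"
      using \<eta> by (auto simp: isCont_def tendsto_iff eventually_at_filter eventually_conj_iff elim!: eventually_mono)
    then obtain d0 where d0: "0 < d0" "\<And>x. dist x x0 < d0 \<Longrightarrow> dist (V (cis \<psi> * of_real x)) (V (cis \<psi> * of_real x0)) < \<eta> \<and>
        dist (k (cis \<psi> * of_real x)) (k (cis \<psi> * of_real x0)) < \<eta>"
      by (auto simp: eventually_nhds_metric)
    show "\<exists>d>0. \<forall>a b. a \<le> x0 \<and> x0 \<le> b \<and> b - a < d \<longrightarrow> (0 < a \<longrightarrow> (\<exists>S. ?ok a b S))"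
    proof (intro exI [of _ d0] conjI allI impI d0(1))
      fix a b assume ab: "a \<le> x0 \<and> x0 \<le> b \<and> b - a < d0" and a: "0 < a"
      define S where "S = (\<lambda>w. K (exp w * of_real b) - K (exp w * of_real a))"
      have near: "dist x x0 < d0" if "a \<le> x" "x \<le> b" for x
        using ab that by (auto simp: dist_real_def)
      have "?ok a b S"
      proof (intro conjI allI impI)
        have "(\<lambda>w. K (exp w * of_real x)) holomorphic_on {w. \<bar>Im w\<bar> < \<alpha>}" if "0 < x" for x
        proof -
          have "K \<circ> (\<lambda>w. exp w * of_real x) holomorphic_on {w. \<bar>Im w\<bar> < \<alpha>}"
            by (rule holomorphic_on_compose_gen [OF _ Kh])
              (use that api in \<open>auto intro!: holomorphic_intros exp_in_sector\<close>)
          then show ?thesis by (simp add: o_def)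
        qed
        then show "S holomorphic_on {w. \<bar>Im w\<bar> < \<alpha>}"
          unfolding S_def using a ab by (intro holomorphic_on_diff) auto
        fix w assume w: "\<bar>Im w\<bar> < \<alpha>"
        show "cmod (S w) \<le> integral {a..b} (?g w)"
          unfolding S_def
        proof (rule norm_diff_le_integral [OF _ Kc [OF w a] Kx [OF w] _ gi [OF w a]])
          show "norm (exp w * k (exp w * of_real x)) \<le> ?g w x" for x
            using kle [of "exp w * of_real x"] by (simp add: norm_mult)
        qed (use ab a in auto)
      next
        let ?w = "\<i> * of_real \<psi>"
        have w: "\<bar>Im ?w\<bar> < \<alpha>" using \<psi> by simp
        let ?D = "\<lambda>x. K (exp ?w * of_real x) - c * of_real x"
        have D: "norm (?D b - ?D a) \<le> integral {a..b} (\<lambda>x. \<eta>)"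
        proof (rule norm_diff_le_integral)
          show "continuous_on {a..b} ?D" by (intro continuous_intros Kc w a)
          fix x assume x: "a < x" "x < b"
          have "((\<lambda>x. c * of_real x) has_vector_derivative c) (at x)"
          proof -
            have "((\<lambda>\<zeta>. c * \<zeta>) has_field_derivative c) (at (of_real x))"
              by (auto intro!: derivative_eq_intros)
            from has_vector_derivative_real_field [OF this] show ?thesis .
          qed
          then show "(?D has_vector_derivative exp ?w * k (exp ?w * of_real x) - c) (at x)"
            by (intro has_vector_derivative_diff Kx w) (use x a in auto)
          have "exp ?w * k (exp ?w * of_real x) - c = cis \<psi> * (k (cis \<psi> * of_real x) - k (cis \<psi> * of_real x0))"
            unfolding c cis_exp by (simp add: algebra_simps)
          then have "norm (exp ?w * k (exp ?w * of_real x) - c) = dist (k (cis \<psi> * of_real x)) (k (cis \<psi> * of_real x0))"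
            by (simp add: norm_mult dist_norm)
          also have "\<dots> \<le> \<eta>" using d0(2) [OF near, of x] x by simp
          finally show "norm (exp ?w * k (exp ?w * of_real x) - c) \<le> \<eta>" .
        qed (use ab in auto)
        have eq: "?D b - ?D a = S ?w - c * of_real (b - a)"
          by (simp add: S_def algebra_simps)
        have "norm (c * of_real (b - a) - S ?w) \<le> \<eta> * (b - a)"
          using D ab unfolding eq by (subst norm_minus_commute) (simp add: mult.commute)
        then have "Re c * (b - a) - Re (S ?w) \<le> \<eta> * (b - a)"
          using complex_Re_le_cmod [of "c * of_real (b - a) - S ?w"] by simp
        moreover have "(?h x0 - \<eta>) * (b - a) \<le> Re c * (b - a)"
          using pq4 ab by (intro mult_right_mono) (auto simp: c_def)
        moreover have "integral {a..b} ?h \<le> integral {a..b} (\<lambda>x. ?h x0 + \<eta>)"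
        proof (rule integral_le [OF hi [OF a]])
          fix x assume "x \<in> {a..b}"
          then have "norm (V (cis \<psi> * of_real x) - V (cis \<psi> * of_real x0)) < \<eta>"
            using d0(2) [OF near, of x] by (simp add: dist_norm)
          then show "?h x \<le> ?h x0 + \<eta>"
            using mnorm_Lipschitz [of "V (cis \<psi> * of_real x)" "V (cis \<psi> * of_real x0)"] by linarith
        qed auto
        then have "integral {a..b} ?h \<le> (?h x0 + \<eta>) * (b - a)"
          using ab by (simp add: mult.commute)
        moreover have "\<epsilon> * (b - a) = 3 * (\<eta> * (b - a))" by (simp add: \<eta>_def)
        ultimately show "integral {a..b} ?h - \<epsilon> * (b - a) \<le> Re (S ?w)"
          unfolding distrib_right [of "?h x0" \<eta>] left_diff_distrib [of "?h x0" \<eta>] by linarith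
      qed
      then show "\<exists>S. ?ok a b S" by (rule exI [of _ S])
    qed
  qed
  then show ?thesis using dR that by blast
qed

section \<open>L1 norms over a half-line: three lines, convexity, reflection\<close>

definition half_norm :: "(complex \<Rightarrow> complex^2^2) \<Rightarrow> real \<Rightarrow> real" where
  "half_norm V \<phi> = (LINT x:{0<..}|lborel. mnorm (V (cis \<phi> * of_real x)))"

lemma half_norm_nonneg: "0 \<le> half_norm V \<phi>"
  unfolding half_norm_def set_lebesgue_integral_def by (rule Bochner_Integration.integral_nonneg) simp

text \<open>The weight exp (Re w) is the Jacobian of the dilation by |exp w|, so the bound depends
  on Im w only. This makes the approximating functions bounded on horizontal lines.\<close>

lemma half_norm_scaled:
  assumes int: "set_integrable lborel {0<..} (\<lambda>x. mnorm (V (cis (Im w) * of_real x)))" and d: "0 < \<delta>"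
    and gi: "(\<lambda>x. exp (Re w) * mnorm (V (exp w * of_real x))) integrable_on {\<delta>..R}"
  shows "integral {\<delta>..R} (\<lambda>x. exp (Re w) * mnorm (V (exp w * of_real x))) \<le> half_norm V (Im w)"
proof -
  define s where "s = exp (Re w)"
  have s: "0 < s" by (simp add: s_def)
  define f where "f = (\<lambda>x. indicat_real {0<..} x * mnorm (V (cis (Im w) * of_real x)))"
  have f: "integrable lborel f"
    using int by (simp add: set_integrable_def f_def)
  have fs: "f (0 + s * x) = indicat_real {0<..} x * mnorm (V (exp w * of_real x))" for x
    using s by (simp add: f_def s_def exp_eq_polar indicator_def zero_less_mult_iff mult_ac exp_of_real)
  have fs_int: "integrable lborel (\<lambda>x. indicat_real {0<..} x * mnorm (V (exp w * of_real x)))"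
    using lborel_integrable_real_affine [OF f, of s 0] s unfolding fs by simp
  have half: "half_norm V (Im w) = s * (LINT x|lborel. indicat_real {0<..} x * mnorm (V (exp w * of_real x)))"
    using lborel_integral_real_affine [of s f 0] s unfolding fs
    by (simp add: half_norm_def set_lebesgue_integral_def f_def)
  have "set_integrable lborel {\<delta>..R} (\<lambda>x. indicat_real {0<..} x * mnorm (V (exp w * of_real x)))"
    unfolding set_integrable_def by (rule integrable_mult_indicator [OF _ fs_int]) simp
  also have "?this \<longleftrightarrow> set_integrable lborel {\<delta>..R} (\<lambda>x. mnorm (V (exp w * of_real x)))"
    by (rule set_integrable_cong) (use d in auto)
  finally have si: "set_integrable lborel {\<delta>..R} (\<lambda>x. mnorm (V (exp w * of_real x)))" .
  have "integral {\<delta>..R} (\<lambda>x. mnorm (V (exp w * of_real x))) = (LINT x:{\<delta>..R}|lborel. mnorm (V (exp w * of_real x)))"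
    by (rule set_borel_integral_eq_integral(2) [OF si, symmetric])
  also have "\<dots> \<le> (LINT x|lborel. indicat_real {0<..} x * mnorm (V (exp w * of_real x)))"
    unfolding set_lebesgue_integral_def
    by (rule integral_mono [OF _ fs_int]) (use si d in \<open>auto simp: set_integrable_def indicator_def\<close>)
  finally show ?thesis
    using s by (simp add: half s_def [symmetric])
qed

lemma half_norm_limit:
  assumes int: "set_integrable lborel {0<..} (\<lambda>x. mnorm (V (cis \<phi> * of_real x)))"
    and le: "\<And>\<delta> R. \<lbrakk>0 < \<delta>; \<delta> \<le> R\<rbrakk> \<Longrightarrow> integral {\<delta>..R} (\<lambda>x. mnorm (V (cis \<phi> * of_real x))) \<le> B"
  shows "half_norm V \<phi> \<le> B"
proof (rule LIMSEQ_le_const2)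
  let ?f = "\<lambda>x. mnorm (V (cis \<phi> * of_real x))"
  let ?I = "\<lambda>n::nat. {1 / real (Suc n)..real (Suc n)}"
  have sub: "?I n \<subseteq> {0<..}" for n by (auto intro: less_le_trans [rotated])
  show "(\<lambda>n. LINT x:?I n|lborel. ?f x) \<longlonglongrightarrow> half_norm V \<phi>"
    unfolding half_norm_def set_lebesgue_integral_def
  proof (rule integral_dominated_convergence [where w = "\<lambda>x. indicat_real {0<..} x *\<^sub>R ?f x"])
    show "integrable lborel (\<lambda>x. indicat_real {0<..} x *\<^sub>R ?f x)"
      using int by (simp add: set_integrable_def)
    then show "(\<lambda>x. indicat_real {0<..} x *\<^sub>R ?f x) \<in> borel_measurable lborel" by simp
    show "(\<lambda>x. indicat_real (?I n) x *\<^sub>R ?f x) \<in> borel_measurable lborel" for n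
    proof -
      have "set_integrable lborel (?I n) ?f" by (rule set_integrable_subset [OF int _ sub]) simp
      then show ?thesis by (simp add: set_integrable_def)
    qed
    show "AE x in lborel. (\<lambda>n. indicat_real (?I n) x *\<^sub>R ?f x) \<longlonglongrightarrow> indicat_real {0<..} x *\<^sub>R ?f x"
    proof (rule AE_I2, rule tendsto_eventually)
      fix x :: real
      show "\<forall>\<^sub>F n in sequentially. indicat_real (?I n) x *\<^sub>R ?f x = indicat_real {0<..} x *\<^sub>R ?f x"
      proof (cases "0 < x")
        case True
        show ?thesis
          using eventually_ge_at_top [of "nat \<lceil>max x (1 / x)\<rceil>"]
        proof eventually_elim
          case (elim n)
          then have "max x (1 / x) \<le> real n" by linarith
          then have "x \<le> real (Suc n)" "1 / x \<le> real (Suc n)" by auto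
          then have "x \<in> ?I n" using True by (simp add: field_simps)
          then show ?case using True by simp
        qed
      next
        case False
        then have "x \<notin> ?I n" for n using sub by fastforce
        then show ?thesis using False by simp
      qed
    qed
    show "AE x in lborel. norm (indicat_real (?I n) x *\<^sub>R ?f x) \<le> indicat_real {0<..} x *\<^sub>R ?f x" for n
    proof (rule AE_I2)
      fix x
      show "norm (indicat_real (?I n) x *\<^sub>R ?f x) \<le> indicat_real {0<..} x *\<^sub>R ?f x"
        using subsetD [OF sub, of x n] by (cases "x \<in> ?I n") auto
    qed
  qed
  show "\<exists>N. \<forall>n\<ge>N. (LINT x:?I n|lborel. ?f x) \<le> B"
  proof (intro exI allI impI)
    fix n :: nat
    have "set_integrable lborel (?I n) ?f" by (rule set_integrable_subset [OF int _ sub]) simp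
    then have "(LINT x:?I n|lborel. ?f x) = integral (?I n) ?f"
      by (rule set_borel_integral_eq_integral(2))
    also have "\<dots> \<le> B" by (rule le) (auto simp: field_simps)
    finally show "(LINT x:?I n|lborel. ?f x) \<le> B" .
  qed
qed

text \<open>For the adjoint B of A, |B u|^2 is the modulus of the pairing of A B u with u; one
  factor |B u| cancels.\<close>

lemma mnorm_conj_transpose_le:
  fixes A B :: "complex^2^2"
  assumes "\<And>i j. B $ i $ j = cnj (A $ j $ i)" shows "mnorm B \<le> mnorm A"
proof (rule onorm_bound)
  fix u :: "complex^2"
  have "pairing (B *v u) (B *v u) = pairing (A *v (B *v u)) u"
    by (simp add: pairing_def matrix_vector_nth2 assms algebra_simps)
  then have "cmod (of_real ((norm (B *v u))\<^sup>2)) = cmod (pairing (A *v (B *v u)) u)"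
    by (simp only: pairing_self)
  then have "(norm (B *v u))\<^sup>2 = cmod (pairing (A *v (B *v u)) u)"
    by (simp only: norm_of_real abs_power2)
  also have "\<dots> \<le> norm (A *v (B *v u)) * norm u" by (rule pairing_bound)
  also have "\<dots> \<le> (mnorm A * norm (B *v u)) * norm u"
    by (intro mult_right_mono mnorm_bound) auto
  finally have "norm (B *v u) * norm (B *v u) \<le> norm (B *v u) * (mnorm A * norm u)"
    by (simp add: power2_eq_square mult_ac)
  then show "norm (B *v u) \<le> mnorm A * norm u"
    by (cases "B *v u = 0") (auto simp: mult_le_cancel_left)
qed simp

text \<open>Hypotheses on one half-line, met by the potential and by its reflected copy. What
  continuation needs is kept apart from the Hermiticity and the uniform bounds, which serve the
  symmetry and the convexity of the norms.\<close>

locale ray_potential =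
  fixes \<alpha> :: real and V :: "complex \<Rightarrow> complex^2^2"
  assumes \<alpha>: "0 < \<alpha>" "\<alpha> < pi / 2"
    and hol: "\<And>i j. (\<lambda>z. V z $ i $ j) holomorphic_on sector \<alpha>"
    and int: "\<And>\<phi>. \<bar>\<phi>\<bar> < \<alpha> \<Longrightarrow> set_integrable lborel {0<..} (\<lambda>x. mnorm (V (cis \<phi> * of_real x)))"
    and bounded_V: "bounded (V ` sector \<alpha>)"
begin

lemma continuous_V: "continuous_on (sector \<alpha>) V"
  by (intro continuous_on_matrix_entries holomorphic_on_imp_continuous_on hol)

lemma continuous_ray: "\<lbrakk>\<bar>Im w\<bar> < \<alpha>; 0 < a\<rbrakk> \<Longrightarrow> continuous_on {a..b} (\<lambda>x. V (exp w * of_real x))"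
  by (intro continuous_on_compose2 [OF continuous_V] continuous_intros)
    (use \<alpha> in \<open>auto intro!: exp_in_sector\<close>)

end

locale half_potential = ray_potential \<alpha> V for \<alpha> :: real and V :: "complex \<Rightarrow> complex^2^2" +
  assumes herm: "\<And>x i j. 0 < x \<Longrightarrow> V (of_real x) $ i $ j = cnj (V (of_real x) $ j $ i)"
    and bdd: "\<And>\<beta>. \<lbrakk>0 < \<beta>; \<beta> < \<alpha>\<rbrakk> \<Longrightarrow> \<exists>C. \<forall>\<phi>. \<bar>\<phi>\<bar> \<le> \<beta> \<longrightarrow> half_norm V \<phi> \<le> C"
begin

text \<open>Comparison with M exp (c \<phi>) rather than with powers of the end values, so that no
  logarithm of a possibly vanishing norm is taken. The factor exp (i c w) has modulus exp (- c Im w)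
  and reduces the claim to the constant bound M on both lines.\<close>

lemma half_norm_three_lines:
  assumes ab: "-\<alpha> < a" "a \<le> \<psi>" "\<psi> \<le> b" "b < \<alpha>"
    and "half_norm V a \<le> M * exp (c * a)" "half_norm V b \<le> M * exp (c * b)"
  shows "half_norm V \<psi> \<le> M * exp (c * \<psi>)"
proof -
  define \<beta> where "\<beta> = (max \<bar>a\<bar> \<bar>b\<bar> + \<alpha>) / 2"
  have \<beta>: "0 < \<beta>" "\<beta> < \<alpha>" "\<bar>a\<bar> \<le> \<beta>" "\<bar>b\<bar> \<le> \<beta>" using ab \<alpha> by (auto simp: \<beta>_def)
  obtain C where C: "\<And>\<phi>. \<bar>\<phi>\<bar> \<le> \<beta> \<Longrightarrow> half_norm V \<phi> \<le> C" using bdd [OF \<beta>(1,2)] by blast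
  have \<psi>: "\<bar>\<psi>\<bar> < \<alpha>" using ab by auto
  show ?thesis
  proof (rule half_norm_limit [OF int [OF \<psi>]])
    fix \<delta> R :: real assume dR: "0 < \<delta>" "\<delta> \<le> R"
    let ?J = "integral {\<delta>..R} (\<lambda>x. mnorm (V (cis \<psi> * of_real x)))"
    have "?J \<le> M * exp (c * \<psi>) + e * (R - \<delta>)" if e: "0 < e" for e
    proof -
      obtain S where S: "S holomorphic_on {w. \<bar>Im w\<bar> < \<alpha>}"
        "\<And>w. \<bar>Im w\<bar> < \<alpha> \<Longrightarrow> cmod (S w) \<le> integral {\<delta>..R} (\<lambda>x. exp (Re w) * mnorm (V (exp w * of_real x)))"
        "?J - e * (R - \<delta>) \<le> Re (S (\<i> * of_real \<psi>))"
        using norm_integral_approx [OF \<alpha> hol \<psi> dR e] by blast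
      have Sb: "cmod (S w) \<le> half_norm V (Im w)" if "\<bar>Im w\<bar> < \<alpha>" for w
        by (rule order_trans [OF S(2) [OF that] half_norm_scaled [OF int [OF that] dR(1)]])
          (intro integrable_continuous_real continuous_intros continuous_ray that dR)
      define g where "g = (\<lambda>w. S w * exp (\<i> * of_real c * w))"
      have ng: "cmod (g w) = cmod (S w) * exp (- c * Im w)" for w
        by (simp add: g_def norm_mult)
      have "cmod (g (\<i> * of_real \<psi>)) \<le> M"
      proof (rule strip_maximum [where g = g and w = "\<i> * of_real \<psi>" and S = "{w. \<bar>Im w\<bar> < \<alpha>}" and a = a and b = b and B = "C * exp (\<bar>c\<bar> * \<beta>)"])
        show "g holomorphic_on {w. \<bar>Im w\<bar> < \<alpha>}"
          unfolding g_def by (intro holomorphic_intros S)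
        fix w
        show "cmod (g w) \<le> M" if w: "Im w = a \<or> Im w = b"
        proof -
          have "cmod (S w) \<le> M * exp (c * Im w)"
            using w assms ab by (auto intro!: order_trans [OF Sb])
          then show ?thesis by (simp add: ng exp_minus field_simps)
        qed
        assume w: "a \<le> Im w" "Im w \<le> b"
        then have w': "\<bar>Im w\<bar> < \<alpha>" "\<bar>Im w\<bar> \<le> \<beta>" using \<beta> ab by auto
        have "- c * Im w \<le> \<bar>c\<bar> * \<bar>Im w\<bar>" by (metis abs_ge_self abs_minus_cancel abs_mult)
        also have "\<dots> \<le> \<bar>c\<bar> * \<beta>" using w' by (intro mult_left_mono) auto
        finally have "exp (- c * Im w) \<le> exp (\<bar>c\<bar> * \<beta>)" by simp
        then show "cmod (g w) \<le> C * exp (\<bar>c\<bar> * \<beta>)"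
          unfolding ng using order_trans [OF Sb [OF w'(1)] C [OF w'(2)]]
          by (intro mult_mono) (auto intro: order_trans [OF norm_ge_zero])
      qed (use ab in auto)
      then have "cmod (S (\<i> * of_real \<psi>)) \<le> M * exp (c * \<psi>)"
        by (simp add: ng exp_minus field_simps)
      then show ?thesis
        using S(3) complex_Re_le_cmod [of "S (\<i> * of_real \<psi>)"] by linarith
    qed
    then have "?J \<le> M * exp (c * \<psi>) + 0 * (R - \<delta>)"
      by (rule le_limit_at_0) (auto intro!: continuous_intros)
    then show "?J \<le> M * exp (c * \<psi>)" by simp
  qed
qed

text \<open>The end values are raised by e to be positive and interpolated by M exp (c \<phi>);
  convexity of exp turns the geometric mean into the arithmetic one.\<close>

lemma half_norm_convex: "convex_on {-\<alpha><..<\<alpha>} (half_norm V)"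
proof (rule convex_on_linorderI)
  fix t x y :: real
  assume t: "0 < t" "t < 1" and xy: "x \<in> {-\<alpha><..<\<alpha>}" "y \<in> {-\<alpha><..<\<alpha>}" "x < y"
  define \<psi> where "\<psi> = (1 - t) *\<^sub>R x + t *\<^sub>R y"
  have \<psi>: "\<psi> - x = t * (y - x)" by (simp add: \<psi>_def algebra_simps)
  have "0 \<le> \<psi> - x" "\<psi> - x \<le> y - x"
    unfolding \<psi> using t xy mult_right_mono [of t 1 "y - x"] by auto
  then have \<psi>': "x \<le> \<psi>" "\<psi> \<le> y" by auto
  have "half_norm V \<psi> \<le> (1 - t) * half_norm V x + t * half_norm V y + e" if e: "0 < e" for e
  proof -
    define p q where "p = half_norm V x + e" and "q = half_norm V y + e"
    have pq: "0 < p" "0 < q" using e half_norm_nonneg [of V] by (auto simp: p_def q_def add_nonneg_pos)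
    define c where "c = (ln q - ln p) / (y - x)"
    define M where "M = p * exp (- c * x)"
    have M: "M * exp (c * u) = exp (ln p + c * (u - x))" for u
      using pq by (simp add: M_def exp_add exp_diff exp_minus right_diff_distrib divide_inverse mult_ac)
    have "c * (y - x) = ln q - ln p" using xy by (simp add: c_def)
    then have cy: "M * exp (c * y) = q" "M * exp (c * x) = p" unfolding M using pq by simp_all
    have "half_norm V \<psi> \<le> M * exp (c * \<psi>)"
      using xy \<psi>' e by (intro half_norm_three_lines [of x \<psi> y]) (auto simp: cy p_def q_def)
    also have "\<dots> = exp ((1 - t) *\<^sub>R ln p + t *\<^sub>R ln q)"
      unfolding M \<psi> using xy by (simp add: c_def field_simps)
    also have "\<dots> \<le> (1 - t) * exp (ln p) + t * exp (ln q)"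
      using t by (intro convex_onD [OF exp_convex]) auto
    also have "\<dots> = (1 - t) * half_norm V x + t * half_norm V y + e"
      using pq by (simp add: p_def q_def algebra_simps)
    finally show ?thesis .
  qed
  then show "half_norm V ((1 - t) *\<^sub>R x + t *\<^sub>R y) \<le> (1 - t) * half_norm V x + t * half_norm V y"
    unfolding \<psi>_def by (rule field_le_epsilon)
qed simp

text \<open>If the norm vanishes at \<open>a\<close>, every slope c is admissible, and the
  three-lines bound at \<psi> is the norm at \<open>b\<close> times exp (- c (b - \<psi>)), which
  can be made arbitrarily small.\<close>

lemma half_norm_zero:
  assumes "-\<alpha> < a" "a < \<psi>" "\<psi> < \<alpha>" "half_norm V a = 0"
  shows "half_norm V \<psi> = 0"
proof (rule ccontr)
  assume "half_norm V \<psi> \<noteq> 0"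
  then have h: "0 < half_norm V \<psi>" using half_norm_nonneg [of V \<psi>] by linarith
  define b where "b = (\<psi> + \<alpha>) / 2"
  define s where "s = b - \<psi>"
  have b: "\<psi> < b" "b < \<alpha>" "0 < s" using assms by (auto simp: b_def s_def field_simps)
  \<comment> \<open>Chosen so that c s, and with it exp (c s), exceeds the quotient of the norms at
    \<open>b\<close> and \<psi>.\<close>
  define c where "c = (half_norm V b + 1) / (half_norm V \<psi> * s)"
  have "half_norm V \<psi> \<le> (half_norm V b * exp (- c * b)) * exp (c * \<psi>)"
    using assms b half_norm_nonneg [of V b]
    by (intro half_norm_three_lines [of a \<psi> b]) (auto simp: exp_minus field_simps)
  also have "\<dots> = half_norm V b * exp (- (c * s))"
    by (simp add: s_def algebra_simps flip: exp_add)
  finally have "half_norm V \<psi> * exp (c * s) \<le> half_norm V b"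
    by (simp add: exp_minus field_simps)
  moreover have "half_norm V \<psi> * (c * s) \<le> half_norm V \<psi> * exp (c * s)"
    using h exp_ge_add_one_self [of "c * s"] by (intro mult_left_mono) linarith+
  moreover have "half_norm V \<psi> * (c * s) = half_norm V b + 1"
    using h b by (simp add: c_def)
  ultimately show False by linarith
qed

text \<open>Hermiticity on the positive axis extends by the identity theorem: the value of
  \<open>V\<close> at \<open>cnj \<zeta>\<close> is the adjoint of its value at \<zeta>, and adjoint
  matrices have equal norms.\<close>

lemma half_norm_even:
  assumes \<phi>: "\<bar>\<phi>\<bar> < \<alpha>" shows "half_norm V (- \<phi>) = half_norm V \<phi>"
proof -
  have cnj_sector: "cnj ` sector \<alpha> = sector \<alpha>"
    using \<alpha> by (auto simp: sector_iff image_iff intro!: bexI [of _ "cnj _"])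
  have refl: "V \<zeta> $ i $ j = cnj (V (cnj \<zeta>) $ j $ i)" if \<zeta>: "\<zeta> \<in> sector \<alpha>" for \<zeta> i j
  proof -
    let ?U = "of_real ` {0<..} :: complex set"
    define f where "f = (\<lambda>\<zeta>. V \<zeta> $ i $ j - (cnj \<circ> (\<lambda>\<zeta>. V \<zeta> $ j $ i) \<circ> cnj) \<zeta>)"
    have "f \<zeta> = 0"
    proof (rule analytic_continuation [where f = f and w = \<zeta> and S = "sector \<alpha>" and U = ?U and \<xi> = 1])
      show "f holomorphic_on sector \<alpha>"
        unfolding f_def
        by (intro holomorphic_on_diff hol holomorphic_on_compose_cnj_cnj) (simp_all add: cnj_sector hol open_sector [OF \<alpha>])
      show "connected (sector \<alpha>)" by (rule convex_connected [OF convex_sector [OF \<alpha>]])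
      show "?U \<subseteq> sector \<alpha>" "1 \<in> sector \<alpha>" using \<alpha> by (auto simp: sector_iff tan_gt_zero)
      show "1 islimpt ?U"
        unfolding islimpt_approachable
      proof (intro allI impI)
        fix e :: real assume "0 < e"
        then have "complex_of_real (1 + e / 2) \<in> ?U" by (intro imageI) auto
        moreover have "complex_of_real (1 + e / 2) \<noteq> 1 \<and> dist (complex_of_real (1 + e / 2)) 1 < e"
          using \<open>0 < e\<close> by (simp add: dist_norm norm_divide)
        ultimately show "\<exists>x'\<in>?U. x' \<noteq> 1 \<and> dist x' 1 < e" by blast
      qed
      show "f z = 0" if zU: "z \<in> ?U" for z
      proof -
        obtain x where "z = of_real x" "0 < x" using zU by auto
        then show ?thesis using herm [of x i j] by (simp add: f_def)
      qed
    qed (use \<zeta> \<alpha> open_sector in auto)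
    then show ?thesis by (simp add: f_def)
  qed
  have "mnorm (V (cis (- \<phi>) * of_real x)) = mnorm (V (cis \<phi> * of_real x))" if "0 < x" for x
  proof -
    have s: "cis \<phi> * of_real x \<in> sector \<alpha>" "cis (- \<phi>) * of_real x \<in> sector \<alpha>"
      using that \<phi> \<alpha> by (auto intro!: sector_rcis)
    have c: "cnj (cis \<phi> * of_real x) = cis (- \<phi>) * of_real x" "cnj (cis (- \<phi>) * of_real x) = cis \<phi> * of_real x"
      by (simp_all add: cis_cnj)
    show ?thesis
      by (rule antisym; rule mnorm_conj_transpose_le)
        (rule refl [OF s(2), unfolded c] refl [OF s(1), unfolded c])+
  qed
  then show ?thesis
    unfolding half_norm_def by (intro set_lebesgue_integral_cong) auto
qed

end

section \<open>Analytic continuation of solutions in a sector\<close>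

text \<open>One Picard iteration. Convexity gives a primitive, and integrating the bound along the
  segment from \<zeta>0 turns r^n / n! into r^(n+1) / (n+1)!; the 2 in 2 C counts the two
  coefficients of a row.\<close>

lemma linear_ode_step:
  fixes a b f1 f2 :: "complex \<Rightarrow> complex"
  assumes S: "convex S" "open S" "\<zeta>0 \<in> S"
    and hol: "a holomorphic_on S" "b holomorphic_on S" "f1 holomorphic_on S" "f2 holomorphic_on S"
    and C: "\<And>\<zeta>. \<zeta> \<in> S \<Longrightarrow> cmod (a \<zeta>) \<le> C" "\<And>\<zeta>. \<zeta> \<in> S \<Longrightarrow> cmod (b \<zeta>) \<le> C"
    and f: "\<And>\<zeta>. \<zeta> \<in> S \<Longrightarrow> cmod (f1 \<zeta>) \<le> K * (2 * C * cmod (\<zeta> - \<zeta>0)) ^ n / fact n"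
      "\<And>\<zeta>. \<zeta> \<in> S \<Longrightarrow> cmod (f2 \<zeta>) \<le> K * (2 * C * cmod (\<zeta> - \<zeta>0)) ^ n / fact n"
  obtains G where "G holomorphic_on S" "G \<zeta>0 = 0"
    "\<And>\<zeta>. \<zeta> \<in> S \<Longrightarrow> (G has_field_derivative a \<zeta> * f1 \<zeta> + b \<zeta> * f2 \<zeta>) (at \<zeta>)"
    "\<And>\<zeta>. \<zeta> \<in> S \<Longrightarrow> cmod (G \<zeta>) \<le> K * (2 * C * cmod (\<zeta> - \<zeta>0)) ^ Suc n / fact (Suc n)"
proof -
  define g where "g = (\<lambda>\<zeta>. a \<zeta> * f1 \<zeta> + b \<zeta> * f2 \<zeta>)"
  have "g holomorphic_on S" unfolding g_def by (intro holomorphic_intros hol)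
  then obtain G0 where G0: "\<And>\<zeta>. \<zeta> \<in> S \<Longrightarrow> (G0 has_field_derivative g \<zeta>) (at \<zeta> within S)"
    using holomorphic_convex_primitive' [OF S(1,2)] by blast
  define G where "G = (\<lambda>\<zeta>. G0 \<zeta> - G0 \<zeta>0)"
  have G: "(G has_field_derivative g \<zeta>) (at \<zeta>)" if "\<zeta> \<in> S" for \<zeta>
    unfolding G_def using G0 [OF that]
    by (auto intro!: derivative_eq_intros simp: at_within_open [OF that S(2)])
  have C0: "0 \<le> C" using C(1) [OF S(3)] norm_ge_zero order_trans by blast
  have gb: "cmod (g \<zeta>) \<le> 2 * C * (K * (2 * C * cmod (\<zeta> - \<zeta>0)) ^ n / fact n)" if "\<zeta> \<in> S" for \<zeta>
  proof -
    have "cmod (g \<zeta>) \<le> cmod (a \<zeta>) * cmod (f1 \<zeta>) + cmod (b \<zeta>) * cmod (f2 \<zeta>)"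
      unfolding g_def by (metis norm_mult norm_triangle_ineq)
    also have "\<dots> \<le> C * (K * (2 * C * cmod (\<zeta> - \<zeta>0)) ^ n / fact n) + C * (K * (2 * C * cmod (\<zeta> - \<zeta>0)) ^ n / fact n)"
      by (intro add_mono mult_mono C f that C0) auto
    finally show ?thesis by simp
  qed
  have "cmod (G \<zeta>) \<le> K * (2 * C * cmod (\<zeta> - \<zeta>0)) ^ Suc n / fact (Suc n)" if \<zeta>: "\<zeta> \<in> S" for \<zeta>
  proof -
    define r where "r = cmod (\<zeta> - \<zeta>0)"
    define \<gamma> where "\<gamma> = (\<lambda>t::real. \<zeta>0 + of_real t * (\<zeta> - \<zeta>0))"
    have \<gamma>S: "\<gamma> t \<in> S" if "0 \<le> t" "t \<le> 1" for t
    proof -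
      have "(1 - t) *\<^sub>R \<zeta>0 + t *\<^sub>R \<zeta> \<in> S" using S \<zeta> that by (intro convexD_alt) auto
      then show ?thesis by (simp add: \<gamma>_def scaleR_conv_of_real algebra_simps)
    qed
    have der: "((\<lambda>t. G (\<gamma> t)) has_vector_derivative (\<zeta> - \<zeta>0) * g (\<gamma> t)) (at t)" if "0 \<le> t" "t \<le> 1" for t
    proof -
      have "((\<lambda>w. G (\<zeta>0 + w * (\<zeta> - \<zeta>0))) has_field_derivative g (\<gamma> t) * (\<zeta> - \<zeta>0)) (at (of_real t))"
        by (rule DERIV_chain2 [where f = G]) (use G \<gamma>S that in \<open>auto simp: \<gamma>_def intro!: derivative_eq_intros\<close>)
      from has_vector_derivative_real_field [OF this] show ?thesis by (simp add: \<gamma>_def mult.commute)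
    qed
    let ?k = "\<lambda>t. K * (2 * C * r) ^ Suc n / fact n * t ^ n"
    have k: "(?k has_integral K * (2 * C * r) ^ Suc n / fact n * (1 ^ Suc n / real (Suc n) - 0 ^ Suc n / real (Suc n))) {0..1}"
    proof (intro has_integral_mult_right fundamental_theorem_of_calculus)
      fix x :: real
      show "((\<lambda>x. x ^ Suc n / real (Suc n)) has_vector_derivative x ^ n) (at x within {0..1})"
        using DERIV_cdivide [OF DERIV_pow [of "Suc n" x "{0..1}"], of "real (Suc n)"]
        by (simp flip: has_real_derivative_iff_has_vector_derivative)
    qed simp
    have "norm (G (\<gamma> 1) - G (\<gamma> 0)) \<le> integral {0..1} ?k"
    proof (rule norm_diff_le_integral)
      show "continuous_on {0..1} (\<lambda>t. G (\<gamma> t))"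
        using der by (auto intro!: continuous_at_imp_continuous_on has_vector_derivative_continuous)
      fix t :: real assume t: "0 < t" "t < 1"
      then show "((\<lambda>t. G (\<gamma> t)) has_vector_derivative (\<zeta> - \<zeta>0) * g (\<gamma> t)) (at t)" by (intro der) auto
      have "cmod (\<gamma> t - \<zeta>0) = t * r" using t by (simp add: \<gamma>_def r_def norm_mult)
      then have "cmod (g (\<gamma> t)) \<le> 2 * C * (K * (2 * C * (t * r)) ^ n / fact n)"
        using gb [OF \<gamma>S, of t] t by simp
      then have "r * cmod (g (\<gamma> t)) \<le> r * (2 * C * (K * (2 * C * (t * r)) ^ n / fact n))"
        by (intro mult_left_mono) (auto simp: r_def)
      also have "\<dots> = ?k t" by (simp add: power_mult_distrib)
      finally show "norm ((\<zeta> - \<zeta>0) * g (\<gamma> t)) \<le> ?k t" by (simp add: norm_mult r_def)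
    qed (use k in auto)
    also have "integral {0..1} ?k = K * (2 * C * r) ^ Suc n / fact (Suc n)"
      using integral_unique [OF k] by simp
    finally show ?thesis by (simp add: \<gamma>_def G_def r_def)
  qed
  moreover have "G holomorphic_on S"
    using G by (auto simp: holomorphic_on_def field_differentiable_def intro: has_field_derivative_at_within)
  moreover have "G \<zeta>0 = 0" by (simp add: G_def)
  ultimately show ?thesis using that G unfolding g_def by blast
qed

text \<open>Because the coefficients are bounded, the Picard series converges on the whole convex
  domain, even an unbounded one. The solution is single-valued and of exponential type, the growth
  that the Phragmen-Lindelof argument can handle.\<close>

lemma linear_ode_convex:
  fixes a b c d :: "complex \<Rightarrow> complex"
  assumes S: "convex S" "open S" "\<zeta>0 \<in> S"
    and hol: "a holomorphic_on S" "b holomorphic_on S" "c holomorphic_on S" "d holomorphic_on S"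
    and C: "\<And>\<zeta>. \<zeta> \<in> S \<Longrightarrow> cmod (a \<zeta>) \<le> C \<and> cmod (b \<zeta>) \<le> C \<and> cmod (c \<zeta>) \<le> C \<and> cmod (d \<zeta>) \<le> C"
  obtains F1 F2 K where "F1 \<zeta>0 = u1" "F2 \<zeta>0 = u2"
    "\<And>\<zeta>. \<zeta> \<in> S \<Longrightarrow> (F1 has_field_derivative a \<zeta> * F1 \<zeta> + b \<zeta> * F2 \<zeta>) (at \<zeta>)"
    "\<And>\<zeta>. \<zeta> \<in> S \<Longrightarrow> (F2 has_field_derivative c \<zeta> * F1 \<zeta> + d \<zeta> * F2 \<zeta>) (at \<zeta>)"
    "0 \<le> K" "\<And>\<zeta>. \<zeta> \<in> S \<Longrightarrow> cmod (F1 \<zeta>) \<le> K * exp (2 * C * cmod (\<zeta> - \<zeta>0))"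
    "\<And>\<zeta>. \<zeta> \<in> S \<Longrightarrow> cmod (F2 \<zeta>) \<le> K * exp (2 * C * cmod (\<zeta> - \<zeta>0))"
proof -
  define K where "K = max (cmod u1) (cmod u2)"
  have K: "0 \<le> K" by (simp add: K_def le_max_iff_disj)
  have C0: "0 \<le> C" using C [OF S(3)] norm_ge_zero order_trans by blast
  let ?B = "\<lambda>n \<zeta>. K * (2 * C * cmod (\<zeta> - \<zeta>0)) ^ n / fact n"
  let ?P = "\<lambda>n D. fst D holomorphic_on S \<and> snd D holomorphic_on S \<and>
    (\<forall>\<zeta>\<in>S. cmod (fst D \<zeta>) \<le> ?B n \<zeta> \<and> cmod (snd D \<zeta>) \<le> ?B n \<zeta>) \<and>
    (n = 0 \<longrightarrow> D = (\<lambda>\<zeta>. u1, \<lambda>\<zeta>. u2))"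
  let ?Q = "\<lambda>D D'. fst D' \<zeta>0 = 0 \<and> snd D' \<zeta>0 = 0 \<and>
    (\<forall>\<zeta>\<in>S. (fst D' has_field_derivative a \<zeta> * fst D \<zeta> + b \<zeta> * snd D \<zeta>) (at \<zeta>) \<and>
      (snd D' has_field_derivative c \<zeta> * fst D \<zeta> + d \<zeta> * snd D \<zeta>) (at \<zeta>))"
  have "\<exists>D :: nat \<Rightarrow> (complex \<Rightarrow> complex) \<times> (complex \<Rightarrow> complex). \<forall>n. ?P n (D n) \<and> ?Q (D n) (D (Suc n))"
  proof (rule dependent_nat_choice)
    show "\<exists>D. ?P 0 D" by (rule exI [of _ "(\<lambda>\<zeta>. u1, \<lambda>\<zeta>. u2)"]) (simp add: K_def)
    fix D :: "(complex \<Rightarrow> complex) \<times> (complex \<Rightarrow> complex)" and n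
    assume D: "?P n D"
    obtain G1 where G1: "G1 holomorphic_on S" "G1 \<zeta>0 = 0"
      "\<And>\<zeta>. \<zeta> \<in> S \<Longrightarrow> (G1 has_field_derivative a \<zeta> * fst D \<zeta> + b \<zeta> * snd D \<zeta>) (at \<zeta>)"
      "\<And>\<zeta>. \<zeta> \<in> S \<Longrightarrow> cmod (G1 \<zeta>) \<le> ?B (Suc n) \<zeta>"
      using linear_ode_step [OF S hol(1,2), of "fst D" "snd D" C K n] D C by blast
    obtain G2 where G2: "G2 holomorphic_on S" "G2 \<zeta>0 = 0"
      "\<And>\<zeta>. \<zeta> \<in> S \<Longrightarrow> (G2 has_field_derivative c \<zeta> * fst D \<zeta> + d \<zeta> * snd D \<zeta>) (at \<zeta>)"
      "\<And>\<zeta>. \<zeta> \<in> S \<Longrightarrow> cmod (G2 \<zeta>) \<le> ?B (Suc n) \<zeta>"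
      using linear_ode_step [OF S hol(3,4), of "fst D" "snd D" C K n] D C by blast
    show "\<exists>D'. ?P (Suc n) D' \<and> ?Q D D'"
      by (rule exI [of _ "(G1, G2)"]) (use G1 G2 in auto)
  qed
  then obtain D where D: "\<And>n. ?P n (D n)" "\<And>n. ?Q (D n) (D (Suc n))" by blast
  define D1 D2 where "D1 = (\<lambda>n. fst (D n))" and "D2 = (\<lambda>n. snd (D n))"
  have D0: "D1 0 = (\<lambda>\<zeta>. u1)" "D2 0 = (\<lambda>\<zeta>. u2)" using D(1) [of 0] by (auto simp: D1_def D2_def)
  have Db: "cmod (D1 n \<zeta>) \<le> ?B n \<zeta>" "cmod (D2 n \<zeta>) \<le> ?B n \<zeta>" if "\<zeta> \<in> S" for n \<zeta>
    using D(1) [of n] that by (auto simp: D1_def D2_def)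
  have Ds: "D1 (Suc n) \<zeta>0 = 0" "D2 (Suc n) \<zeta>0 = 0" for n using D(2) [of n] by (auto simp: D1_def D2_def)
  have Dd: "(D1 (Suc n) has_field_derivative a \<zeta> * D1 n \<zeta> + b \<zeta> * D2 n \<zeta>) (at \<zeta>)"
    "(D2 (Suc n) has_field_derivative c \<zeta> * D1 n \<zeta> + d \<zeta> * D2 n \<zeta>) (at \<zeta>)" if "\<zeta> \<in> S" for n \<zeta>
    using D(2) [of n] that by (auto simp: D1_def D2_def)
  have sumB: "(\<lambda>n. ?B n \<zeta>) sums (K * exp (2 * C * cmod (\<zeta> - \<zeta>0)))" for \<zeta>
    using sums_mult [OF exp_converges [of "2 * C * cmod (\<zeta> - \<zeta>0)"], of K] by (simp add: divide_inverse mult_ac)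
  have sumD: "summable (\<lambda>n. D1 n \<zeta>)" "summable (\<lambda>n. D2 n \<zeta>)" if "\<zeta> \<in> S" for \<zeta>
    by (rule summable_comparison_test' [OF sums_summable [OF sumB [of \<zeta>]], of 0], simp add: Db that)+
  have sumN: "cmod (\<Sum>n. D1 n \<zeta>) \<le> K * exp (2 * C * cmod (\<zeta> - \<zeta>0))"
    "cmod (\<Sum>n. D2 n \<zeta>) \<le> K * exp (2 * C * cmod (\<zeta> - \<zeta>0))" if "\<zeta> \<in> S" for \<zeta>
    using norm_suminf_le [OF Db(1) [OF that] sums_summable [OF sumB]]
      norm_suminf_le [OF Db(2) [OF that] sums_summable [OF sumB]] sums_unique [OF sumB] by auto
  \<comment> \<open>Stated for a generic row of the system so that it serves both components. The
    Weierstrass test is applied on a bounded part of \<open>S\<close>, where the majorants are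
    uniform.\<close>
  have series: "((\<lambda>\<zeta>. \<Sum>n. E n \<zeta>) has_field_derivative p \<zeta> * (\<Sum>n. D1 n \<zeta>) + q \<zeta> * (\<Sum>n. D2 n \<zeta>)) (at \<zeta>)"
    if \<zeta>: "\<zeta> \<in> S" and E0: "\<And>\<zeta>. E 0 \<zeta> = e"
      and Ed: "\<And>n \<zeta>. \<zeta> \<in> S \<Longrightarrow> (E (Suc n) has_field_derivative p \<zeta> * D1 n \<zeta> + q \<zeta> * D2 n \<zeta>) (at \<zeta>)"
      and pq: "\<And>\<zeta>. \<zeta> \<in> S \<Longrightarrow> cmod (p \<zeta>) \<le> C \<and> cmod (q \<zeta>) \<le> C"
      and sE: "summable (\<lambda>n. E n \<zeta>)"
    for E :: "nat \<Rightarrow> complex \<Rightarrow> complex" and p q e \<zeta>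
  proof -
    define R where "R = cmod (\<zeta> - \<zeta>0) + 1"
    define T where "T = S \<inter> ball \<zeta>0 R"
    have T: "convex T" "open T" "\<zeta> \<in> T" "T \<subseteq> S"
      using S \<zeta> by (auto simp: T_def convex_Int R_def dist_norm norm_minus_commute)
    define E' where "E' = (\<lambda>n \<zeta>. case n of 0 \<Rightarrow> 0 | Suc n \<Rightarrow> p \<zeta> * D1 n \<zeta> + q \<zeta> * D2 n \<zeta>)"
    have E'b: "cmod (E' (Suc n) x) \<le> 2 * C * (K * (2 * C * R) ^ n / fact n)" if "x \<in> T" for n x
    proof -
      have x: "x \<in> S" "cmod (x - \<zeta>0) \<le> R" using that by (auto simp: T_def dist_norm norm_minus_commute)
      have le: "?B n x \<le> K * (2 * C * R) ^ n / fact n"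
        using x C0 K by (intro divide_right_mono mult_left_mono power_mono) auto
      have "cmod (E' (Suc n) x) \<le> cmod (p x) * cmod (D1 n x) + cmod (q x) * cmod (D2 n x)"
        by (simp add: E'_def) (metis norm_mult norm_triangle_ineq)
      also have "\<dots> \<le> C * (K * (2 * C * R) ^ n / fact n) + C * (K * (2 * C * R) ^ n / fact n)"
        using pq [OF x(1)] Db [OF x(1), of n] le C0 by (intro add_mono mult_mono) auto
      finally show ?thesis by simp
    qed
    define M where "M = (\<lambda>n. case n of 0 \<Rightarrow> 0 | Suc n \<Rightarrow> 2 * C * (K * (2 * C * R) ^ n / fact n))"
    have "summable (\<lambda>n. 2 * C * (K * (2 * C * R) ^ n / fact n))"
      using summable_mult [OF summable_exp [of "2 * C * R"], of "2 * C * K"] by (simp add: field_simps)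
    then have "summable (\<lambda>n. M (Suc n))" by (simp add: M_def)
    then have "summable M" by (simp only: summable_Suc_iff)
    moreover have "norm (E' n x) \<le> M n" if "x \<in> T" for n x
      using E'b [OF that] by (cases n) (auto simp: E'_def M_def)
    ultimately have unif: "uniformly_convergent_on T (\<lambda>n x. \<Sum>i<n. E' i x)"
      by (intro Weierstrass_m_test') auto
    have "((\<lambda>x. \<Sum>n. E n x) has_field_derivative (\<Sum>n. E' n \<zeta>)) (at \<zeta>)"
    proof (rule has_field_derivative_series'(2) [of T E E' \<zeta> \<zeta>])
      show "(E n has_field_derivative E' n x) (at x within T)" if "x \<in> T" for n x
      proof (cases n)
        case 0
        have "E 0 = (\<lambda>x. e)" using E0 by auto
        then show ?thesis by (simp add: 0 E'_def)
      next
        case (Suc k)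
        then show ?thesis using Ed [of x k] T that by (auto simp: E'_def intro: has_field_derivative_at_within)
      qed
      show "\<zeta> \<in> interior T" using T by (simp add: interior_open)
    qed (use T unif sE in auto)
    moreover have "(\<Sum>n. E' n \<zeta>) = p \<zeta> * (\<Sum>n. D1 n \<zeta>) + q \<zeta> * (\<Sum>n. D2 n \<zeta>)"
    proof -
      have "(\<lambda>n. E' (Suc n) \<zeta>) sums (p \<zeta> * (\<Sum>n. D1 n \<zeta>) + q \<zeta> * (\<Sum>n. D2 n \<zeta>))"
        unfolding E'_def using sumD [OF \<zeta>] by (auto intro!: sums_add sums_mult summable_sums)
      from sums_Suc [OF this]
      have "(\<lambda>n. E' n \<zeta>) sums (p \<zeta> * (\<Sum>n. D1 n \<zeta>) + q \<zeta> * (\<Sum>n. D2 n \<zeta>))" by (simp add: E'_def)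
      then show ?thesis by (simp add: sums_iff)
    qed
    ultimately show ?thesis by simp
  qed
  show ?thesis
  proof (rule that [of "\<lambda>\<zeta>. \<Sum>n. D1 n \<zeta>" "\<lambda>\<zeta>. \<Sum>n. D2 n \<zeta>" K])
    have 1: "D1 n \<zeta>0 = (if n = 0 then u1 else 0)" "D2 n \<zeta>0 = (if n = 0 then u2 else 0)" for n
      using Ds D0 by (cases n; simp)+
    show "(\<Sum>n. D1 n \<zeta>0) = u1" "(\<Sum>n. D2 n \<zeta>0) = u2"
      unfolding 1 using sums_single [of 0 "\<lambda>_. u1"] sums_single [of 0 "\<lambda>_. u2"] by (auto simp: sums_iff)
    fix \<zeta> assume \<zeta>: "\<zeta> \<in> S"
    show "((\<lambda>\<zeta>. \<Sum>n. D1 n \<zeta>) has_field_derivative a \<zeta> * (\<Sum>n. D1 n \<zeta>) + b \<zeta> * (\<Sum>n. D2 n \<zeta>)) (at \<zeta>)"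
      by (rule series [OF \<zeta>, of D1 u1]) (use D0 Dd C sumD \<zeta> in auto)
    show "((\<lambda>\<zeta>. \<Sum>n. D2 n \<zeta>) has_field_derivative c \<zeta> * (\<Sum>n. D1 n \<zeta>) + d \<zeta> * (\<Sum>n. D2 n \<zeta>)) (at \<zeta>)"
      by (rule series [OF \<zeta>, of D2 u2]) (use D0 Dd C sumD \<zeta> in auto)
  qed (use K sumN in auto)
qed

text \<open>In the coordinate w = log \<zeta> the damping factor is exp (- e \<zeta>^2), turned so
  that its axis bisects the sector. There cos (2 Im w - (a + b)) \<ge> cos (b - a) > 0, as the
  opening is below \<pi> / 2, and order 2 beats the exponential type of g.\<close>

lemma phragmen_lindelof_sector:
  assumes \<alpha>: "\<alpha> < pi / 2" and hol: "g holomorphic_on sector \<alpha>" and ab: "-\<alpha> < a" "a \<le> b" "b < \<alpha>" "b - a < pi / 2"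
    and growth: "\<And>\<zeta>. \<zeta> \<in> sector \<alpha> \<Longrightarrow> cmod (g \<zeta>) \<le> K * exp (L * cmod \<zeta>)" and K: "0 \<le> K" "0 \<le> L"
    and rays: "\<And>r. 0 < r \<Longrightarrow> cmod (g (cis a * of_real r)) \<le> M" "\<And>r. 0 < r \<Longrightarrow> cmod (g (cis b * of_real r)) \<le> M"
  shows "\<exists>B. \<forall>\<psi> r. a \<le> \<psi> \<longrightarrow> \<psi> \<le> b \<longrightarrow> 0 < r \<longrightarrow> cmod (g (cis \<psi> * of_real r)) \<le> B"
proof -
  \<comment> \<open>The damping has no effect near the vertex, where Re w tends to minus infinity;
    there the growth bound with |\<zeta>| \<le> 1 gives K exp L.\<close>
  define B where "B = max M (K * exp L)"
  define k where "k = cos (b - a)"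
  have k: "0 < k" unfolding k_def using ab by (intro cos_gt_zero_pi) auto
  define S where "S = {w. \<bar>Im w\<bar> < \<alpha>}"
  have polar: "exp w = cis (Im w) * of_real (exp (Re w))" for w
    by (simp add: exp_eq_polar mult.commute exp_of_real)
  have eS: "exp w \<in> sector \<alpha>" if "w \<in> S" for w
    using exp_in_sector [of 1 w \<alpha>] that \<alpha> by (simp add: S_def)
  have gb: "cmod (g (exp w)) \<le> K * exp (L * exp (Re w))" if "w \<in> S" for w
    using growth [OF eS [OF that]] by simp
  have main: "cmod (g (exp w)) \<le> B" if w: "a \<le> Im w" "Im w \<le> b" for w
  proof -
    have "cmod (g (exp w)) \<le> B * exp (e * exp (2 * Re w))" if e: "0 < e" for e
    proof -
      define h where "h = (\<lambda>w. g (exp w) * exp (- of_real e * exp (2 * w - \<i> * of_real (a + b))))"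
      have nh: "cmod (h w) = cmod (g (exp w)) * exp (- e * exp (2 * Re w) * cos (2 * Im w - (a + b)))" for w
        by (simp add: h_def norm_mult Re_exp)
      have cosb: "k \<le> cos (2 * Im w - (a + b))" if "a \<le> Im w" "Im w \<le> b" for w
      proof -
        have "cos (b - a) \<le> cos \<bar>2 * Im w - (a + b)\<bar>"
          by (rule cos_monotone_0_pi_le) (use that ab in auto)
        then show ?thesis by (simp add: k_def)
      qed
      have hle: "cmod (h w) \<le> cmod (g (exp w)) * exp (- e * exp (2 * Re w) * k)" if "a \<le> Im w" "Im w \<le> b" for w
        unfolding nh using cosb [OF that] e by (intro mult_left_mono) auto
      have "cmod (h w) \<le> B"
      proof (rule strip_maximum_far [where g = h and w = w and S = S and a = a and b = b and X = "L / (e * k)"])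
        have "g \<circ> exp holomorphic_on S"
          by (rule holomorphic_on_compose_gen [OF _ hol]) (use eS in \<open>auto intro!: holomorphic_intros\<close>)
        then show "h holomorphic_on S"
          unfolding h_def by (intro holomorphic_intros) (auto simp: o_def)
        show "{w. a \<le> Im w \<and> Im w \<le> b} \<subseteq> S" using ab by (auto simp: S_def)
      next
        fix w assume w: "Im w = a \<or> Im w = b"
        then have "cmod (g (exp w)) \<le> M" unfolding polar using rays by auto
        moreover have "cmod (h w) \<le> cmod (g (exp w)) * exp (- e * exp (2 * Re w) * k)" using w ab by (intro hle) auto
        moreover have "cmod (g (exp w)) * exp (- e * exp (2 * Re w) * k) \<le> cmod (g (exp w)) * 1"
          using e k by (intro mult_left_mono) auto
        ultimately show "cmod (h w) \<le> B" by (simp add: B_def)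
      next
        fix w assume w: "a \<le> Im w" "Im w \<le> b" "L / (e * k) \<le> \<bar>Re w\<bar>"
        then have wS: "w \<in> S" using ab by (auto simp: S_def)
        define y where "y = exp (Re w)"
        have y: "0 < y" "exp (2 * Re w) = y * y" by (simp_all add: y_def flip: exp_add)
        have "cmod (h w) \<le> (K * exp (L * y)) * exp (- e * (y * y) * k)"
          using hle [OF w(1,2)] gb [OF wS] unfolding y y_def [symmetric]
          by (meson mult_right_mono exp_ge_zero order_trans)
        also have "\<dots> = K * exp (y * (L - e * k * y))" by (simp add: algebra_simps flip: exp_add)
        also have "\<dots> \<le> K * exp L"
        proof (rule mult_left_mono [OF _ K(1)])
          have "y * (L - e * k * y) \<le> L"
          proof (cases "0 \<le> Re w")
            case True
            then have "L / (e * k) \<le> y"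
              using w(3) True exp_ge_add_one_self [of "Re w"] unfolding y_def by linarith
            then have "L - e * k * y \<le> 0" using e k by (simp add: field_simps)
            then show ?thesis using y K by (smt (verit) mult_nonneg_nonpos)
          next
            case False
            then have "y \<le> 1" by (simp add: y_def)
            then have "y * L \<le> 1 * L" using K by (intro mult_right_mono) auto
            moreover have "0 \<le> y * (e * k * y)" using y e k by simp
            ultimately show ?thesis by (simp add: algebra_simps)
          qed
          then show "exp (y * (L - e * k * y)) \<le> exp L" by simp
        qed
        finally show "cmod (h w) \<le> B" by (simp add: B_def)
      qed (use w in auto)
      moreover have "cmod (g (exp w)) = cmod (h w) * exp (e * exp (2 * Re w) * cos (2 * Im w - (a + b)))"
        unfolding nh by (simp add: exp_minus)
      moreover have "\<dots> \<le> cmod (h w) * exp (e * exp (2 * Re w) * 1)"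
        using e by (intro mult_left_mono) auto
      ultimately show ?thesis by (smt (verit, best) mult_right_mono exp_ge_zero mult_1_right)
    qed
    then have "cmod (g (exp w)) \<le> B * exp (0 * exp (2 * Re w))"
      by (rule le_limit_at_0) (auto intro!: continuous_intros)
    then show ?thesis by simp
  qed
  show ?thesis
  proof (intro exI allI impI)
    fix \<psi> r :: real assume "a \<le> \<psi>" "\<psi> \<le> b" "0 < r"
    then show "cmod (g (cis \<psi> * of_real r)) \<le> B"
      using main [of "Complex (ln r) \<psi>"] by (simp add: polar)
  qed
qed

section \<open>Growth of solutions along a ray\<close>

lemma inner_self_derivative:
  fixes f :: "real \<Rightarrow> complex"
  assumes "(f has_vector_derivative d) (at t)"
  shows "((\<lambda>t. (cmod (f t))\<^sup>2) has_real_derivative 2 * inner (f t) d) (at t)"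
proof -
  have "((\<lambda>t. inner (f t) (f t)) has_vector_derivative (inner (f t) d + inner d (f t))) (at t)"
    by (rule bounded_bilinear.has_vector_derivative [OF bounded_bilinear_inner assms assms])
  then show ?thesis
    by (simp add: has_real_derivative_iff_has_vector_derivative power2_norm_eq_inner inner_commute)
qed

lemma dirac_ode_norm_sq:
  assumes "dirac_ode m z lam W F t" and lam: "cmod lam = 1"
  obtains y' where "((\<lambda>t. (norm (F t))\<^sup>2) has_real_derivative y') (at t)"
    "\<bar>y'\<bar> \<le> 2 * (cmod z + \<bar>m\<bar> + mnorm (W t)) * (norm (F t))\<^sup>2"
proof -
  define R where "R = (\<i> * lam) *s dirac_rhs m z (W t) (F t)"
  have "((\<lambda>t. F t $ 1) has_vector_derivative R $ 1) (at t)" "((\<lambda>t. F t $ 2) has_vector_derivative R $ 2) (at t)"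
    using assms(1) by (auto simp: dirac_ode_def R_def dirac_rhs_def vector_2)
  then have "((\<lambda>t. (cmod (F t $ 1))\<^sup>2 + (cmod (F t $ 2))\<^sup>2) has_real_derivative
      2 * inner (F t $ 1) (R $ 1) + 2 * inner (F t $ 2) (R $ 2)) (at t)"
    by (intro DERIV_add inner_self_derivative)
  then have 1: "((\<lambda>t. (norm (F t))\<^sup>2) has_real_derivative 2 * inner (F t) R) (at t)"
    by (simp add: norm_cvec2 inner_vec_def sum_2)
  have "norm R = norm (dirac_rhs m z (W t) (F t))"
    using lam unfolding R_def norm_cvec2_sqrt by (simp add: norm_mult)
  also have "\<dots> \<le> (cmod z + \<bar>m\<bar> + mnorm (W t)) * norm (F t)" by (rule norm_dirac_rhs)
  finally have "norm (F t) * norm R \<le> norm (F t) * ((cmod z + \<bar>m\<bar> + mnorm (W t)) * norm (F t))"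
    by (intro mult_left_mono) auto
  then have "\<bar>inner (F t) R\<bar> \<le> norm (F t) * ((cmod z + \<bar>m\<bar> + mnorm (W t)) * norm (F t))"
    using Cauchy_Schwarz_ineq2 [of "F t" R] by linarith
  also have "\<dots> = (cmod z + \<bar>m\<bar> + mnorm (W t)) * (norm (F t))\<^sup>2"
    by (simp only: power2_eq_square mult_ac)
  finally have "\<bar>2 * inner (F t) R\<bar> \<le> 2 * (cmod z + \<bar>m\<bar> + mnorm (W t)) * (norm (F t))\<^sup>2"
    by linarith
  then show ?thesis using that 1 by blast
qed

lemma dirac_ode_Gronwall:
  assumes ode: "\<And>t. \<lbrakk>a \<le> t; t \<le> b\<rbrakk> \<Longrightarrow> dirac_ode m z lam W F t" and lam: "cmod lam = 1"
    and ab: "a \<le> b" and W: "continuous_on {a..b} W"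
  defines "I \<equiv> integral {a..b} (\<lambda>t. 2 * (cmod z + \<bar>m\<bar> + mnorm (W t)))"
  shows "(norm (F b))\<^sup>2 \<le> (norm (F a))\<^sup>2 * exp I" "(norm (F a))\<^sup>2 \<le> (norm (F b))\<^sup>2 * exp I"
proof -
  have "\<exists>y'. ((\<lambda>t. (norm (F t))\<^sup>2) has_real_derivative y') (at t) \<and>
      \<bar>y'\<bar> \<le> 2 * (cmod z + \<bar>m\<bar> + mnorm (W t)) * (norm (F t))\<^sup>2" if "t \<in> {a..b}" for t
    using dirac_ode_norm_sq [OF ode lam, of t] that by (metis atLeastAtMost_iff)
  then obtain y' where y': "\<And>t. t \<in> {a..b} \<Longrightarrow> ((\<lambda>t. (norm (F t))\<^sup>2) has_real_derivative y' t) (at t) \<and>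
      \<bar>y' t\<bar> \<le> 2 * (cmod z + \<bar>m\<bar> + mnorm (W t)) * (norm (F t))\<^sup>2"
    by metis
  have c: "continuous_on {a..b} (\<lambda>t. 2 * (cmod z + \<bar>m\<bar> + mnorm (W t)))"
    by (intro continuous_intros W)
  show "(norm (F b))\<^sup>2 \<le> (norm (F a))\<^sup>2 * exp I" "(norm (F a))\<^sup>2 \<le> (norm (F b))\<^sup>2 * exp I"
    unfolding I_def by (rule Gronwall [OF ab _ _ c, where y' = y']; use y' in simp)+
qed

lemma dirac_ode_diff:
  assumes "dirac_ode m z lam W F t" "dirac_ode m z lam W G t"
  shows "dirac_ode m z lam W (\<lambda>t. F t - G t) t"
proof -
  have "((\<lambda>t. F t $ 1 - G t $ 1) has_vector_derivative
      \<i> * lam * ((z + m) * F t $ 2 - (W t *v F t) $ 2) - \<i> * lam * ((z + m) * G t $ 2 - (W t *v G t) $ 2)) (at t)"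
    "((\<lambda>t. F t $ 2 - G t $ 2) has_vector_derivative
      \<i> * lam * ((z - m) * F t $ 1 - (W t *v F t) $ 1) - \<i> * lam * ((z - m) * G t $ 1 - (W t *v G t) $ 1)) (at t)"
    using assms by (auto simp: dirac_ode_def intro!: has_vector_derivative_diff)
  then show ?thesis
    by (simp add: dirac_ode_def matrix_vector_mult_diff_distrib algebra_simps)
qed

text \<open>Applied to the difference of two solutions this is uniqueness for the initial value
  problem on the open half-line; Gronwall carries the zero in both directions.\<close>

lemma dirac_ode_zero:
  assumes ode: "\<And>t. 0 < t \<Longrightarrow> dirac_ode m z lam W F t" and lam: "cmod lam = 1"
    and W: "\<And>a b. 0 < a \<Longrightarrow> continuous_on {a..b} W" and s: "0 < s" "F s = 0" and t: "0 < t"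
  shows "F t = 0"
proof (cases "s \<le> t")
  case True
  show ?thesis using dirac_ode_Gronwall(1) [OF ode lam True W] s by simp
next
  case False
  then have "t \<le> s" by simp
  then show ?thesis using dirac_ode_Gronwall(2) [OF ode lam _ W, of t s] s t by simp
qed

text \<open>For real \<open>lam * \<kappa>\<close> the free flow only rotates the phases of the two
  mode coordinates. The sum of their squared moduli changes at a rate governed by the norm of
  \<open>W\<close>, whose integrals are bounded, so Gronwall applies.\<close>

lemma oscillatory_solution_bounded:
  assumes \<kappa>: "\<kappa>\<^sup>2 = z\<^sup>2 - (of_real m)\<^sup>2" "\<kappa> \<noteq> 0" and lam: "cmod lam = 1" "Im (lam * \<kappa>) = 0"
    and ode: "\<And>t. 1 \<le> t \<Longrightarrow> dirac_ode m z lam W F t"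
    and W: "\<And>b. continuous_on {1..b} W" and I: "\<And>b. integral {1..b} (\<lambda>t. mnorm (W t)) \<le> I"
  shows "\<exists>B. \<forall>t\<ge>1. norm (F t) \<le> B"
proof -
  have zm: "z + of_real m \<noteq> 0" by (rule z_plus_m_nonzero [OF \<kappa>])
  define a where "a = (\<lambda>s t. mode m z \<kappa> s (F t))"
  define S where "S = (\<lambda>t. (cmod (a 1 t))\<^sup>2 + (cmod (a (-1) t))\<^sup>2)"
  define N where "N = cmod (z + m) + cmod \<kappa>"
  define L where "L = mode_const m z \<kappa>"
  have L: "0 \<le> L" by (simp add: L_def mode_const_def)
  have FN: "norm (F t) \<le> N * (cmod (a 1 t) + cmod (a (-1) t))" for t
  proof -
    have "norm (F t) \<le> cmod (F t $ 1) + cmod (F t $ 2)"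
      unfolding norm_cvec2_sqrt by (rule sqrt_sum_squares_le_sum) auto
    also have "cmod (F t $ 1) \<le> cmod (z + m) * (cmod (a 1 t) + cmod (a (-1) t))"
      unfolding a_def mode_decomposition(1) [OF zm \<kappa>(2), of "F t"] norm_mult
      by (intro mult_left_mono norm_triangle_ineq) auto
    also have "cmod (F t $ 2) \<le> cmod \<kappa> * (cmod (a 1 t) + cmod (a (-1) t))"
      unfolding a_def mode_decomposition(2) [OF zm \<kappa>(2), of "F t"] norm_mult
      by (intro mult_left_mono norm_triangle_ineq4) auto
    finally show ?thesis by (simp add: N_def algebra_simps)
  qed
  have sq: "(cmod (a 1 t) + cmod (a (-1) t)) * (cmod (a 1 t) + cmod (a (-1) t)) \<le> 2 * S t" for t
    using zero_le_power2 [of "cmod (a 1 t) - cmod (a (-1) t)"]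
    by (simp add: S_def power2_eq_square algebra_simps)
  have N0: "0 \<le> N" by (simp add: N_def)
  define r where "r = (\<lambda>s t. mode_source m z \<kappa> lam s (W t) (F t))"
  have ad: "((\<lambda>t. (cmod (a s t))\<^sup>2) has_real_derivative 2 * inner (a s t) (r s t)) (at t)"
    if s: "s = 1 \<or> s = -1" and t: "1 \<le> t" for s t
  proof -
    have "((\<lambda>t. (cmod (a s t))\<^sup>2) has_real_derivative
        2 * inner (a s t) (\<i> * s * (lam * \<kappa>) * a s t + r s t)) (at t)"
      unfolding a_def r_def by (intro inner_self_derivative mode_derivative \<kappa> ode t s)
    moreover have "inner (a s t) (\<i> * s * (lam * \<kappa>) * a s t) = 0"
    proof -
      obtain \<mu> where "lam * \<kappa> = of_real \<mu>" using lam(2) by (metis complex_is_Real_iff Reals_cases)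
      then show ?thesis by (simp add: inner_complex_def)
    qed
    ultimately show ?thesis by (simp add: inner_add_right)
  qed
  \<comment> \<open>One factor 2 comes from differentiating squares, the other from (|a| + |b|)^2
    \<le> 2 (|a|^2 + |b|^2); \<open>N\<close> converts mode coordinates back to |F|.\<close>
  define k where "k = (\<lambda>t. 4 * L * N * mnorm (W t))"
  have "S b \<le> S 1 * exp (integral {1..b} k)" if b: "1 \<le> b" for b
  proof (rule Gronwall(1) [OF b, where y' = "\<lambda>t. 2 * inner (a 1 t) (r 1 t) + 2 * inner (a (-1) t) (r (-1) t)"])
    fix t assume t: "1 \<le> t" "t \<le> b"
    show "(S has_real_derivative 2 * inner (a 1 t) (r 1 t) + 2 * inner (a (-1) t) (r (-1) t)) (at t)"
      unfolding S_def by (intro DERIV_add ad) (use t in auto)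
    have rb: "\<bar>inner (a s t) (r s t)\<bar> \<le> cmod (a s t) * (L * (mnorm (W t) * norm (F t)))" if s: "s = 1 \<or> s = -1" for s
      unfolding r_def L_def
      by (rule order_trans [OF Cauchy_Schwarz_ineq2]) (intro mult_left_mono mode_source_bound lam s norm_ge_zero)
    have "\<bar>2 * inner (a 1 t) (r 1 t) + 2 * inner (a (-1) t) (r (-1) t)\<bar>
        \<le> 2 * \<bar>inner (a 1 t) (r 1 t)\<bar> + 2 * \<bar>inner (a (-1) t) (r (-1) t)\<bar>" by linarith
    also have "\<dots> \<le> 2 * (L * mnorm (W t)) * ((cmod (a 1 t) + cmod (a (-1) t)) * norm (F t))"
      using rb [of 1] rb [of "-1"] by (simp add: algebra_simps)
    also have "\<dots> \<le> 2 * (L * mnorm (W t)) * ((cmod (a 1 t) + cmod (a (-1) t)) * (N * (cmod (a 1 t) + cmod (a (-1) t))))"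
      by (intro mult_left_mono FN) (auto simp: L)
    also have "\<dots> = 2 * (L * N * mnorm (W t)) * ((cmod (a 1 t) + cmod (a (-1) t)) * (cmod (a 1 t) + cmod (a (-1) t)))"
      by (simp add: mult_ac)
    also have "\<dots> \<le> 2 * (L * N * mnorm (W t)) * (2 * S t)"
      by (intro mult_left_mono sq) (auto simp: L N0)
    finally show "\<bar>2 * inner (a 1 t) (r 1 t) + 2 * inner (a (-1) t) (r (-1) t)\<bar> \<le> k t * S t"
      by (simp add: k_def mult_ac)
  next
    show "continuous_on {1..b} k" unfolding k_def by (intro continuous_intros W)
  qed
  moreover have "integral {1..b} k \<le> 4 * L * N * I" for b
    unfolding k_def using I [of b] L N0 by (simp add: mult_left_mono)
  moreover have S0: "0 \<le> S t" for t by (simp add: S_def)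
  ultimately have Sb: "S b \<le> S 1 * exp (4 * L * N * I)" if "1 \<le> b" for b
    using that by (meson exp_le_cancel_iff mult_left_mono order_trans)
  have "norm (F t) \<le> N * sqrt (2 * (S 1 * exp (4 * L * N * I)))" if "1 \<le> t" for t
  proof -
    have "cmod (a 1 t) + cmod (a (-1) t) \<le> sqrt (2 * S t)"
      by (rule real_le_rsqrt) (use sq in \<open>simp add: power2_eq_square\<close>)
    also have "\<dots> \<le> sqrt (2 * (S 1 * exp (4 * L * N * I)))" using Sb [OF that] by simp
    finally show ?thesis using FN [of t] N0 by (meson mult_left_mono order_trans)
  qed
  then show ?thesis by blast
qed

text \<open>The solution is continued from the point \<open>cis \<phi>\<close> and agrees with
  \<open>f\<close> on its own ray by uniqueness. It is bounded there and on the oscillatory ray of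
  angle \<open>\<psi>0\<close>, hence in between. The limit at 0 serves the gluing of the
  half-lines, the last conclusion the nontriviality of the glued function.\<close>

lemma (in ray_potential) half_line_continuation:
  assumes \<kappa>: "\<kappa>\<^sup>2 = z\<^sup>2 - (of_real m)\<^sup>2" "\<kappa> \<noteq> 0" and real: "Im (cis \<psi>0 * \<kappa>) = 0"
    and ang: "-\<alpha> < \<psi>0" "\<psi>0 \<le> \<psi>" "\<psi> \<le> \<phi>" "\<phi> < \<alpha>" "\<phi> - \<psi>0 < pi / 2"
    and ode: "\<And>x. 0 < x \<Longrightarrow> dirac_ode m z (cis \<phi>) (\<lambda>x. V (cis \<phi> * of_real x)) f x"
    and fb: "\<And>x. 0 < x \<Longrightarrow> norm (f x) \<le> Bf" and f0: "(f \<longlongrightarrow> f0) (at_right 0)"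
  obtains H B where "\<And>x. 0 < x \<Longrightarrow> dirac_ode m z (cis \<psi>) (\<lambda>x. V (cis \<psi> * of_real x)) H x"
    "\<And>x. 0 < x \<Longrightarrow> norm (H x) \<le> B" "(H \<longlongrightarrow> f0) (at_right 0)"
    "(\<And>x. 0 < x \<Longrightarrow> H x = 0) \<Longrightarrow> (\<And>x. 0 < x \<Longrightarrow> f x = 0)"
proof -
  let ?S = "sector \<alpha>"
  have api: "\<alpha> < pi" using \<alpha> by simp
  obtain C where C: "\<And>\<zeta>. \<zeta> \<in> ?S \<Longrightarrow> norm (V \<zeta>) \<le> C"
    using bounded_V by (auto simp: bounded_iff)
  define C1 where "C1 = cmod z + \<bar>m\<bar> + C"
  have cisS: "cis t * of_real x \<in> ?S" if "\<bar>t\<bar> < \<alpha>" "0 < x" for t x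
    using that api by (intro sector_rcis)
  have \<phi>: "\<bar>\<phi>\<bar> < \<alpha>" and \<psi>: "\<bar>\<psi>\<bar> < \<alpha>" and \<psi>0: "\<bar>\<psi>0\<bar> < \<alpha>" using ang by auto
  have s1: "cis \<phi> \<in> ?S" using cisS [OF \<phi>, of 1] by simp
  have C0: "0 \<le> C" using C [OF s1] norm_ge_zero order_trans by blast
  have Vb: "cmod (V \<zeta> $ i $ j) \<le> C" if "\<zeta> \<in> ?S" for \<zeta> i j
    using C [OF that] Finite_Cartesian_Product.norm_nth_le [of "V \<zeta> $ i" j]
      Finite_Cartesian_Product.norm_nth_le [of "V \<zeta>" i] by linarith
  define p q where "p = z + of_real m" and "q = z - of_real m"
  have pq: "cmod p \<le> cmod z + \<bar>m\<bar>" "cmod q \<le> cmod z + \<bar>m\<bar>"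
    unfolding p_def q_def using norm_triangle_ineq [of z "of_real m"] norm_triangle_ineq4 [of z "of_real m"] by auto
  have bounds: "cmod (- \<i> * V \<zeta> $ 2 $ 1) \<le> C1 \<and> cmod (\<i> * (p - V \<zeta> $ 2 $ 2)) \<le> C1 \<and>
      cmod (\<i> * (q - V \<zeta> $ 1 $ 1)) \<le> C1 \<and> cmod (- \<i> * V \<zeta> $ 1 $ 2) \<le> C1" if "\<zeta> \<in> ?S" for \<zeta>
    using add_nonneg_nonneg [OF norm_ge_zero [of z] abs_ge_zero [of m]] pq Vb [OF that, of 2 1] Vb [OF that, of 2 2] Vb [OF that, of 1 1] Vb [OF that, of 1 2]
      norm_triangle_ineq4 [of p "V \<zeta> $ 2 $ 2"] norm_triangle_ineq4 [of q "V \<zeta> $ 1 $ 1"]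
    by (simp add: C1_def norm_mult del: add_nonneg_nonneg)
  have coeff: "(\<lambda>\<zeta>. - \<i> * V \<zeta> $ 2 $ 1) holomorphic_on ?S" "(\<lambda>\<zeta>. \<i> * (p - V \<zeta> $ 2 $ 2)) holomorphic_on ?S"
    "(\<lambda>\<zeta>. \<i> * (q - V \<zeta> $ 1 $ 1)) holomorphic_on ?S" "(\<lambda>\<zeta>. - \<i> * V \<zeta> $ 1 $ 2) holomorphic_on ?S"
    by (intro holomorphic_intros hol)+
  obtain F1 F2 K where F: "F1 (cis \<phi>) = f 1 $ 1" "F2 (cis \<phi>) = f 1 $ 2"
    "\<And>\<zeta>. \<zeta> \<in> ?S \<Longrightarrow> (F1 has_field_derivative (- \<i> * V \<zeta> $ 2 $ 1) * F1 \<zeta> + (\<i> * (p - V \<zeta> $ 2 $ 2)) * F2 \<zeta>) (at \<zeta>)"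
    "\<And>\<zeta>. \<zeta> \<in> ?S \<Longrightarrow> (F2 has_field_derivative (\<i> * (q - V \<zeta> $ 1 $ 1)) * F1 \<zeta> + (- \<i> * V \<zeta> $ 1 $ 2) * F2 \<zeta>) (at \<zeta>)"
    "0 \<le> K" "\<And>\<zeta>. \<zeta> \<in> ?S \<Longrightarrow> cmod (F1 \<zeta>) \<le> K * exp (2 * C1 * cmod (\<zeta> - cis \<phi>))"
    "\<And>\<zeta>. \<zeta> \<in> ?S \<Longrightarrow> cmod (F2 \<zeta>) \<le> K * exp (2 * C1 * cmod (\<zeta> - cis \<phi>))"
    by (rule linear_ode_convex [OF convex_sector [OF \<alpha>] open_sector [OF \<alpha>] s1 coeff bounds]) (assumption, rule that)
  define h :: "real \<Rightarrow> real \<Rightarrow> complex^2" where "h = (\<lambda>t x. vector [F1 (cis t * of_real x), F2 (cis t * of_real x)])"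
  have C10: "0 \<le> C1" using C0 by (simp add: C1_def)
  have chain: "((\<lambda>x. G (cis t * of_real x)) has_vector_derivative cis t * d) (at x)"
    if "(G has_field_derivative d) (at (cis t * of_real x))" for G t x d
  proof -
    have "((\<lambda>\<zeta>. G (cis t * \<zeta>)) has_field_derivative d * cis t) (at (of_real x))"
      by (rule DERIV_chain2 [where f = G and g = "\<lambda>\<zeta>. cis t * \<zeta>"], rule that)
        (auto intro!: derivative_eq_intros)
    from has_vector_derivative_real_field [OF this] show ?thesis by (simp add: mult.commute)
  qed
  have hode: "dirac_ode m z (cis t) (\<lambda>x. V (cis t * of_real x)) (h t) x" if "\<bar>t\<bar> < \<alpha>" "0 < x" for t x
    using chain [OF F(3) [OF cisS [OF that]]] chain [OF F(4) [OF cisS [OF that]]]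
    by (simp add: dirac_ode_def h_def vector_2 matrix_vector_nth2 p_def q_def algebra_simps)
  have cV: "continuous_on {a..b} (\<lambda>x. V (cis t * of_real x))" if "\<bar>t\<bar> < \<alpha>" "0 < a" for a b t
    using continuous_ray [of "\<i> * of_real t" a b] that by (simp add: cis_conv_exp)
  have hf: "h \<phi> x = f x" if "0 < x" for x
  proof -
    have "(\<lambda>x. h \<phi> x - f x) x = 0"
    proof (rule dirac_ode_zero [where F = "\<lambda>x. h \<phi> x - f x" and s = 1])
      show "dirac_ode m z (cis \<phi>) (\<lambda>x. V (cis \<phi> * of_real x)) (\<lambda>x. h \<phi> x - f x) t" if "0 < t" for t
        by (intro dirac_ode_diff hode ode \<phi> that)
      show "h \<phi> 1 - f 1 = 0" by (simp add: h_def F(1,2) vec_eq_iff forall_2 vector_2)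
    qed (use cV \<phi> that in auto)
    then show ?thesis by simp
  qed
  have hn: "norm (h t x) \<le> cmod (F1 (cis t * of_real x)) + cmod (F2 (cis t * of_real x))" for t x
    using sqrt_sum_squares_le_sum [of "cmod (F1 (cis t * of_real x))" "cmod (F2 (cis t * of_real x))"]
    unfolding norm_cvec2_sqrt by (simp add: h_def vector_2)
  have nh: "cmod (F1 (cis t * of_real x)) \<le> norm (h t x)" "cmod (F2 (cis t * of_real x)) \<le> norm (h t x)" for t x
    using Finite_Cartesian_Product.norm_nth_le [of "h t x" 1] Finite_Cartesian_Product.norm_nth_le [of "h t x" 2]
    by (auto simp: h_def vector_2)
  define K1 where "K1 = K * exp (2 * C1)"
  have K1: "0 \<le> K1" using F(5) by (simp add: K1_def)
  have growth: "cmod (F1 \<zeta>) \<le> K1 * exp (2 * C1 * cmod \<zeta>)" "cmod (F2 \<zeta>) \<le> K1 * exp (2 * C1 * cmod \<zeta>)" if "\<zeta> \<in> ?S" for \<zeta>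
  proof -
    have "cmod (\<zeta> - cis \<phi>) \<le> cmod \<zeta> + 1" using norm_triangle_ineq4 [of \<zeta> "cis \<phi>"] by simp
    then have "2 * C1 * cmod (\<zeta> - cis \<phi>) \<le> 2 * C1 * (cmod \<zeta> + 1)" using C10 by (intro mult_left_mono) auto
    then have "K * exp (2 * C1 * cmod (\<zeta> - cis \<phi>)) \<le> K * exp (2 * C1 * (cmod \<zeta> + 1))"
      using F(5) by (intro mult_left_mono) auto
    also have "\<dots> = K1 * exp (2 * C1 * cmod \<zeta>)" by (simp add: K1_def algebra_simps flip: exp_add)
    finally show "cmod (F1 \<zeta>) \<le> K1 * exp (2 * C1 * cmod \<zeta>)" "cmod (F2 \<zeta>) \<le> K1 * exp (2 * C1 * cmod \<zeta>)"
      using F(6,7) [OF that] by auto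
  qed
  have "\<exists>B. \<forall>t\<ge>1. norm (h \<psi>0 t) \<le> B"
  proof (rule oscillatory_solution_bounded [OF \<kappa> _ real])
    show "dirac_ode m z (cis \<psi>0) (\<lambda>x. V (cis \<psi>0 * of_real x)) (h \<psi>0) t" if "1 \<le> t" for t
      by (rule hode [OF \<psi>0]) (use that in simp)
    show "continuous_on {1..b} (\<lambda>x. V (cis \<psi>0 * of_real x))" for b by (rule cV [OF \<psi>0]) simp
    show "integral {1..b} (\<lambda>t. mnorm (V (cis \<psi>0 * of_real t))) \<le> half_norm V \<psi>0" for b
      using half_norm_scaled [of V "\<i> * of_real \<psi>0" 1 b] int [OF \<psi>0]
        integrable_continuous_real [OF continuous_on_mnorm [OF cV [OF \<psi>0]], of 1 b]
      by (simp add: cis_conv_exp)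
  qed simp
  then obtain B0 where B0: "\<And>t. 1 \<le> t \<Longrightarrow> norm (h \<psi>0 t) \<le> B0" by blast
  \<comment> \<open>The oscillatory bound starts at radius 1; for smaller radii the growth estimate
    takes over.\<close>
  define M where "M = max (max B0 Bf) (K1 * exp (2 * C1))"
  have MF: "cmod (F1 (cis \<psi>0 * of_real x)) \<le> M \<and> cmod (F2 (cis \<psi>0 * of_real x)) \<le> M"
    "cmod (F1 (cis \<phi> * of_real x)) \<le> M \<and> cmod (F2 (cis \<phi> * of_real x)) \<le> M" if x: "0 < x" for x
  proof -
    show "cmod (F1 (cis \<phi> * of_real x)) \<le> M \<and> cmod (F2 (cis \<phi> * of_real x)) \<le> M"
      using nh [of \<phi> x] hf [OF x] fb [OF x] by (auto simp: M_def)
    show "cmod (F1 (cis \<psi>0 * of_real x)) \<le> M \<and> cmod (F2 (cis \<psi>0 * of_real x)) \<le> M"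
    proof (cases "1 \<le> x")
      case True
      then show ?thesis using nh [of \<psi>0 x] B0 [OF True] by (auto simp: M_def)
    next
      case False
      then have "2 * C1 * x \<le> 2 * C1 * 1" using C10 by (intro mult_left_mono) auto
      then have "K1 * exp (2 * C1 * x) \<le> K1 * exp (2 * C1)" using K1 by (intro mult_left_mono) auto
      then show ?thesis using growth [OF cisS [OF \<psi>0 x]] x by (auto simp: M_def norm_mult)
    qed
  qed
  have holF: "F1 holomorphic_on ?S" "F2 holomorphic_on ?S"
    using F(3,4) by (auto simp: holomorphic_on_def field_differentiable_def intro: has_field_derivative_at_within)
  have le: "\<psi>0 \<le> \<phi>" using ang by simp
  have "\<exists>B. \<forall>t r. \<psi>0 \<le> t \<longrightarrow> t \<le> \<phi> \<longrightarrow> 0 < r \<longrightarrow> cmod (F1 (cis t * of_real r)) \<le> B"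
    by (rule phragmen_lindelof_sector [OF \<alpha>(2) holF(1) ang(1) le ang(4,5) growth(1) K1]) (use MF C10 in auto)
  then obtain B1 where B1: "\<And>t r. \<lbrakk>\<psi>0 \<le> t; t \<le> \<phi>; 0 < r\<rbrakk> \<Longrightarrow> cmod (F1 (cis t * of_real r)) \<le> B1"
    by blast
  have "\<exists>B. \<forall>t r. \<psi>0 \<le> t \<longrightarrow> t \<le> \<phi> \<longrightarrow> 0 < r \<longrightarrow> cmod (F2 (cis t * of_real r)) \<le> B"
    by (rule phragmen_lindelof_sector [OF \<alpha>(2) holF(2) ang(1) le ang(4,5) growth(2) K1]) (use MF C10 in auto)
  then obtain B2 where B2: "\<And>t r. \<lbrakk>\<psi>0 \<le> t; t \<le> \<phi>; 0 < r\<rbrakk> \<Longrightarrow> cmod (F2 (cis t * of_real r)) \<le> B2"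
    by blast
  show ?thesis
  proof (rule that [of "h \<psi>" "B1 + B2"])
    show "dirac_ode m z (cis \<psi>) (\<lambda>x. V (cis \<psi> * of_real x)) (h \<psi>) x" if "0 < x" for x
      by (rule hode [OF \<psi> that])
    show "norm (h \<psi> x) \<le> B1 + B2" if "0 < x" for x
      using hn [of \<psi> x] B1 [OF ang(2,3) that] B2 [OF ang(2,3) that] by linarith
  next
    \<comment> \<open>Near the vertex coefficients and solution are bounded, so the solution is
      Lipschitz there, while points of radius x on the two rays are at most 2 x apart. Hence both
      rays share one limit at 0.\<close>
    define T where "T = ?S \<inter> ball 0 2"
    define D where "D = 2 * (C1 * (K1 * exp (2 * C1 * 2)))"
    have lip: "cmod (G w - G w') \<le> D * cmod (w - w')" if "w \<in> T" "w' \<in> T"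
      and G: "\<And>\<zeta>. \<zeta> \<in> ?S \<Longrightarrow> (G has_field_derivative a \<zeta> * F1 \<zeta> + b \<zeta> * F2 \<zeta>) (at \<zeta>)"
      and ab: "\<And>\<zeta>. \<zeta> \<in> ?S \<Longrightarrow> cmod (a \<zeta>) \<le> C1 \<and> cmod (b \<zeta>) \<le> C1"
      for G a b :: "complex \<Rightarrow> complex" and w w'
    proof (rule field_differentiable_bound [of T])
      show "convex T" unfolding T_def by (intro convex_Int convex_sector \<alpha> convex_ball)
      fix \<zeta> assume "\<zeta> \<in> T"
      then have \<zeta>: "\<zeta> \<in> ?S" "cmod \<zeta> \<le> 2" by (auto simp: T_def)
      show "(G has_field_derivative a \<zeta> * F1 \<zeta> + b \<zeta> * F2 \<zeta>) (at \<zeta> within T)"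
        by (rule has_field_derivative_at_within [OF G [OF \<zeta>(1)]])
      have e: "K1 * exp (2 * C1 * cmod \<zeta>) \<le> K1 * exp (2 * C1 * 2)"
        using mult_left_mono [OF \<zeta>(2), of "2 * C1"] C10 K1 by (intro mult_left_mono) auto
      have "cmod (a \<zeta> * F1 \<zeta> + b \<zeta> * F2 \<zeta>) \<le> cmod (a \<zeta>) * cmod (F1 \<zeta>) + cmod (b \<zeta>) * cmod (F2 \<zeta>)"
        by (metis norm_mult norm_triangle_ineq)
      also have "\<dots> \<le> C1 * (K1 * exp (2 * C1 * 2)) + C1 * (K1 * exp (2 * C1 * 2))"
        using ab [OF \<zeta>(1)] growth [OF \<zeta>(1)] e C10 by (intro add_mono mult_mono) auto
      finally show "cmod (a \<zeta> * F1 \<zeta> + b \<zeta> * F2 \<zeta>) \<le> D" by (simp add: D_def)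
    qed (use that in auto)
    have D0: "0 \<le> D" using C10 K1 by (simp add: D_def)
    have hl: "norm (h \<psi> x - f x) \<le> 4 * D * x" if x: "0 < x" "x < 1" for x
    proof -
      have T: "cis \<psi> * of_real x \<in> T" "cis \<phi> * of_real x \<in> T"
        using x cisS \<psi> \<phi> by (auto simp: T_def norm_mult)
      have d: "cmod (cis \<psi> * of_real x - cis \<phi> * of_real x) \<le> 2 * x"
        using norm_triangle_ineq4 [of "cis \<psi> * of_real x" "cis \<phi> * of_real x"] x by (simp add: norm_mult)
      have "cmod (F1 (cis \<psi> * of_real x) - F1 (cis \<phi> * of_real x)) \<le> D * (2 * x)"
        by (rule order_trans [OF lip [OF T F(3)] mult_left_mono [OF d D0]]) (use bounds in auto)
      moreover have "cmod (F2 (cis \<psi> * of_real x) - F2 (cis \<phi> * of_real x)) \<le> D * (2 * x)"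
        by (rule order_trans [OF lip [OF T F(4)] mult_left_mono [OF d D0]]) (use bounds in auto)
      moreover have "norm (h \<psi> x - h \<phi> x) \<le> cmod (F1 (cis \<psi> * of_real x) - F1 (cis \<phi> * of_real x))
          + cmod (F2 (cis \<psi> * of_real x) - F2 (cis \<phi> * of_real x))"
        using sqrt_sum_squares_le_sum [of "cmod (F1 (cis \<psi> * of_real x) - F1 (cis \<phi> * of_real x))"
            "cmod (F2 (cis \<psi> * of_real x) - F2 (cis \<phi> * of_real x))"]
        unfolding norm_cvec2_sqrt by (simp add: h_def vector_2)
      ultimately show ?thesis using hf [OF x(1)] by simp
    qed
    have "((\<lambda>x. h \<psi> x - f x) \<longlongrightarrow> 0) (at_right 0)"
    proof (rule Lim_null_comparison)
      show "\<forall>\<^sub>F x in at_right 0. norm (h \<psi> x - f x) \<le> 4 * D * x"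
        using hl by (auto simp: eventually_at_right_field intro!: exI [of _ 1])
      show "((\<lambda>x. 4 * D * x) \<longlongrightarrow> 0) (at_right 0)" by (auto intro!: tendsto_eq_intros)
    qed
    from tendsto_add [OF this f0] show "(h \<psi> \<longlongrightarrow> f0) (at_right 0)" by simp
  next
    fix x :: real assume hz: "\<And>x. 0 < x \<Longrightarrow> h \<psi> x = 0" and x: "0 < x"
    have z: "F1 (cis \<psi> * of_real x) = 0" "F2 (cis \<psi> * of_real x) = 0" if "0 < x" for x
      using nh [of \<psi> x] hz [OF that] by auto
    \<comment> \<open>Zeros on the rotated ray accumulate at the interior point
      \<open>cis \<psi>\<close>, so the continuation vanishes on the whole sector.\<close>
    let ?U = "(\<lambda>x. cis \<psi> * of_real x) ` {0<..}"
    have lim: "cis \<psi> islimpt ?U"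
      unfolding islimpt_approachable
    proof (intro allI impI)
      fix e :: real assume "0 < e"
      then have "cis \<psi> * of_real (1 + e / 2) \<in> ?U" by (intro imageI) auto
      moreover have "cis \<psi> * of_real (1 + e / 2) - cis \<psi> = cis \<psi> * of_real (e / 2)" by (simp add: algebra_simps)
      then have "cmod (cis \<psi> * of_real (1 + e / 2) - cis \<psi>) = e / 2"
        using \<open>0 < e\<close> by (simp only: norm_mult norm_of_real norm_cis)
      then have "cis \<psi> * of_real (1 + e / 2) \<noteq> cis \<psi> \<and> dist (cis \<psi> * of_real (1 + e / 2)) (cis \<psi>) < e"
        using \<open>0 < e\<close> by (auto simp: dist_norm)
      ultimately show "\<exists>x'\<in>?U. x' \<noteq> cis \<psi> \<and> dist x' (cis \<psi>) < e" by blast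
    qed
    have vanish: "G (cis \<phi> * of_real x) = 0" if "G holomorphic_on ?S" "\<And>x. 0 < x \<Longrightarrow> G (cis \<psi> * of_real x) = 0" for G
      by (rule analytic_continuation [OF that(1) open_sector [OF \<alpha>] convex_connected [OF convex_sector [OF \<alpha>]] _ _ lim])
        (use cisS [OF \<psi>] cisS [OF \<psi>, of 1] cisS [OF \<phi> x] that(2) in auto)
    have "h \<phi> x = 0"
      unfolding h_def using vanish [OF holF(1) z(1)] vanish [OF holF(2) z(2)]
      by (simp add: vec_eq_iff forall_2 vector_2)
    then show "f x = 0" using hf [OF x] by simp
  qed
qed

section \<open>Rotation of the ray\<close>

definition conj_sigma3 :: "complex^2^2 \<Rightarrow> complex^2^2" where
  "conj_sigma3 A = (\<chi> i j. (if i = j then 1 else -1) * A $ i $ j)"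

lemma conj_sigma3_mult: "conj_sigma3 A *v u = sigma3 *v (A *v (sigma3 *v u))"
  by (simp add: vec_eq_iff forall_2 matrix_vector_nth2 sigma3_mult vector_2 conj_sigma3_def)

lemma conj_sigma3_invol [simp]: "conj_sigma3 (conj_sigma3 A) = A"
  by (simp add: vec_eq_iff conj_sigma3_def)

lemma norm_sigma3 [simp]: "norm (sigma3 *v u) = norm u"
  unfolding norm_cvec2_sqrt by (simp add: sigma3_mult vector_2)

lemma sigma3_invol [simp]: "sigma3 *v (sigma3 *v u) = u"
  by (simp add: vec_eq_iff forall_2 sigma3_mult vector_2)

lemma mnorm_conj_sigma3 [simp]: "mnorm (conj_sigma3 A) = mnorm A"
proof -
  have "mnorm (conj_sigma3 A) \<le> mnorm A" for A
    by (rule onorm_bound) (use mnorm_bound [of A "sigma3 *v _"] in \<open>simp_all add: conj_sigma3_mult\<close>)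
  from this [of A] this [of "conj_sigma3 A"] show ?thesis by simp
qed

lemma norm_conj_sigma3 [simp]: "norm (conj_sigma3 A) = norm A"
proof -
  have "norm (conj_sigma3 A $ i) = norm (A $ i)" for i
    unfolding norm_cvec2_sqrt by (simp add: conj_sigma3_def norm_mult)
  then show ?thesis by (simp add: norm_vec_def [of "conj_sigma3 A"] norm_vec_def [of A])
qed

text \<open>\<open>sigma3\<close> anticommutes with \<open>sigma1\<close> and commutes with the mass
  term, so conjugation by it changes the sign of the derivative term alone.\<close>

lemma dirac_ode_reflect:
  assumes "dirac_ode m z lam W F (- x)"
  shows "dirac_ode m z lam (\<lambda>x. conj_sigma3 (W (- x))) (\<lambda>x. sigma3 *v F (- x)) x"
proof -
  have refl: "((\<lambda>t. F (- t) $ i) has_vector_derivative - d) (at x)"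
    if "((\<lambda>t. F t $ i) has_vector_derivative d) (at (- x))" for i d
  proof -
    have "((\<lambda>x. - x) has_vector_derivative - 1) (at x)"
      by (rule has_vector_derivative_minus [OF has_vector_derivative_id])
    from vector_diff_chain_at [OF this that]
    have "(((\<lambda>t. F t $ i) \<circ> (\<lambda>x. - x)) has_vector_derivative (- 1) *\<^sub>R d) (at x)" .
    then show ?thesis by (simp add: o_def)
  qed
  have "((\<lambda>t. F (- t) $ 1) has_vector_derivative - (\<i> * lam * ((z + m) * F (- x) $ 2 - (W (- x) *v F (- x)) $ 2))) (at x)"
    "((\<lambda>t. F (- t) $ 2) has_vector_derivative - (\<i> * lam * ((z - m) * F (- x) $ 1 - (W (- x) *v F (- x)) $ 1))) (at x)"
    using assms refl unfolding dirac_ode_def by blast+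
  from this(1) has_vector_derivative_minus [OF this(2)] show ?thesis
    unfolding dirac_ode_def conj_sigma3_mult sigma3_invol
    by (simp add: sigma3_mult vector_2 algebra_simps)
qed

lemma dirac_ode_transform:
  assumes "dirac_ode m z lam W F x" "open S" "x \<in> S" "\<And>y. y \<in> S \<Longrightarrow> F y = G y"
  shows "dirac_ode m z lam W G x"
proof -
  have "((\<lambda>t. G t $ i) has_vector_derivative d) (at x)" if "((\<lambda>t. F t $ i) has_vector_derivative d) (at x)" for i d
    by (rule has_vector_derivative_transform_within_open [OF that assms(2,3)]) (simp add: assms(4))
  then show ?thesis
    using assms(1) unfolding dirac_ode_def assms(4) [OF assms(3)] by blast
qed

lemma dirac_ode_cong: "\<lbrakk>dirac_ode m z lam W F x; W x = W' x\<rbrakk> \<Longrightarrow> dirac_ode m z lam W' F x"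
  by (simp add: dirac_ode_def)

lemma isCont_vec2:
  fixes F :: "real \<Rightarrow> complex^2"
  assumes "isCont (\<lambda>t. F t $ 1) x" "isCont (\<lambda>t. F t $ 2) x" shows "isCont F x"
  unfolding isCont_def
proof (rule vec_tendstoI)
  fix i
  show "((\<lambda>t. F t $ i) \<longlongrightarrow> F x $ i) (at x)"
    using assms exhaust_2 [of i] by (auto simp: isCont_def)
qed

lemma dirac_ode_isCont: "dirac_ode m z lam W F x \<Longrightarrow> isCont F x"
  by (intro isCont_vec2) (auto simp: dirac_ode_def intro: has_vector_derivative_continuous)

text \<open>Conjugation by \<open>\<sigma>\<^sub>3\<close> undoes the sign of the derivative under \<open>x \<mapsto> - x\<close>, so the left half-line becomes a
  right half-line problem with this potential.\<close>

definition left_potential :: "(complex \<Rightarrow> complex^2^2) \<Rightarrow> complex \<Rightarrow> complex^2^2" where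
  "left_potential V \<zeta> = conj_sigma3 (V (- \<zeta>))"

section \<open>L1 norms on full rays and rotation of eigenfunctions\<close>

lemma ray_norm_nonneg: "0 \<le> ray_norm V \<phi>"
  unfolding ray_norm_def by (rule Bochner_Integration.integral_nonneg) simp

context
  fixes \<alpha> :: real and V :: "complex \<Rightarrow> complex^2^2"
  assumes \<alpha>: "0 < \<alpha>" "\<alpha> < pi / 2" and adm: "admissible_potential \<alpha> V"
begin

lemma integrable_ray: "\<bar>\<phi>\<bar> < \<alpha> \<Longrightarrow> integrable lborel (\<lambda>x. mnorm (V (cis \<phi> * of_real x)))"
  by (rule integrable_mnorm [OF admissible_integrable [OF adm]])

lemma left_integral:
  "(LINT x:{0<..}|lborel. mnorm (left_potential V (cis \<phi> * of_real x))) = (LINT x:{..<0}|lborel. mnorm (V (cis \<phi> * of_real x)))"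
proof -
  have *: "indicat_real {..<0} (0 + -1 * x) = indicat_real {0<..} x" for x :: real
    by (simp add: indicator_def)
  show ?thesis
    using lborel_integral_real_affine [of "-1" "\<lambda>x. indicat_real {..<0} x * mnorm (V (cis \<phi> * of_real x))" 0]
    unfolding * by (simp add: set_lebesgue_integral_def left_potential_def)
qed

lemma left_set_integrable:
  assumes "\<bar>\<phi>\<bar> < \<alpha>" shows "set_integrable lborel {0<..} (\<lambda>x. mnorm (left_potential V (cis \<phi> * of_real x)))"
proof -
  have "integrable lborel (\<lambda>x. mnorm (V (cis \<phi> * of_real (0 + -1 * x))))"
    by (rule lborel_integrable_real_affine [OF integrable_ray [OF assms]]) simp
  then have "integrable lborel (\<lambda>x. mnorm (left_potential V (cis \<phi> * of_real x)))"
    by (simp add: left_potential_def)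
  then show ?thesis unfolding set_integrable_def by (rule integrable_mult_indicator [rotated]) simp
qed

lemma ray_norm_split:
  assumes "\<bar>\<phi>\<bar> < \<alpha>" shows "ray_norm V \<phi> = half_norm V \<phi> + half_norm (left_potential V) \<phi>"
proof -
  let ?f = "\<lambda>x. mnorm (V (cis \<phi> * of_real x))"
  have si: "integrable lborel (\<lambda>x. indicat_real A x * ?f x)" if "A \<in> sets borel" for A
    using integrable_mult_indicator [OF _ integrable_ray [OF assms], of A] that by simp
  have "ray_norm V \<phi> = (LINT x|lborel. indicat_real {0<..} x * ?f x + indicat_real {..<0} x * ?f x)"
    unfolding ray_norm_def
  proof (rule integral_cong_AE)
    show "AE x in lborel. ?f x = indicat_real {0<..} x * ?f x + indicat_real {..<0} x * ?f x"
      using AE_lborel_singleton [of 0] by eventually_elim (auto simp: indicator_def)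
  qed (use integrable_ray [OF assms] si in auto)
  also have "\<dots> = (LINT x|lborel. indicat_real {0<..} x * ?f x) + (LINT x|lborel. indicat_real {..<0} x * ?f x)"
    by (rule Bochner_Integration.integral_add) (auto intro: si)
  finally show ?thesis
    using left_integral [of \<phi>] by (simp add: half_norm_def set_lebesgue_integral_def)
qed

lemma half_norm_le_ray_norm:
  assumes "\<bar>\<phi>\<bar> < \<alpha>"
  shows "half_norm V \<phi> \<le> ray_norm V \<phi>" "half_norm (left_potential V) \<phi> \<le> ray_norm V \<phi>"
  using ray_norm_split [OF assms] half_norm_nonneg [of V \<phi>] half_norm_nonneg [of "left_potential V" \<phi>] by auto

lemma ray_norm_locally_bounded:
  assumes "0 < \<beta>" "\<beta> < \<alpha>" obtains C where "\<And>\<phi>. \<bar>\<phi>\<bar> \<le> \<beta> \<Longrightarrow> ray_norm V \<phi> \<le> C"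
  using adm assms unfolding admissible_potential_def by blast

lemma half_potential_right: "half_potential \<alpha> V"
proof
  have sub: "sector \<alpha> \<subseteq> double_sector \<alpha>" by (auto simp: double_sector_def)
  show "(\<lambda>z. V z $ i $ j) holomorphic_on sector \<alpha>" for i j
    using adm sub unfolding admissible_potential_def by (meson analytic_imp_holomorphic holomorphic_on_subset)
  show "set_integrable lborel {0<..} (\<lambda>x. mnorm (V (cis \<phi> * of_real x)))" if "\<bar>\<phi>\<bar> < \<alpha>" for \<phi>
    unfolding set_integrable_def by (rule integrable_mult_indicator [OF _ integrable_ray [OF that]]) simp
  show "bounded (V ` sector \<alpha>)"
    using adm sub unfolding admissible_potential_def by (meson bounded_subset image_mono)
  show "V (of_real x) $ i $ j = cnj (V (of_real x) $ j $ i)" if "0 < x" for x i j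
    using adm that unfolding admissible_potential_def by (metis less_irrefl)
  show "\<exists>C. \<forall>\<phi>. \<bar>\<phi>\<bar> \<le> \<beta> \<longrightarrow> half_norm V \<phi> \<le> C" if \<beta>: "0 < \<beta>" "\<beta> < \<alpha>" for \<beta>
  proof -
    obtain C where C: "\<And>\<phi>. \<bar>\<phi>\<bar> \<le> \<beta> \<Longrightarrow> ray_norm V \<phi> \<le> C"
      using ray_norm_locally_bounded [OF \<beta>] by blast
    have "half_norm V \<phi> \<le> C" if "\<bar>\<phi>\<bar> \<le> \<beta>" for \<phi>
      using half_norm_le_ray_norm(1) [of \<phi>] C [OF that] that \<open>\<beta> < \<alpha>\<close> by linarith
    then show ?thesis by blast
  qed
qed (use \<alpha> in auto)

lemma half_potential_left: "half_potential \<alpha> (left_potential V)"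
proof
  have sub: "uminus ` sector \<alpha> \<subseteq> double_sector \<alpha>" by (auto simp: double_sector_def)
  show "(\<lambda>z. left_potential V z $ i $ j) holomorphic_on sector \<alpha>" for i j
  proof -
    have "(\<lambda>z. V z $ i $ j) holomorphic_on uminus ` sector \<alpha>"
      using adm sub unfolding admissible_potential_def by (meson analytic_imp_holomorphic holomorphic_on_subset)
    then have "(\<lambda>z. V z $ i $ j) \<circ> uminus holomorphic_on sector \<alpha>"
      by (intro holomorphic_on_compose holomorphic_intros)
    then show ?thesis
      unfolding left_potential_def conj_sigma3_def by (auto simp: o_def intro!: holomorphic_intros)
  qed
  show "bounded (left_potential V ` sector \<alpha>)"
  proof -
    obtain C where C: "\<And>\<zeta>. \<zeta> \<in> double_sector \<alpha> \<Longrightarrow> norm (V \<zeta>) \<le> C"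
      using adm by (auto simp: admissible_potential_def bounded_iff)
    then show ?thesis using sub by (auto simp: bounded_iff left_potential_def intro!: exI [of _ C])
  qed
  show "left_potential V (of_real x) $ i $ j = cnj (left_potential V (of_real x) $ j $ i)" if "0 < x" for x i j
  proof -
    have "V (of_real (- x)) $ i $ j = cnj (V (of_real (- x)) $ j $ i)"
      using adm that unfolding admissible_potential_def by (metis neg_equal_0_iff_equal less_irrefl)
    then show ?thesis by (auto simp: left_potential_def conj_sigma3_def)
  qed
  show "\<exists>C. \<forall>\<phi>. \<bar>\<phi>\<bar> \<le> \<beta> \<longrightarrow> half_norm (left_potential V) \<phi> \<le> C" if \<beta>: "0 < \<beta>" "\<beta> < \<alpha>" for \<beta>
  proof -
    obtain C where C: "\<And>\<phi>. \<bar>\<phi>\<bar> \<le> \<beta> \<Longrightarrow> ray_norm V \<phi> \<le> C"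
      using ray_norm_locally_bounded [OF \<beta>] by blast
    have "half_norm (left_potential V) \<phi> \<le> C" if "\<bar>\<phi>\<bar> \<le> \<beta>" for \<phi>
      using half_norm_le_ray_norm(2) [of \<phi>] C [OF that] that \<open>\<beta> < \<alpha>\<close> by linarith
    then show ?thesis by blast
  qed
qed (use \<alpha> left_set_integrable in auto)

lemma ray_norm_convex: "convex_on {-\<alpha><..<\<alpha>} (ray_norm V)"
proof -
  have "convex_on {-\<alpha><..<\<alpha>} (\<lambda>\<phi>. half_norm V \<phi> + half_norm (left_potential V) \<phi>)"
    by (intro convex_on_add half_potential.half_norm_convex half_potential_right half_potential_left)
  then show ?thesis
    unfolding convex_on_def by (smt (verit) convexD_alt ray_norm_split abs_less_iff greaterThanLessThan_iff convex_def)
qed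

lemma ray_norm_continuous: "continuous_on {-\<alpha><..<\<alpha>} (ray_norm V)"
  by (rule convex_on_continuous [OF open_greaterThanLessThan ray_norm_convex])

lemma ray_norm_even: "\<bar>\<phi>\<bar> < \<alpha> \<Longrightarrow> ray_norm V (- \<phi>) = ray_norm V \<phi>"
  by (simp add: ray_norm_split half_potential.half_norm_even [OF half_potential_right]
      half_potential.half_norm_even [OF half_potential_left])

lemma ray_norm_mono:
  assumes "0 \<le> \<phi>" "\<phi> \<le> \<psi>" "\<psi> < \<alpha>" shows "ray_norm V \<phi> \<le> ray_norm V \<psi>"
proof (cases "\<psi> = 0")
  case False
  then have \<psi>: "0 < \<psi>" using assms by simp
  \<comment> \<open>The weight that writes \<phi> as a convex combination of -\<psi> and \<psi>,
    where the norms agree by evenness.\<close>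
  define t where "t = (1 + \<phi> / \<psi>) / 2"
  have t: "0 \<le> t" "t \<le> 1" using assms \<psi> by (auto simp: t_def field_simps)
  have "\<phi> = (1 - t) *\<^sub>R (- \<psi>) + t *\<^sub>R \<psi>" using \<psi> by (simp add: t_def field_simps)
  then have "ray_norm V \<phi> \<le> (1 - t) * ray_norm V (- \<psi>) + t * ray_norm V \<psi>"
    using convex_onD [OF ray_norm_convex, of t "- \<psi>" \<psi>] t assms \<psi> by simp
  then show ?thesis using ray_norm_even [of \<psi>] assms by (simp add: algebra_simps)
qed (use assms in simp)

text \<open>At the thresholds this carries the vanishing of the potential from the given ray to the
  ray of the eigenfunction.\<close>

lemma ray_norm_zero:
  assumes "0 \<le> a" "a < \<alpha>" "0 \<le> b" "b < \<alpha>" "ray_norm V a = 0" shows "ray_norm V b = 0"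
proof (cases "b \<le> a")
  case True
  then show ?thesis using ray_norm_mono [of b a] ray_norm_nonneg [of V b] assms by simp
next
  case False
  have "half_norm V a = 0" "half_norm (left_potential V) a = 0"
    using half_norm_le_ray_norm [of a] half_norm_nonneg [of V a] half_norm_nonneg [of "left_potential V" a] assms by auto
  then have "half_norm V b = 0" "half_norm (left_potential V) b = 0"
    using half_potential.half_norm_zero [OF half_potential_right, of a b]
      half_potential.half_norm_zero [OF half_potential_left, of a b] False assms by auto
  then show ?thesis using ray_norm_split [of b] assms by simp
qed

lemma v_inf_eq:
  assumes "0 \<le> Im \<theta>" "Im \<theta> < \<alpha>" shows "v_inf \<alpha> V \<theta> = ray_norm V (Im \<theta>)"
  unfolding v_inf_def
proof (rule antisym)
  show "(INF \<phi>\<in>{Im \<theta>..<\<alpha>}. ray_norm V \<phi>) \<le> ray_norm V (Im \<theta>)"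
    using assms ray_norm_nonneg by (intro cINF_lower bdd_belowI2) auto
  show "ray_norm V (Im \<theta>) \<le> (INF \<phi>\<in>{Im \<theta>..<\<alpha>}. ray_norm V \<phi>)"
    using assms ray_norm_mono by (intro cINF_greatest) auto
qed

text \<open>The half-lines are rotated separately, the left one after reflection, and glued to a
  bounded solution on the ray of angle \<psi>. Boundedness suffices for the gap because Im
  (\<open>cis \<psi> * \<kappa>\<close>) > 0 damps the boundary terms.\<close>

lemma continuation_gap:
  assumes \<theta>: "0 < Im \<theta>" "Im \<theta> < \<alpha>" and eig: "is_eigenvalue (dirac m V \<theta>) z"
    and \<kappa>: "\<kappa>\<^sup>2 = z\<^sup>2 - (of_real m)\<^sup>2" "\<kappa> \<noteq> 0"
    and \<psi>0: "0 \<le> \<psi>0" "Im (cis \<psi>0 * \<kappa>) = 0" and \<psi>: "\<psi>0 < \<psi>" "\<psi> \<le> Im \<theta>" "0 < Im (cis \<psi> * \<kappa>)"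
  shows "1 + 3 / 128 * (1 - mode_angle m z \<kappa>) \<le> kernel_norm m z \<kappa> * ray_norm V \<psi>"
proof -
  let ?\<phi> = "Im \<theta>"
  have \<phi>: "\<bar>?\<phi>\<bar> < \<alpha>" "\<alpha> < pi" using \<theta> \<alpha> by auto
  obtain F x0 where F: "continuous_on UNIV F" "(F \<longlongrightarrow> 0) at_infinity" "F x0 \<noteq> 0"
    "\<And>x. x \<noteq> 0 \<Longrightarrow> dirac_ode m z (cis ?\<phi>) (\<lambda>x. V (cis ?\<phi> * of_real x)) F x"
    using eigenfunction_ode [OF adm \<phi> eig] by blast
  have Fc: "isCont F x" for x using F(1) by (simp add: continuous_on_eq_continuous_at)
  obtain Bf where Bf: "\<And>x. norm (F x) \<le> Bf"
    using vanishing_at_infinity_bounded [OF F(1,2)] by blast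
  define Fl where "Fl = (\<lambda>x. sigma3 *v F (- x))"
  have Fl: "dirac_ode m z (cis ?\<phi>) (\<lambda>x. left_potential V (cis ?\<phi> * of_real x)) Fl x" if "0 < x" for x
    using dirac_ode_reflect [OF F(4), of x] that by (simp add: Fl_def left_potential_def)
  have ang: "-\<alpha> < \<psi>0" "\<psi>0 \<le> \<psi>" "\<psi> \<le> ?\<phi>" "?\<phi> < \<alpha>" "?\<phi> - \<psi>0 < pi / 2"
    using \<theta> \<psi>0 \<psi> \<alpha> by auto
  interpret R: half_potential \<alpha> V by (rule half_potential_right)
  interpret L: half_potential \<alpha> "left_potential V" by (rule half_potential_left)
  have F0: "(F \<longlongrightarrow> F 0) (at_right 0)" using Fc [of 0] by (simp add: isCont_def filterlim_at_split)
  have "isCont Fl 0"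
    unfolding Fl_def sigma3_mult
    by (intro isCont_vec2) (simp_all add: vector_2, (intro continuous_intros isCont_o2 [OF _ Fc]; simp)+)
  then have Fl0: "(Fl \<longlongrightarrow> Fl 0) (at_right 0)" by (simp add: isCont_def filterlim_at_split)
  have Bl: "norm (Fl x) \<le> Bf" for x using Bf by (simp add: Fl_def)
  have Fr: "dirac_ode m z (cis ?\<phi>) (\<lambda>x. V (cis ?\<phi> * of_real x)) F x" if "0 < x" for x
    using F(4) that by simp
  have "\<exists>H B. (\<forall>x>0. dirac_ode m z (cis \<psi>) (\<lambda>x. V (cis \<psi> * of_real x)) H x) \<and>
      (\<forall>x>0. norm (H x) \<le> B) \<and> (H \<longlongrightarrow> F 0) (at_right 0) \<and> ((\<forall>x>0. H x = 0) \<longrightarrow> (\<forall>x>0. F x = 0))"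
  proof (rule R.half_line_continuation [OF \<kappa> \<psi>0(2) ang Fr Bf F0], goal_cases)
    case (2 H B)
    then show ?case by (intro exI [of _ H] exI [of _ B]) auto
  qed simp
  then obtain Hr Br where Hr: "\<forall>x>0. dirac_ode m z (cis \<psi>) (\<lambda>x. V (cis \<psi> * of_real x)) Hr x"
    "\<forall>x>0. norm (Hr x) \<le> Br" "(Hr \<longlongrightarrow> F 0) (at_right 0)"
    "(\<forall>x>0. Hr x = 0) \<longrightarrow> (\<forall>x>0. F x = 0)"
    by (elim exE conjE) (rule that)
  note Hr_ode = Hr(1) [rule_format] and Hr_bound = Hr(2) [rule_format]
  have "\<exists>H B. (\<forall>x>0. dirac_ode m z (cis \<psi>) (\<lambda>x. left_potential V (cis \<psi> * of_real x)) H x) \<and>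
      (\<forall>x>0. norm (H x) \<le> B) \<and> (H \<longlongrightarrow> Fl 0) (at_right 0) \<and> ((\<forall>x>0. H x = 0) \<longrightarrow> (\<forall>x>0. Fl x = 0))"
  proof (rule L.half_line_continuation [OF \<kappa> \<psi>0(2) ang Fl Bl Fl0], goal_cases)
    case (2 H B)
    then show ?case by (intro exI [of _ H] exI [of _ B]) auto
  qed simp
  then obtain Hl Cl where Hl: "\<forall>x>0. dirac_ode m z (cis \<psi>) (\<lambda>x. left_potential V (cis \<psi> * of_real x)) Hl x"
    "\<forall>x>0. norm (Hl x) \<le> Cl" "(Hl \<longlongrightarrow> Fl 0) (at_right 0)"
    "(\<forall>x>0. Hl x = 0) \<longrightarrow> (\<forall>x>0. Fl x = 0)"
    by (elim exE conjE) (rule that)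
  note Hl_ode = Hl(1) [rule_format] and Hl_bound = Hl(2) [rule_format]
  \<comment> \<open>The value at 0 is that of the eigenfunction; both one-sided limits equal it,
    which gives the continuity at 0 that the gap estimate requires.\<close>
  define G where "G = (\<lambda>x. if 0 < x then Hr x else if x < 0 then sigma3 *v Hl (- x) else F 0)"
  have Gode: "dirac_ode m z (cis \<psi>) (\<lambda>x. V (cis \<psi> * of_real x)) G x" if "x \<noteq> 0" for x
  proof (cases "0 < x")
    case True
    show ?thesis
      by (rule dirac_ode_transform [OF Hr_ode [OF True] open_greaterThan [of 0]]) (use True in \<open>auto simp: G_def\<close>)
  next
    case False
    then have x: "x < 0" using that by simp
    have "dirac_ode m z (cis \<psi>) (\<lambda>x. conj_sigma3 (left_potential V (cis \<psi> * of_real (- x)))) (\<lambda>x. sigma3 *v Hl (- x)) x"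
      using dirac_ode_reflect [OF Hl_ode, of x] x by simp
    then have "dirac_ode m z (cis \<psi>) (\<lambda>x. V (cis \<psi> * of_real x)) (\<lambda>x. sigma3 *v Hl (- x)) x"
      by (rule dirac_ode_cong) (simp add: left_potential_def)
    then show ?thesis
      by (rule dirac_ode_transform [OF _ open_lessThan [of 0]]) (use x in \<open>auto simp: G_def\<close>)
  qed
  have G0: "G 0 = F 0" by (simp add: G_def)
  have "(G \<longlongrightarrow> G 0) (at_right 0)"
    unfolding G0 using Hr(3)
    by (rule Lim_transform_eventually) (auto simp: G_def eventually_at_filter)
  moreover have "(G \<longlongrightarrow> G 0) (at_left 0)"
  proof -
    have "((\<lambda>x. Hl (- x)) \<longlongrightarrow> Fl 0) (at_left 0)"
      using Hl(3) by (simp add: filterlim_at_left_to_right)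
    then have "((\<lambda>x. sigma3 *v Hl (- x)) \<longlongrightarrow> sigma3 *v Fl 0) (at_left 0)"
      by (rule bounded_linear.tendsto [OF bounded_linear_matrix_vector])
    then have "((\<lambda>x. sigma3 *v Hl (- x)) \<longlongrightarrow> G 0) (at_left 0)" by (simp add: G0 Fl_def)
    then show ?thesis
      by (rule Lim_transform_eventually) (auto simp: G_def eventually_at_filter)
  qed
  ultimately have "isCont G 0" by (simp add: isCont_def filterlim_at_split)
  then have Gc: "continuous_on UNIV G"
    using Gode dirac_ode_isCont by (metis continuous_at_imp_continuous_on)
  have Gb: "norm (G x) \<le> max (max Br Cl) Bf" for x
    using Hr_bound [of x] Hl_bound [of "- x"] Bf [of 0] by (auto simp: G_def)
  \<comment> \<open>Each half carries its own implication: if \<open>G\<close> vanished,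
    \<open>F\<close> would vanish on both half-lines and at 0.\<close>
  have "\<exists>x. G x \<noteq> 0"
  proof (rule ccontr)
    assume "\<not> ?thesis"
    then have Gz: "G x = 0" for x by blast
    have "Hr x = 0" if "0 < x" for x using Gz [of x] that by (simp add: G_def)
    then have 1: "F x = 0" if "0 < x" for x using Hr(4) that by blast
    have "Hl x = 0" if "0 < x" for x
      using Gz [of "- x"] that sigma3_invol [of "Hl x"] by (simp add: G_def)
    then have "Fl x = 0" if "0 < x" for x using Hl(4) that by blast
    then have 2: "F x = 0" if "x < 0" for x
      using that sigma3_invol [of "F x"] by (metis Fl_def matrix_vector_mult_0_right neg_0_less_iff_less minus_minus)
    have "F 0 = 0" using Gz [of 0] G0 by simp
    then show False using F(3) 1 2 by (metis linorder_neqE_linordered_idom)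
  qed
  then obtain xx where "G xx \<noteq> 0" by blast
  have \<psi>a: "\<bar>\<psi>\<bar> < \<alpha>" using ang \<psi>0 by auto
  have "1 + 3 / 128 * (1 - mode_angle m z \<kappa>)
      \<le> kernel_norm m z \<kappa> * (LINT x|lborel. mnorm (V (cis \<psi> * of_real x)))"
    by (rule birman_schwinger_gap [OF \<kappa> _ _ admissible_integrable [OF adm \<psi>a] Gc Gb Gode _ \<open>G xx \<noteq> 0\<close>])
      (use \<psi>(3) in auto)
  then show ?thesis by (simp add: ray_norm_def)
qed

end

section \<open>Localisation of eigenvalues and resonances\<close>

text \<open>For m = 1 the boundary circle meets the real axis in s and 1 / s. The positivity of x -
  r and the identity x^2 - r^2 = 1 are read off from this form.\<close>

lemma x_r_of:
  assumes v: "0 \<le> v" "v < 1"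
  defines "s \<equiv> sqrt (1 - v\<^sup>2)"
  shows "0 < s" "s \<le> 1" "s\<^sup>2 = 1 - v\<^sup>2" "x_of v = (1 / s + s) / 2" "r_of v = (1 / s - s) / 2"
proof -
  have v2: "v\<^sup>2 < 1" using v by (simp add: power_less_one_iff abs_square_less_1)
  then show s: "0 < s" and s1: "s \<le> 1" and s2: "s\<^sup>2 = 1 - v\<^sup>2" by (simp_all add: s_def)
  have v4: "v ^ 4 - 2 * v\<^sup>2 + 2 = (s\<^sup>2)\<^sup>2 + 1"
    unfolding s2 by (simp add: power2_eq_square power4_eq_xxxx algebra_simps)
  have frac: "(v ^ 4 - 2 * v\<^sup>2 + 2) / (4 * (1 - v\<^sup>2)) = ((1 / s)\<^sup>2 + s\<^sup>2) / 4"
    unfolding v4 s2 [symmetric] using s by (simp add: field_simps power2_eq_square)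
  have "((1 / s)\<^sup>2 + s\<^sup>2) / 4 + 1 / 2 = ((1 / s + s) / 2)\<^sup>2" "((1 / s)\<^sup>2 + s\<^sup>2) / 4 - 1 / 2 = ((1 / s - s) / 2)\<^sup>2"
    using s by (simp_all add: power2_eq_square field_simps)
  moreover have "s \<le> 1 / s" using s s1 by (simp add: le_divide_eq mult_le_one)
  ultimately show "x_of v = (1 / s + s) / 2" "r_of v = (1 / s - s) / 2"
    unfolding x_of_def r_of_def frac using s by simp_all
qed

lemma x_minus_r_nonneg:
  assumes "0 \<le> v" "v < 1" shows "0 < x_of v - r_of v" "0 \<le> r_of v"
proof -
  let ?s = "sqrt (1 - v\<^sup>2)"
  note x = x_r_of [OF assms]
  have "x_of v - r_of v = ?s" unfolding x(4,5) by (simp add: field_simps)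
  then show "0 < x_of v - r_of v" using x(1) by simp
  have "?s \<le> 1 / ?s" using x(1,2) by (simp add: le_divide_eq mult_le_one)
  then show "0 \<le> r_of v" unfolding x(5) by simp
qed

text \<open>The disks are Apollonius disks: with \<open>P = |z + m|\<close> and \<open>Q = |z - m|\<close>, membership is a bound on
  \<open>P / Q\<close> from below, or from above.\<close>

lemma Apollonius_disk_aux:
  assumes v: "0 \<le> v" "v < 1" and m: "0 \<le> m" and PQ: "cmod (z - of_real m) \<le> cmod (z + of_real m)"
    and less: "4 * (cmod (z + of_real m) * cmod (z - of_real m)) < (cmod (z + of_real m) + cmod (z - of_real m))\<^sup>2 * v\<^sup>2"
  shows "cmod (z - of_real (m * x_of v)) < m * r_of v"
proof -
  define s where "s = sqrt (1 - v\<^sup>2)"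
  note x = x_r_of [OF v, folded s_def]
  \<comment> \<open>In the sum \<open>a\<close> and the difference \<open>b\<close> of the distances
    to -m and m, the hypothesis becomes s a < b.\<close>
  define a b where "a = cmod (z + of_real m) + cmod (z - of_real m)" and "b = cmod (z + of_real m) - cmod (z - of_real m)"
  have ab: "a\<^sup>2 = b\<^sup>2 + 4 * (cmod (z + of_real m) * cmod (z - of_real m))"
    by (simp add: a_def b_def power2_eq_square algebra_simps)
  have b0: "0 \<le> b" "b \<le> a" using PQ by (auto simp: a_def b_def)
  have "(s * a)\<^sup>2 < b\<^sup>2"
    using less ab unfolding a_def [symmetric] power_mult_distrib x(3) by (simp add: algebra_simps)
  then have sab: "s * a < b" using b0 by (simp add: power2_less_imp_less)
  have "s < 1"
  proof (rule ccontr)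
    assume "\<not> s < 1"
    then have "s = 1" using x(2) by simp
    then show False using sab b0 by simp
  qed
  have "0 \<le> s * a" using x(1) b0 by simp
  then have "0 < b" using sab by linarith
  then have "s * b < 1 * b" using \<open>s < 1\<close> by (intro mult_strict_right_mono)
  \<comment> \<open>The second positive factor makes the inequality symmetric in \<open>a\<close>
    and \<open>b\<close>; a^2 + b^2 and a b are polynomials in |z|^2, m and Re z, so the square
    roots disappear.\<close>
  then have "0 < (b - s * a) * (a - s * b)" using sab b0 by (intro mult_pos_pos) auto
  then have key: "(a\<^sup>2 + b\<^sup>2) * s < (1 + s\<^sup>2) * (a * b)" by (simp add: power2_eq_square algebra_simps)
  have P2: "(cmod (z + of_real m))\<^sup>2 = (cmod z)\<^sup>2 + m\<^sup>2 + 2 * m * Re z"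
    "(cmod (z - of_real m))\<^sup>2 = (cmod z)\<^sup>2 + m\<^sup>2 - 2 * m * Re z"
    unfolding cmod_power2 by (simp_all add: power2_eq_square algebra_simps)
  have "a\<^sup>2 + b\<^sup>2 = 2 * (cmod (z + of_real m))\<^sup>2 + 2 * (cmod (z - of_real m))\<^sup>2"
    "a * b = (cmod (z + of_real m))\<^sup>2 - (cmod (z - of_real m))\<^sup>2"
    by (simp_all add: a_def b_def power2_eq_square algebra_simps)
  then have sums: "a\<^sup>2 + b\<^sup>2 = 4 * ((cmod z)\<^sup>2 + m\<^sup>2)" "a * b = 4 * (m * Re z)" unfolding P2 by auto
  have "((cmod z)\<^sup>2 + m\<^sup>2) * s < (1 + s\<^sup>2) * (m * Re z)" 
  proof -
    have "4 * ((cmod z)\<^sup>2 + m\<^sup>2) * s = 4 * (((cmod z)\<^sup>2 + m\<^sup>2) * s)"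
      "(1 + s\<^sup>2) * (4 * (m * Re z)) = 4 * ((1 + s\<^sup>2) * (m * Re z))" by simp_all
    then show ?thesis using key unfolding sums by linarith
  qed
  then have "(cmod z)\<^sup>2 + m\<^sup>2 < (1 + s\<^sup>2) * (m * Re z) / s" using x(1) by (simp add: pos_less_divide_eq)
  also have "\<dots> = 2 * x_of v * (m * Re z)" unfolding x(4) using x(1) by (simp add: field_simps power2_eq_square)
  finally have 1: "(cmod z)\<^sup>2 + m\<^sup>2 < 2 * x_of v * (m * Re z)" .
  have xr: "(x_of v)\<^sup>2 - (r_of v)\<^sup>2 = 1" unfolding x(4,5) using x(1) by (simp add: field_simps power2_eq_square)
  have "(cmod (z - of_real (m * x_of v)))\<^sup>2 = (cmod z)\<^sup>2 - 2 * x_of v * (m * Re z) + m\<^sup>2 * (x_of v)\<^sup>2"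
    unfolding cmod_power2 by (simp add: power2_eq_square algebra_simps)
  also have "\<dots> < m\<^sup>2 * ((x_of v)\<^sup>2 - 1)" using 1 by (simp add: algebra_simps)
  also have "\<dots> = (m * r_of v)\<^sup>2" using xr by (simp add: power_mult_distrib)
  finally show ?thesis
    by (rule power2_less_imp_less) (use m x_minus_r_nonneg [OF v] in simp)
qed

text \<open>The map z \<mapsto> - z exchanges the two distances and the two disks.\<close>

lemma Apollonius_disk:
  assumes v: "0 \<le> v" "v < 1" and m: "0 \<le> m"
    and less: "4 * (cmod (z + of_real m) * cmod (z - of_real m)) < (cmod (z + of_real m) + cmod (z - of_real m))\<^sup>2 * v\<^sup>2"
  shows "cmod (z - of_real (m * x_of v)) < m * r_of v \<or> cmod (z - of_real (- (m * x_of v))) < m * r_of v"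
proof (cases "cmod (z - of_real m) \<le> cmod (z + of_real m)")
  case True
  then show ?thesis using Apollonius_disk_aux [OF v m True less] by simp
next
  case False
  have sw: "cmod (- z - of_real m) = cmod (z + of_real m)" "cmod (- z + of_real m) = cmod (z - of_real m)"
    using norm_minus_cancel [of "z + of_real m"] norm_minus_commute [of z "of_real m"] by auto
  have "cmod (- z - of_real (m * x_of v)) < m * r_of v"
  proof (rule Apollonius_disk_aux [OF v m])
    show "cmod (- z - of_real m) \<le> cmod (- z + of_real m)" unfolding sw using False by linarith
    show "4 * (cmod (- z + of_real m) * cmod (- z - of_real m))
        < (cmod (- z + of_real m) + cmod (- z - of_real m))\<^sup>2 * v\<^sup>2"
      unfolding sw using less by (simp add: mult.commute add.commute)
  qed
  also have "cmod (- z - of_real (m * x_of v)) = cmod (z - of_real (- (m * x_of v)))"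
    using norm_minus_cancel [of "z + of_real (m * x_of v)"] by simp
  finally show ?thesis by simp
qed

text \<open>The mode vectors are not parallel, that is \<open>mode_angle m z \<kappa>\<close> < 1,
  so the gap gives n(z) v > 1 strictly; squaring removes the root and with it the choice of
  \<kappa>.\<close>

lemma kernel_norm_gap:
  assumes \<kappa>: "\<kappa>\<^sup>2 = z\<^sup>2 - (of_real m)\<^sup>2" "\<kappa> \<noteq> 0"
    and gap: "1 + 3 / 128 * (1 - mode_angle m z \<kappa>) \<le> kernel_norm m z \<kappa> * v"
  shows "4 * (cmod (z + of_real m) * cmod (z - of_real m)) < (cmod (z + of_real m) + cmod (z - of_real m))\<^sup>2 * v\<^sup>2"
proof -
  define P Q k where "P = cmod (z + of_real m)" and "Q = cmod (z - of_real m)" and "k = cmod \<kappa>"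
  have "0 < P" "0 < k" using z_plus_m_nonzero [OF \<kappa>] \<kappa> by (auto simp: P_def k_def)
  have "cmod (\<kappa>\<^sup>2) = cmod ((z + of_real m) * (z - of_real m))"
    unfolding \<kappa> by (simp add: power2_eq_square algebra_simps)
  then have kPQ: "k\<^sup>2 = P * Q" by (simp add: k_def P_def Q_def norm_mult norm_power)
  have "\<bar>P\<^sup>2 - k\<^sup>2\<bar> < P\<^sup>2 + k\<^sup>2" using \<open>0 < P\<close> \<open>0 < k\<close> by (simp add: abs_less_iff)
  then have "mode_angle m z \<kappa> < 1"
    using \<open>0 < P\<close> \<open>0 < k\<close> unfolding mode_angle_def P_def [symmetric] k_def [symmetric]
    by (simp add: divide_less_eq)
  then have "0 < 3 / 128 * (1 - mode_angle m z \<kappa>)" by simp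
  then have "1 < kernel_norm m z \<kappa> * v" using gap by linarith
  also have "kernel_norm m z \<kappa> = (P + Q) / (2 * k)"
    using kPQ \<open>0 < P\<close> \<open>0 < k\<close> unfolding kernel_norm_def P_def [symmetric] k_def [symmetric]
    by (simp add: field_simps power2_eq_square)
  finally have "2 * k < (P + Q) * v" using \<open>0 < k\<close> by (simp add: field_simps)
  then have "(2 * k)\<^sup>2 < ((P + Q) * v)\<^sup>2" using \<open>0 < k\<close> by (intro power_strict_mono) auto
  then show ?thesis using kPQ by (simp add: power_mult_distrib P_def Q_def)
qed

lemma vanishing_at_infinity_const:
  fixes c :: "real \<Rightarrow> complex"
  assumes "\<And>a b. a \<le> b \<Longrightarrow> c b = c a" "(c \<longlongrightarrow> 0) at_infinity" shows "c x = 0"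
proof -
  have "c = (\<lambda>_. c x)" using assms(1) by (metis linear)
  then have "((\<lambda>_::real. c x) \<longlongrightarrow> 0) at_infinity" using assms(2) by simp
  from tendsto_unique [OF trivial_limit_at_infinity tendsto_const this] show ?thesis .
qed

section \<open>Eigenvalue estimates, thresholds and reality\<close>

context
  fixes \<alpha> :: real and V :: "complex \<Rightarrow> complex^2^2"
  assumes \<alpha>: "0 < \<alpha>" "\<alpha> < pi / 2" and adm: "admissible_potential \<alpha> V"
begin

lemma continuous_on_ray:
  assumes "\<bar>\<phi>\<bar> < \<alpha>" "0 \<notin> S" shows "continuous_on S (\<lambda>x. V (cis \<phi> * of_real x))"
  by (intro continuous_on_compose2 [OF admissible_continuous [OF adm]] continuous_intros)
    (use assms \<alpha> in \<open>auto intro!: double_sector_rcis\<close>)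

lemma integral_le_ray_norm:
  assumes "\<bar>\<phi>\<bar> < \<alpha>"
  shows "(\<lambda>x. mnorm (V (cis \<phi> * of_real x))) integrable_on {a..b}"
    "integral {a..b} (\<lambda>x. mnorm (V (cis \<phi> * of_real x))) \<le> ray_norm V \<phi>"
proof -
  note int = integrable_ray [OF \<alpha> adm assms]
  have si: "set_integrable lborel {a..b} (\<lambda>x. mnorm (V (cis \<phi> * of_real x)))"
    unfolding set_integrable_def by (rule integrable_mult_indicator [OF _ int]) simp
  then show "(\<lambda>x. mnorm (V (cis \<phi> * of_real x))) integrable_on {a..b}"
    by (rule set_borel_integral_eq_integral)
  have "integral {a..b} (\<lambda>x. mnorm (V (cis \<phi> * of_real x))) = (LINT x:{a..b}|lborel. mnorm (V (cis \<phi> * of_real x)))"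
    by (rule set_borel_integral_eq_integral(2) [OF si, symmetric])
  also have "\<dots> \<le> ray_norm V \<phi>"
    unfolding ray_norm_def set_lebesgue_integral_def
    by (rule integral_mono [OF _ int]) (use si in \<open>auto simp: set_integrable_def indicator_def\<close>)
  finally show "integral {a..b} (\<lambda>x. mnorm (V (cis \<phi> * of_real x))) \<le> ray_norm V \<phi>" .
qed

lemma eigenfunction_bounded:
  assumes \<theta>: "\<bar>Im \<theta>\<bar> < \<alpha>" and eig: "is_eigenvalue (dirac m V \<theta>) z"
  obtains F x0 B where "continuous_on UNIV F" "(F \<longlongrightarrow> 0) at_infinity" "F x0 \<noteq> 0"
    "\<And>x. x \<noteq> 0 \<Longrightarrow> dirac_ode m z (cis (Im \<theta>)) (\<lambda>x. V (cis (Im \<theta>) * of_real x)) F x"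
    "\<And>x. norm (F x) \<le> B"
proof -
  have "\<alpha> < pi" using \<alpha> by simp
  then obtain F x0 where F: "continuous_on UNIV F" "(F \<longlongrightarrow> 0) at_infinity" "F x0 \<noteq> 0"
    "\<And>x. x \<noteq> 0 \<Longrightarrow> dirac_ode m z (cis (Im \<theta>)) (\<lambda>x. V (cis (Im \<theta>) * of_real x)) F x"
    using eigenfunction_ode [OF adm \<theta> _ eig] by blast
  obtain B where "\<And>x. norm (F x) \<le> B"
    using vanishing_at_infinity_bounded [OF F(1,2)] by blast
  with F show ?thesis by (rule that)
qed

text \<open>The sign of \<kappa> is chosen so that outgoing modes do not grow. The case of real
  \<kappa>\<zeta> is included because an eigenfunction tends to 0 at infinity; this is how embedded
  eigenvalues are covered.\<close>

lemma eigenvalue_gap: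
  assumes \<theta>: "\<bar>Im \<theta>\<bar> < \<alpha>" and eig: "is_eigenvalue (dirac m V \<theta>) z" and z: "z\<^sup>2 \<noteq> (of_real m)\<^sup>2"
  obtains \<kappa> where "\<kappa>\<^sup>2 = z\<^sup>2 - (of_real m)\<^sup>2" "\<kappa> \<noteq> 0"
    "1 + 3 / 128 * (1 - mode_angle m z \<kappa>) \<le> kernel_norm m z \<kappa> * ray_norm V (Im \<theta>)"
proof -
  define k where "k = csqrt (z\<^sup>2 - (of_real m)\<^sup>2)"
  define \<kappa> where "\<kappa> = (if 0 \<le> Im (cis (Im \<theta>) * k) then k else - k)"
  have \<kappa>: "\<kappa>\<^sup>2 = z\<^sup>2 - (of_real m)\<^sup>2" "\<kappa> \<noteq> 0" "0 \<le> Im (cis (Im \<theta>) * \<kappa>)"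
    using z by (auto simp: \<kappa>_def k_def)
  obtain F x0 B where F: "continuous_on UNIV F" "(F \<longlongrightarrow> 0) at_infinity" "F x0 \<noteq> 0"
    "\<And>x. x \<noteq> 0 \<Longrightarrow> dirac_ode m z (cis (Im \<theta>)) (\<lambda>x. V (cis (Im \<theta>) * of_real x)) F x"
    "\<And>x. norm (F x) \<le> B"
    using eigenfunction_bounded [OF \<theta> eig] by blast
  have "1 + 3 / 128 * (1 - mode_angle m z \<kappa>)
      \<le> kernel_norm m z \<kappa> * (LINT x|lborel. mnorm (V (cis (Im \<theta>) * of_real x)))"
    by (rule birman_schwinger_gap [OF \<kappa>(1,2) _ \<kappa>(3) admissible_integrable [OF adm \<theta>] F(1,5,4) _ F(3)])
      (use F(2) in auto)
  then show ?thesis using that \<kappa> by (simp add: ray_norm_def)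
qed

text \<open>For z = m = 0 only the potential drives the equation. As it is integrable, Gronwall
  makes |F|^2 comparable, up to one constant factor, at any two points of a half-line; decay at
  infinity then forces F = 0.\<close>

lemma zero_not_eigenvalue_massless:
  assumes \<theta>: "\<bar>Im \<theta>\<bar> < \<alpha>" shows "\<not> is_eigenvalue (dirac 0 V \<theta>) 0"
proof
  assume eig: "is_eigenvalue (dirac 0 V \<theta>) 0"
  define W where "W = (\<lambda>x::real. V (cis (Im \<theta>) * of_real x))"
  obtain F x0 where F: "continuous_on UNIV F" "(F \<longlongrightarrow> 0) at_infinity" "F x0 \<noteq> 0"
    "\<And>x. x \<noteq> 0 \<Longrightarrow> dirac_ode 0 0 (cis (Im \<theta>)) W F x"
    by (rule eigenfunction_bounded [OF \<theta> eig, folded W_def]) (rule that; assumption)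
  define E where "E = exp (2 * ray_norm V (Im \<theta>))"
  have cW: "continuous_on {a..b} W" if "0 \<notin> {a..b}" for a b
    unfolding W_def by (rule continuous_on_ray [OF \<theta> that])
  have IE: "exp (integral {a..b} (\<lambda>t. 2 * (cmod 0 + \<bar>0\<bar> + mnorm (W t)))) \<le> E" for a b
    using integral_le_ray_norm(2) [OF \<theta>, of a b] by (simp add: E_def W_def)
  have step: "(norm (F a))\<^sup>2 \<le> (norm (F b))\<^sup>2 * E \<and> (norm (F b))\<^sup>2 \<le> (norm (F a))\<^sup>2 * E"
    if ab: "a \<le> b" and 0: "0 \<notin> {a..b}" for a b
  proof -
    have ode: "dirac_ode 0 0 (cis (Im \<theta>)) W F t" if "a \<le> t" "t \<le> b" for t
      by (rule F(4)) (use 0 that in auto)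
    have "cmod (cis (Im \<theta>)) = 1" by simp
    note G = dirac_ode_Gronwall [OF ode this ab cW [OF 0]]
    show ?thesis
      using G(1) G(2) mult_left_mono [OF IE [of a b], of "(norm (F a))\<^sup>2"]
        mult_left_mono [OF IE [of a b], of "(norm (F b))\<^sup>2"] by simp
  qed
  have lim: "((\<lambda>x. (norm (F x))\<^sup>2 * E) \<longlongrightarrow> 0) at_infinity"
    using tendsto_mult_right [OF tendsto_power [OF tendsto_norm [OF F(2)], of 2], of E] by simp
  have nz: "F x = 0" if "x \<noteq> 0" for x
  proof -
    have "(norm (F x))\<^sup>2 \<le> 0 + e" if e: "0 < e" for e
    proof -
      have "\<forall>\<^sub>F y in at_infinity. (norm (F y))\<^sup>2 * E < e" using lim e by (rule order_tendstoD)
      then obtain R where R: "\<And>y. R \<le> \<bar>y\<bar> \<Longrightarrow> (norm (F y))\<^sup>2 * E < e"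
        by (auto simp: eventually_at_infinity)
      show ?thesis
      proof (cases "0 < x")
        case True
        then show ?thesis
          using step [of x "max x \<bar>R\<bar>"] R [of "max x \<bar>R\<bar>"] by fastforce
      next
        case False
        then show ?thesis
          using step [of "min x (- \<bar>R\<bar>)" x] R [of "min x (- \<bar>R\<bar>)"] \<open>x \<noteq> 0\<close> by fastforce
      qed
    qed
    then have "(norm (F x))\<^sup>2 \<le> 0" by (rule field_le_epsilon)
    then show ?thesis by simp
  qed
  have "isCont F 0" using F(1) by (simp add: continuous_on_eq_continuous_at)
  then have "(F \<longlongrightarrow> F 0) (at 0)" by (simp add: isCont_def)
  moreover have "(F \<longlongrightarrow> 0) (at 0)"
    by (rule tendsto_eventually) (use nz in \<open>auto simp: eventually_at_filter\<close>)
  ultimately have "F 0 = 0" by (rule tendsto_unique [rotated]) simp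
  then show False using nz F(3) by (cases "x0 = 0") auto
qed

text \<open>At z = m or z = -m the free system is triangular. One component has a derivative of zero
  integral, so it is constant and, by decay, zero; then the same holds for the other.\<close>

lemma threshold_not_eigenvalue_free:
  assumes \<theta>: "\<bar>Im \<theta>\<bar> < \<alpha>" and zero: "ray_norm V (Im \<theta>) = 0" and z: "z\<^sup>2 = (of_real m)\<^sup>2"
  shows "\<not> is_eigenvalue (dirac m V \<theta>) z"
proof
  assume eig: "is_eigenvalue (dirac m V \<theta>) z"
  define W where "W = (\<lambda>x::real. V (cis (Im \<theta>) * of_real x))"
  obtain F x0 B where F: "continuous_on UNIV F" "(F \<longlongrightarrow> 0) at_infinity" "F x0 \<noteq> 0"
    "\<And>x. x \<noteq> 0 \<Longrightarrow> dirac_ode m z (cis (Im \<theta>)) W F x" "\<And>x. norm (F x) \<le> B"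
    by (rule eigenfunction_bounded [OF \<theta> eig, folded W_def]) (rule that; assumption)
  have vanish: "F x $ i = 0"
    if d: "\<And>x. x \<noteq> 0 \<Longrightarrow> ((\<lambda>t. F t $ i) has_vector_derivative \<i> * cis (Im \<theta>) * (- (W x *v F x) $ j)) (at x)" for i j x
  proof (rule vanishing_at_infinity_const [where c = "\<lambda>t. F t $ i"])
    fix a b :: real assume ab: "a \<le> b"
    have "norm (F b $ i - F a $ i) \<le> integral {a..b} (\<lambda>x. B * mnorm (W x))"
    proof (rule norm_diff_le_integral [OF ab])
      show "continuous_on {a..b} (\<lambda>t. F t $ i)"
        by (intro continuous_intros continuous_on_subset [OF F(1)]) auto
      fix x :: real assume "x \<noteq> 0"
      then show "((\<lambda>t. F t $ i) has_vector_derivative \<i> * cis (Im \<theta>) * (- (W x *v F x) $ j)) (at x)" by (rule d)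
      have "cmod ((W x *v F x) $ j) \<le> norm (W x *v F x)" by (rule Finite_Cartesian_Product.norm_nth_le)
      also have "\<dots> \<le> mnorm (W x) * norm (F x)" by (rule mnorm_bound)
      also have "\<dots> \<le> mnorm (W x) * B" by (intro mult_left_mono F) simp
      finally show "norm (\<i> * cis (Im \<theta>) * (- (W x *v F x) $ j)) \<le> B * mnorm (W x)"
        by (simp add: norm_mult mult.commute)
    next
      show "(\<lambda>x. B * mnorm (W x)) integrable_on {a..b}"
        unfolding W_def by (intro integrable_on_mult_right integral_le_ray_norm \<theta>)
    qed
    also have "\<dots> = B * integral {a..b} (\<lambda>x. mnorm (W x))" by simp
    also have "\<dots> \<le> B * 0"
      using integral_le_ray_norm(2) [OF \<theta>, of a b] zero order_trans [OF norm_ge_zero F(5)]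
      by (intro mult_left_mono) (auto simp: W_def)
    finally show "F b $ i = F a $ i" by simp
  next
    show "((\<lambda>t. F t $ i) \<longlongrightarrow> 0) at_infinity" using tendsto_vec_nth [OF F(2), of i] by simp
  qed
  have ode: "((\<lambda>t. F t $ 1) has_vector_derivative \<i> * cis (Im \<theta>) * ((z + m) * F x $ 2 - (W x *v F x) $ 2)) (at x)"
    "((\<lambda>t. F t $ 2) has_vector_derivative \<i> * cis (Im \<theta>) * ((z - m) * F x $ 1 - (W x *v F x) $ 1)) (at x)"
    if "x \<noteq> 0" for x using F(4) [OF that] by (auto simp: dirac_ode_def)
  have "F x $ 1 = 0 \<and> F x $ 2 = 0" for x
  proof -
    consider "z = of_real m" | "z = - of_real m" using z by (auto simp: power2_eq_iff)
    then show ?thesis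
    proof cases
      case 1
      have 2: "F x $ 2 = 0" for x by (rule vanish [of 2 1]) (use ode(2) 1 in simp)
      have "F x $ 1 = 0" for x by (rule vanish [of 1 2]) (use ode(1) 2 in simp)
      with 2 show ?thesis by blast
    next
      case 2
      have 1: "F x $ 1 = 0" for x by (rule vanish [of 1 2]) (use ode(1) 2 in simp)
      have "F x $ 2 = 0" for x by (rule vanish [of 2 1]) (use ode(2) 1 in simp)
      with 1 show ?thesis by blast
    qed
  qed
  then have "F x0 = 0" by (simp add: vec_eq_iff forall_2)
  then show False using F(3) by simp
qed

text \<open>A conservation law in place of operator symmetry: the current \<open>q\<close>, the real
  part of F1 times the conjugate of F2, has derivative - Im z |F|^2 for a Hermitian potential and
  vanishes at both ends.\<close>

lemma eigenvalue_real:
  assumes eig: "is_eigenvalue (dirac m V 0) z" shows "Im z = 0"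
proof (rule ccontr)
  assume Imz: "Im z \<noteq> 0"
  obtain F x0 B where F: "continuous_on UNIV F" "(F \<longlongrightarrow> 0) at_infinity" "F x0 \<noteq> 0"
    "\<And>x. x \<noteq> 0 \<Longrightarrow> dirac_ode m z (cis (Im 0)) (\<lambda>x. V (cis (Im 0) * of_real x)) F x" "\<And>x. norm (F x) \<le> B"
    using eigenfunction_bounded [of 0, OF _ eig] \<alpha> by (metis abs_zero zero_complex.sel(2))
  define q where "q = (\<lambda>t. inner (F t $ 1) (F t $ 2))"
  have qder: "(q has_vector_derivative - Im z * (norm (F x))\<^sup>2) (at x)" if x: "x \<noteq> 0" for x
  proof -
    define u where "u = V (of_real x) *v F x"
    have d: "((\<lambda>t. F t $ 1) has_vector_derivative \<i> * ((z + m) * F x $ 2 - u $ 2)) (at x)"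
      "((\<lambda>t. F t $ 2) has_vector_derivative \<i> * ((z - m) * F x $ 1 - u $ 1)) (at x)"
      using F(4) [OF x] by (simp_all add: dirac_ode_def u_def)
    have "V (of_real x) $ i $ j = cnj (V (of_real x) $ j $ i)" for i j
      using adm x unfolding admissible_potential_def by blast
    then have h: "V (of_real x) $ 2 $ 1 = cnj (V (of_real x) $ 1 $ 2)"
      "Im (V (of_real x) $ 1 $ 1) = 0" "Im (V (of_real x) $ 2 $ 2) = 0"
      by (metis, metis cnj.simps(2) equal_neg_zero, metis cnj.simps(2) equal_neg_zero)
    have herm: "Im (u $ 1 * cnj (F x $ 1) + u $ 2 * cnj (F x $ 2)) = 0"
      unfolding u_def matrix_vector_nth2 h(1) using h(2,3) by (simp add: algebra_simps)
    have "(q has_vector_derivative (inner (F x $ 1) (\<i> * ((z - m) * F x $ 1 - u $ 1))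
        + inner (\<i> * ((z + m) * F x $ 2 - u $ 2)) (F x $ 2))) (at x)"
      unfolding q_def by (rule bounded_bilinear.has_vector_derivative [OF bounded_bilinear_inner d])
    moreover have "inner (F x $ 1) (\<i> * ((z - m) * F x $ 1 - u $ 1)) + inner (\<i> * ((z + m) * F x $ 2 - u $ 2)) (F x $ 2)
      = - Im z * (norm (F x))\<^sup>2"
      using herm unfolding norm_cvec2 cmod_power2 inner_complex_def
      by (simp add: power2_eq_square algebra_simps)
    ultimately show ?thesis by simp
  qed
  have qc: "continuous_on UNIV q" unfolding q_def by (intro continuous_intros F)
  have qlim: "(q \<longlongrightarrow> 0) at_infinity"
    unfolding q_def using tendsto_inner [OF tendsto_vec_nth [OF F(2), of 1] tendsto_vec_nth [OF F(2), of 2]] by simp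
  have nc: "continuous_on S (\<lambda>x. (norm (F x))\<^sup>2)" for S
    by (intro continuous_intros continuous_on_subset [OF F(1)]) auto
  \<comment> \<open>A fixed positive mass around a point where F does not vanish, against which the
    current at the ends becomes small.\<close>
  define c where "c = integral {x0 - 1..x0 + 1} (\<lambda>x. (norm (F x))\<^sup>2)"
  have "c \<noteq> 0"
    unfolding c_def using F(3) nc by (subst integral_eq_0_iff) auto
  moreover have "0 \<le> c" unfolding c_def by (intro integral_nonneg integrable_continuous_real nc) auto
  ultimately have c: "0 < c" by simp
  then have e: "0 < \<bar>Im z\<bar> * c / 2" using Imz by simp
  obtain R where R: "\<And>x. R \<le> \<bar>x\<bar> \<Longrightarrow> \<bar>q x\<bar> < \<bar>Im z\<bar> * c / 2"
    using tendstoD [OF qlim e] by (auto simp: eventually_at_infinity)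
  define y where "y = max \<bar>R\<bar> (\<bar>x0\<bar> + 1)"
  have y: "R \<le> \<bar>y\<bar>" "R \<le> \<bar>- y\<bar>" "- y \<le> y" "- y \<le> x0 - 1" "x0 + 1 \<le> y" by (auto simp: y_def)
  have "((\<lambda>x. - Im z * (norm (F x))\<^sup>2) has_integral (q y - q (- y))) {- y..y}"
    by (rule fundamental_theorem_of_calculus_interior_strong [of "{0}"])
      (use y qder continuous_on_subset [OF qc] in auto)
  from integral_unique [OF this]
  have eq: "- Im z * integral {- y..y} (\<lambda>x. (norm (F x))\<^sup>2) = q y - q (- y)" by simp
  have "c \<le> integral {- y..y} (\<lambda>x. (norm (F x))\<^sup>2)"
    unfolding c_def by (rule integral_subset_le) (use y nc in \<open>auto intro!: integrable_continuous_real\<close>)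
  then have "\<bar>Im z\<bar> * c \<le> \<bar>Im z\<bar> * integral {- y..y} (\<lambda>x. (norm (F x))\<^sup>2)" by (intro mult_left_mono) auto
  also have "\<dots> = \<bar>q y - q (- y)\<bar>"
    using c \<open>c \<le> _\<close> unfolding eq [symmetric] by (simp add: abs_mult)
  also have "\<dots> < \<bar>Im z\<bar> * c" using R [OF y(1)] R [OF y(2)] by linarith
  finally show False by simp
qed

text \<open>An eigenvalue on an angle up to \<phi> is handled by monotonicity of the norms. One on a
  larger angle is rotated down, which works because z in D means that \<kappa>\<zeta> is real on
  some ray of angle between 0 and \<phi>.\<close>

lemma resonance_bound:
  assumes z: "z \<in> resonances \<alpha> m V" "z \<in> D_region m \<phi>" and \<phi>: "0 \<le> \<phi>" "\<phi> < \<alpha>"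
  shows "z\<^sup>2 \<noteq> (of_real m)\<^sup>2 \<Longrightarrow> 4 * (cmod (z + of_real m) * cmod (z - of_real m))
      < (cmod (z + of_real m) + cmod (z - of_real m))\<^sup>2 * (ray_norm V \<phi>)\<^sup>2"
    and "z\<^sup>2 = (of_real m)\<^sup>2 \<Longrightarrow> m \<noteq> 0 \<and> ray_norm V \<phi> \<noteq> 0"
proof -
  obtain \<theta> where \<theta>: "0 < Im \<theta>" "Im \<theta> < \<alpha>" and eig: "is_eigenvalue (dirac m V \<theta>) z"
    using z(1) by (auto simp: resonances_def discrete_spectrum_def)
  then have \<theta>': "\<bar>Im \<theta>\<bar> < \<alpha>" by simp
  show "m \<noteq> 0 \<and> ray_norm V \<phi> \<noteq> 0" if "z\<^sup>2 = (of_real m)\<^sup>2"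
  proof
    show "m \<noteq> 0" using zero_not_eigenvalue_massless [OF \<theta>'] eig that by auto
    show "ray_norm V \<phi> \<noteq> 0"
    proof
      assume "ray_norm V \<phi> = 0"
      then have "ray_norm V (Im \<theta>) = 0" using ray_norm_zero [OF \<alpha> adm \<phi>] \<theta> by simp
      then show False using threshold_not_eigenvalue_free [OF \<theta>' _ that] eig by simp
    qed
  qed
  assume ne: "z\<^sup>2 \<noteq> (of_real m)\<^sup>2"
  show "4 * (cmod (z + of_real m) * cmod (z - of_real m))
      < (cmod (z + of_real m) + cmod (z - of_real m))\<^sup>2 * (ray_norm V \<phi>)\<^sup>2"
  proof (cases "Im \<theta> \<le> \<phi>")
    case True
    obtain \<kappa> where \<kappa>: "\<kappa>\<^sup>2 = z\<^sup>2 - (of_real m)\<^sup>2" "\<kappa> \<noteq> 0"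
      "1 + 3 / 128 * (1 - mode_angle m z \<kappa>) \<le> kernel_norm m z \<kappa> * ray_norm V (Im \<theta>)"
      using eigenvalue_gap [OF \<theta>' eig ne] by blast
    have "4 * (cmod (z + of_real m) * cmod (z - of_real m))
      < (cmod (z + of_real m) + cmod (z - of_real m))\<^sup>2 * (ray_norm V (Im \<theta>))\<^sup>2"
      by (rule kernel_norm_gap [OF \<kappa>])
    also have "\<dots> \<le> (cmod (z + of_real m) + cmod (z - of_real m))\<^sup>2 * (ray_norm V \<phi>)\<^sup>2"
      using \<theta> \<phi> True
      by (intro mult_left_mono power_mono ray_norm_mono [OF \<alpha> adm] ray_norm_nonneg) auto
    finally show ?thesis .
  next
    case False
    obtain p \<omega> where \<omega>: "0 \<le> Im \<omega>" "Im \<omega> \<le> \<phi>" and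
      zp: "z = csqrt (exp (-2 * \<omega>) * of_real (p\<^sup>2) + of_real (m\<^sup>2)) \<or>
        z = - csqrt (exp (-2 * \<omega>) * of_real (p\<^sup>2) + of_real (m\<^sup>2))"
      using z(2) by (auto simp: D_region_def)
    \<comment> \<open>A root of z^2 - m^2 = exp (-2 \<omega>) p^2 that is real on the ray of angle
      Im \<omega> and has positive imaginary part on the rays just above it.\<close>
    define \<kappa> where "\<kappa> = of_real \<bar>p\<bar> * exp (- \<omega>)"
    have "z\<^sup>2 = exp (-2 * \<omega>) * of_real (p\<^sup>2) + of_real (m\<^sup>2)" using zp by auto
    moreover have "\<kappa>\<^sup>2 = (of_real \<bar>p\<bar>)\<^sup>2 * (exp (- \<omega>))\<^sup>2"
      by (simp add: \<kappa>_def power_mult_distrib)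
    moreover have "(complex_of_real \<bar>p\<bar>)\<^sup>2 = of_real (p\<^sup>2)" by (simp flip: of_real_power)
    moreover have "(exp (- \<omega>))\<^sup>2 = exp (-2 * \<omega>)" by (simp add: power2_eq_square flip: exp_add)
    ultimately have \<kappa>: "\<kappa>\<^sup>2 = z\<^sup>2 - (of_real m)\<^sup>2" by simp
    then have \<kappa>0: "\<kappa> \<noteq> 0" using ne by auto
    then have p: "0 < \<bar>p\<bar>" by (simp add: \<kappa>_def)
    have rot: "cis \<psi> * \<kappa> = of_real (\<bar>p\<bar> * exp (- Re \<omega>)) * cis (\<psi> - Im \<omega>)" for \<psi>
    proof -
      have e: "exp (- \<omega>) = of_real (exp (- Re \<omega>)) * cis (- Im \<omega>)"
        using exp_eq_polar [of "- \<omega>"] by simp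
      have "cis \<psi> * \<kappa> = of_real (\<bar>p\<bar> * exp (- Re \<omega>)) * (cis \<psi> * cis (- Im \<omega>))"
        unfolding \<kappa>_def e by (simp only: of_real_mult mult_ac)
      then show ?thesis by (simp add: cis_mult)
    qed
    have gap: "1 + 3 / 128 * (1 - mode_angle m z \<kappa>) \<le> kernel_norm m z \<kappa> * ray_norm V \<psi>"
      if \<psi>: "\<phi> < \<psi>" "\<psi> \<le> Im \<theta>" for \<psi>
    proof (rule continuation_gap [OF \<alpha> adm \<theta> eig \<kappa> \<kappa>0 \<omega>(1)])
      show "Im (cis (Im \<omega>) * \<kappa>) = 0" unfolding rot by simp
      have "0 < sin (\<psi> - Im \<omega>)" using \<psi> \<omega> \<theta> \<alpha> by (intro sin_gt_zero) auto
      then show "0 < Im (cis \<psi> * \<kappa>)" unfolding rot using p by simp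
    qed (use \<psi> \<omega> in auto)
    have "isCont (ray_norm V) \<phi>"
      by (rule continuous_on_interior [OF ray_norm_continuous [OF \<alpha> adm]]) (use \<phi> \<alpha> in auto)
    then have "((\<lambda>\<psi>. kernel_norm m z \<kappa> * ray_norm V \<psi>) \<longlongrightarrow> kernel_norm m z \<kappa> * ray_norm V \<phi>) (at_right \<phi>)"
      by (intro tendsto_mult_left) (simp add: isCont_def filterlim_at_split)
    then have "1 + 3 / 128 * (1 - mode_angle m z \<kappa>) \<le> kernel_norm m z \<kappa> * ray_norm V \<phi>"
    proof (rule tendsto_lowerbound)
      show "\<forall>\<^sub>F \<psi> in at_right \<phi>. 1 + 3 / 128 * (1 - mode_angle m z \<kappa>) \<le> kernel_norm m z \<kappa> * ray_norm V \<psi>"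
        using gap False by (auto simp: eventually_at_right_field intro!: exI [of _ "Im \<theta>"])
    qed simp
    then show ?thesis by (rule kernel_norm_gap [OF \<kappa> \<kappa>0])
  qed
qed

end

theorem theorem5p3:
  fixes m \<alpha> :: real and V :: "complex \<Rightarrow> complex^2^2"
  assumes "0 \<le> m" and "0 < \<alpha>" and "\<alpha> < pi / 2"
    and "admissible_potential \<alpha> V"
  shows
    "(\<forall>\<theta>. 0 \<le> Im \<theta> \<and> Im \<theta> < \<alpha> \<and> v_inf \<alpha> V \<theta> < 1 \<longrightarrow>
       (let x = x_of (v_inf \<alpha> V \<theta>); r = r_of (v_inf \<alpha> V \<theta>);
            K1 = K_disk (m * r) (of_real (m * x)); K2 = K_disk (m * r) (of_real (- (m * x)))
        in K1 \<inter> K2 = {} \<and> resonances \<alpha> m V \<inter> D_region m (Im \<theta>) \<subseteq> K1 \<union> K2)) \<and>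
     (scalar_sign_definite \<alpha> V \<longrightarrow>
       (\<forall>\<theta>. 0 \<le> Im \<theta> \<and> Im \<theta> < \<alpha> \<longrightarrow> v_inf \<alpha> V \<theta> = ray_norm V (Im \<theta>))) \<and>
     (ray_norm V 0 < 1 \<longrightarrow>
       (let x0 = x_of (ray_norm V 0); r0 = r_of (ray_norm V 0);
            I1 = {- (m * (x0 + r0)) <..< - (m * (x0 - r0))}; I2 = {m * (x0 - r0) <..< m * (x0 + r0)}
        in I1 \<inter> I2 = {} \<and> {z. is_eigenvalue (dirac m V 0) z} \<subseteq> of_real ` (I1 \<union> I2))) \<and>
     (m = 0 \<and> ray_norm V 0 < 1 \<longrightarrow>
       (let \<phi>0 = Sup {Im \<theta> | \<theta>. 0 \<le> Im \<theta> \<and> Im \<theta> < \<alpha> \<and> v_inf \<alpha> V \<theta> < 1}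
        in 0 < \<phi>0 \<and> resonances \<alpha> m V \<inter> D_region m \<phi>0 = {}))"
proof (intro conjI allI impI)
  note m = assms(1) and \<alpha> = assms(2,3) and adm = assms(4)
  note vinf = v_inf_eq [OF \<alpha> adm]
  \<comment> \<open>For m = 0 both distances equal |z| and the disk condition reduces to v >
    1.\<close>
  have massless: "1 < v" if "z\<^sup>2 \<noteq> (of_real 0)\<^sup>2" "0 \<le> v"
    "4 * (cmod (z + of_real 0) * cmod (z - of_real 0)) < (cmod (z + of_real 0) + cmod (z - of_real 0))\<^sup>2 * v\<^sup>2" for z v
  proof (rule ccontr)
    assume "\<not> 1 < v"
    then have "v\<^sup>2 \<le> 1" using that by (simp add: power_le_one)
    then have "(cmod z + cmod z)\<^sup>2 * v\<^sup>2 \<le> (cmod z + cmod z)\<^sup>2 * 1" by (intro mult_left_mono) auto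
    then show False using that(3) by (simp add: power2_eq_square)
  qed
  {
    fix \<theta> assume \<theta>: "0 \<le> Im \<theta> \<and> Im \<theta> < \<alpha> \<and> v_inf \<alpha> V \<theta> < 1"
    define v where "v = v_inf \<alpha> V \<theta>"
    have veq: "v = ray_norm V (Im \<theta>)" using vinf \<theta> by (simp add: v_def)
    have v: "0 \<le> v" "v < 1" using \<theta> ray_norm_nonneg by (auto simp: veq v_def vinf)
    define x r where "x = x_of v" and "r = r_of v"
    have xr: "0 < x - r" "0 \<le> r" using x_minus_r_nonneg [OF v] by (auto simp: x_def r_def)
    \<comment> \<open>The imaginary axis separates the disks, since r < x.\<close>
    have "K_disk (m * r) (of_real (m * x)) \<inter> K_disk (m * r) (of_real (- (m * x))) = {}"
    proof (cases "m * r = 0")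
      case False
      then have "0 < m" using m by auto
      then have "0 < m * (x - r)" using xr by simp
      have False if w: "cmod (of_real (m * x) - w) \<le> m * r" "cmod (of_real (- (m * x)) - w) \<le> m * r" for w
      proof -
        have "m * x - Re w \<le> m * r" using order_trans [OF complex_Re_le_cmod w(1)] by simp
        moreover have "m * x + Re w \<le> m * r"
          using complex_Re_le_cmod [of "w - of_real (- (m * x))"]
            w(2) [unfolded norm_minus_commute [of "of_real (- (m * x))" w]] by simp
        ultimately show False using \<open>0 < m * (x - r)\<close> by (simp add: algebra_simps)
      qed
      then show ?thesis by (auto simp: K_disk_def dist_norm)
    qed (simp add: K_disk_def)
    moreover have "z \<in> K_disk (m * r) (of_real (m * x)) \<union> K_disk (m * r) (of_real (- (m * x)))"
      if z: "z \<in> resonances \<alpha> m V" "z \<in> D_region m (Im \<theta>)" for z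
    proof -
      note rb = resonance_bound [OF \<alpha> adm z, folded veq]
      have less: "4 * (cmod (z + of_real m) * cmod (z - of_real m)) < (cmod (z + of_real m) + cmod (z - of_real m))\<^sup>2 * v\<^sup>2"
      proof (cases "z\<^sup>2 = (of_real m)\<^sup>2")
        case True
        \<comment> \<open>At z = m or z = -m the left side is 0, so only positivity of the right
          side is needed.\<close>
        then have "m \<noteq> 0" "v \<noteq> 0" using rb(2) \<theta> by auto
        then show ?thesis using True by (auto simp: power2_eq_iff norm_mult)
      next
        case False
        then show ?thesis using rb(1) \<theta> by auto
      qed
      from Apollonius_disk [OF v m less]
      have "cmod (z - of_real (m * x)) < m * r \<or> cmod (z - of_real (- (m * x))) < m * r"
        by (simp add: x_def r_def)
      \<comment> \<open>Strictness excludes radius 0, for which \<open>K_disk\<close> is empty by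
        convention.\<close>
      moreover then have "m * r \<noteq> 0" using norm_ge_zero by (metis not_less)
      ultimately show ?thesis by (auto simp: K_disk_def dist_norm norm_minus_commute)
    qed
    ultimately show "let x = x_of (v_inf \<alpha> V \<theta>); r = r_of (v_inf \<alpha> V \<theta>);
            K1 = K_disk (m * r) (of_real (m * x)); K2 = K_disk (m * r) (of_real (- (m * x)))
        in K1 \<inter> K2 = {} \<and> resonances \<alpha> m V \<inter> D_region m (Im \<theta>) \<subseteq> K1 \<union> K2"
      unfolding Let_def v_def [symmetric] x_def [symmetric] r_def [symmetric] by blast
  }
  show "v_inf \<alpha> V \<theta> = ray_norm V (Im \<theta>)" if "0 \<le> Im \<theta> \<and> Im \<theta> < \<alpha>" for \<theta>
    using vinf that by blast
  {
    assume v1: "ray_norm V 0 < 1"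
    define v where "v = ray_norm V 0"
    have v: "0 \<le> v" "v < 1" using v1 ray_norm_nonneg by (auto simp: v_def)
    define x r where "x = x_of v" and "r = r_of v"
    have xr: "0 < x - r" "0 \<le> r" using x_minus_r_nonneg [OF v] by (auto simp: x_def r_def)
    then have mxr: "0 \<le> m * (x - r)" using m by simp
    have "{- (m * (x + r)) <..< - (m * (x - r))} \<inter> {m * (x - r) <..< m * (x + r)} = {}"
      using mxr by auto
    moreover have "z \<in> of_real ` ({- (m * (x + r)) <..< - (m * (x - r))} \<union> {m * (x - r) <..< m * (x + r)})"
      if eig: "is_eigenvalue (dirac m V 0) z" for z
    proof -
      have 0: "\<bar>Im 0\<bar> < \<alpha>" using \<alpha> by simp
      have "4 * (cmod (z + of_real m) * cmod (z - of_real m)) < (cmod (z + of_real m) + cmod (z - of_real m))\<^sup>2 * v\<^sup>2"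
      proof (cases "z\<^sup>2 = (of_real m)\<^sup>2")
        case True
        have "m \<noteq> 0" using zero_not_eigenvalue_massless [OF \<alpha> adm 0] eig True by auto
        moreover have "v \<noteq> 0"
          using threshold_not_eigenvalue_free [OF \<alpha> adm 0 _ True] eig by (auto simp: v_def)
        ultimately show ?thesis using True by (auto simp: power2_eq_iff norm_mult)
      next
        case False
        obtain \<kappa> where "\<kappa>\<^sup>2 = z\<^sup>2 - (of_real m)\<^sup>2" "\<kappa> \<noteq> 0"
          "1 + 3 / 128 * (1 - mode_angle m z \<kappa>) \<le> kernel_norm m z \<kappa> * ray_norm V (Im 0)"
          using eigenvalue_gap [OF \<alpha> adm 0 eig False] by blast
        from kernel_norm_gap [OF this] show ?thesis by (simp add: v_def)
      qed
      from Apollonius_disk [OF v m this]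
      have disk: "cmod (z - of_real (m * x)) < m * r \<or> cmod (z - of_real (- (m * x))) < m * r"
        by (simp add: x_def r_def)
      have zr: "z = of_real (Re z)" using eigenvalue_real [OF \<alpha> adm eig] by (simp add: complex_eq_iff)
      have "\<bar>Re z - m * x\<bar> < m * r \<or> \<bar>Re z + m * x\<bar> < m * r"
        using disk abs_Re_le_cmod [of "z - of_real (m * x)"] abs_Re_le_cmod [of "z - of_real (- (m * x))"] by auto
      then have "Re z \<in> {- (m * (x + r)) <..< - (m * (x - r))} \<union> {m * (x - r) <..< m * (x + r)}"
        by (auto simp: abs_less_iff algebra_simps)
      then show ?thesis by (subst zr) (rule imageI)
    qed
    ultimately show "let x0 = x_of (ray_norm V 0); r0 = r_of (ray_norm V 0);
            I1 = {- (m * (x0 + r0)) <..< - (m * (x0 - r0))}; I2 = {m * (x0 - r0) <..< m * (x0 + r0)}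
        in I1 \<inter> I2 = {} \<and> {z. is_eigenvalue (dirac m V 0) z} \<subseteq> of_real ` (I1 \<union> I2)"
      unfolding Let_def v_def [symmetric] x_def [symmetric] r_def [symmetric] by blast
  }
  {
    assume "m = 0 \<and> ray_norm V 0 < 1"
    then have m0: "m = 0" and v0: "ray_norm V 0 < 1" by auto
    define A where "A = {Im \<theta> | \<theta>. 0 \<le> Im \<theta> \<and> Im \<theta> < \<alpha> \<and> v_inf \<alpha> V \<theta> < 1}"
    have A_iff: "\<phi> \<in> A \<longleftrightarrow> 0 \<le> \<phi> \<and> \<phi> < \<alpha> \<and> ray_norm V \<phi> < 1" for \<phi>
    proof
      assume "\<phi> \<in> A"
      then show "0 \<le> \<phi> \<and> \<phi> < \<alpha> \<and> ray_norm V \<phi> < 1" using vinf by (auto simp: A_def)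
    next
      assume "0 \<le> \<phi> \<and> \<phi> < \<alpha> \<and> ray_norm V \<phi> < 1"
      then show "\<phi> \<in> A"
        unfolding A_def using vinf [of "Complex 0 \<phi>"] by (auto intro!: exI [of _ "Complex 0 \<phi>"])
    qed
    define \<phi>0 where "\<phi>0 = Sup A"
    have A: "A \<noteq> {}" "bdd_above A" using v0 \<alpha> by (auto simp: A_iff intro!: exI [of _ 0] bdd_aboveI [of _ \<alpha>])
    have cont: "isCont (ray_norm V) \<phi>" if "0 \<le> \<phi>" "\<phi> < \<alpha>" for \<phi>
      by (rule continuous_on_interior [OF ray_norm_continuous [OF \<alpha> adm]]) (use that \<alpha> in auto)
    have pos: "0 < \<phi>0"
    proof -
      have "(ray_norm V \<longlongrightarrow> ray_norm V 0) (at_right 0)"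
        using cont [of 0] \<alpha> by (simp add: isCont_def filterlim_at_split)
      then have "\<forall>\<^sub>F \<phi> in at_right 0. ray_norm V \<phi> < 1" using v0 by (rule order_tendstoD)
      moreover have "\<forall>\<^sub>F \<phi> in at_right 0. \<phi> < \<alpha>"
        using \<alpha> by (auto simp: eventually_at_right_field)
      moreover have "\<forall>\<^sub>F \<phi> in at_right 0. (0::real) < \<phi>" by (rule eventually_at_right_less)
      ultimately have "\<forall>\<^sub>F \<phi> in at_right 0. 0 < \<phi> \<and> \<phi> \<in> A"
        by eventually_elim (auto simp: A_iff)
      then obtain \<phi> where "0 < \<phi>" "\<phi> \<in> A" by (auto dest: eventually_happens)
      then show ?thesis unfolding \<phi>0_def using cSup_upper [OF _ A(2), of \<phi>] by simp
    qed
    have below: "ray_norm V \<phi> < 1" if \<phi>: "0 \<le> \<phi>" "\<phi> < \<phi>0" for \<phi>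
    proof -
      obtain \<phi>1 where "\<phi>1 \<in> A" "\<phi> < \<phi>1" using less_cSup_iff [OF A, of \<phi>] \<phi> by (auto simp: \<phi>0_def)
      then show ?thesis using ray_norm_mono [OF \<alpha> adm \<phi>(1), of \<phi>1] by (auto simp: A_iff)
    qed
    have False if z: "z \<in> resonances \<alpha> m V" "z \<in> D_region m \<phi>0" for z
    proof -
      obtain \<theta> where \<theta>: "0 < Im \<theta>" "Im \<theta> < \<alpha>" and eig: "is_eigenvalue (dirac m V \<theta>) z"
        using z(1) by (auto simp: resonances_def discrete_spectrum_def)
      then have \<theta>': "\<bar>Im \<theta>\<bar> < \<alpha>" by simp
      have ne: "z\<^sup>2 \<noteq> (of_real 0)\<^sup>2"
        using zero_not_eigenvalue_massless [OF \<alpha> adm \<theta>'] eig by (auto simp: m0)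
      show False
      \<comment> \<open>Below \<open>\<phi>0\<close> the norm on the ray of the eigenfunction is
        itself less than 1. Otherwise \<open>\<phi>0\<close> < \<alpha>, and the norm at
        \<open>\<phi>0\<close> is at most 1 by continuity, which still contradicts the strict
        bound.\<close>
      proof (cases "Im \<theta> < \<phi>0")
        case True
        obtain \<kappa> where "\<kappa>\<^sup>2 = z\<^sup>2 - (of_real 0)\<^sup>2" "\<kappa> \<noteq> 0"
          "1 + 3 / 128 * (1 - mode_angle 0 z \<kappa>) \<le> kernel_norm 0 z \<kappa> * ray_norm V (Im \<theta>)"
          using eigenvalue_gap [OF \<alpha> adm \<theta>' eig [unfolded m0] ne] by blast
        from massless [OF ne ray_norm_nonneg kernel_norm_gap [OF this]] below [of "Im \<theta>"] True \<theta>
        show False by simp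
      next
        case False
        then have \<phi>0: "0 \<le> \<phi>0" "\<phi>0 < \<alpha>" using pos \<theta> by auto
        have "ray_norm V \<phi>0 \<le> 1"
        proof (rule tendsto_upperbound)
          show "(ray_norm V \<longlongrightarrow> ray_norm V \<phi>0) (at_left \<phi>0)"
            using cont [OF \<phi>0] by (simp add: isCont_def filterlim_at_split)
          show "\<forall>\<^sub>F \<phi> in at_left \<phi>0. ray_norm V \<phi> \<le> 1"
            using below pos by (auto simp: eventually_at_left_field intro!: exI [of _ 0] less_imp_le)
        qed simp
        moreover have "1 < ray_norm V \<phi>0"
          using massless [OF ne ray_norm_nonneg resonance_bound(1) [OF \<alpha> adm z [unfolded m0] \<phi>0 ne]] .
        ultimately show False by simp
      qed
    qed
    then show "let \<phi>0 = Sup {Im \<theta> | \<theta>. 0 \<le> Im \<theta> \<and> Im \<theta> < \<alpha> \<and> v_inf \<alpha> V \<theta> < 1}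
        in 0 < \<phi>0 \<and> resonances \<alpha> m V \<inter> D_region m \<phi>0 = {}"
      using pos unfolding Let_def A_def [symmetric] \<phi>0_def [symmetric] by blast
  }
qed

end
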